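(* Let $n\ge 1$, $\alpha>0$, and let $\mu\ge 0$ be a Borel measure on $\mathbb{C}^n$ such that $\int_{\mathbb{C}^n}|K_{ph,\alpha}(z,w)|^2e^{-|w|^2/\alpha}\,d\mu(w)<\infty$ for every $z\in\mathbb{C}^n$. Then the Toeplitz operator $T_\mu$ on $\mathcal{PH}^2_\alpha(\mathbb{C}^n)$ belongs to the trace class $S_1$ if and only if $\mu(\mathbb{C}^n)<\infty$.
   Context: $dA$ is Lebesgue measure on $\mathbb{C}^n$, and $z\bar w=\sum_{j=1}^n z_j\overline{w_j}$. A function $f:\mathbb{C}^n\to\mathbb{C}$ is pluriharmonic if $\partial^2 f/\partial z_j\partial\bar z_k=0$ for all $j,k$; equivalently $f=g+\bar h$ with $g,h$ entire. $\mathcal{PH}^2_\alpha(\mathbb{C}^n)$ is the Hilbert space of pluriharmonic functions $f$ with $\|f\|_{2,\alpha}^2=\frac{1}{(\alpha\pi)^n}\int_{\mathbb{C}^n}|f(z)|^2e^{-|z|^2/\alpha}\,dA(z)<\infty$, with inner product $\langle f,g\rangle=\frac{1}{(\alpha\pi)^n}\int f\bar g\,e^{-|z|^2/\alpha}\,dA$ and reproducing kernel $K_{ph,\alpha}(z,w)=e^{z\bar w/\alpha}+e^{\bar z w/\alpha}-1$. The Toeplitz operator with symbol $\mu$ is $T_\mu f(z)=\int_{\mathbb{C}^n}K_{ph,\alpha}(z,w)f(w)e^{-|w|^2/\alpha}\,d\mu(w)$, which is defined at least for $f$ in the linear span of the kernels $K_{ph,\alpha}(\cdot,w)$, $w\in\mathbb{C}^n$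 (a dense subspace of $\mathcal{PH}^2_\alpha(\mathbb{C}^n)$). "$T_\mu\in S_1$" means that $T_\mu$ extends to a bounded operator on $\mathcal{PH}^2_\alpha(\mathbb{C}^n)$ which is trace class. *)

theory Defs
  imports "HOL-Analysis.Analysis"
begin

section \<open>Operators on a complex Hilbert space of functions\<close>

text \<open>
  A Hilbert space of complex-valued functions is given by its carrier \<open>H\<close> (with the pointwise
  vector space operations) and its inner product \<open>ip\<close>, linear in the first argument.  Operators are
  HOL functions of which only the restriction to \<open>H\<close> matters.
\<close>

definition hnorm :: "(('a \<Rightarrow> complex) \<Rightarrow> ('a \<Rightarrow> complex) \<Rightarrow> complex) \<Rightarrow> ('a \<Rightarrow> complex) \<Rightarrow> real" where
  "hnorm ip f = sqrt (Re (ip f f))"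

definition bounded_operator ::
  "('a \<Rightarrow> complex) set \<Rightarrow> (('a \<Rightarrow> complex) \<Rightarrow> ('a \<Rightarrow> complex) \<Rightarrow> complex)
    \<Rightarrow> (('a \<Rightarrow> complex) \<Rightarrow> ('a \<Rightarrow> complex)) \<Rightarrow> bool" where
  "bounded_operator H ip A \<longleftrightarrow>
     (\<forall>f\<in>H. A f \<in> H) \<and>
     (\<forall>f\<in>H. \<forall>g\<in>H. A (\<lambda>x. f x + g x) = (\<lambda>x. A f x + A g x)) \<and>
     (\<forall>c. \<forall>f\<in>H. A (\<lambda>x. c * f x) = (\<lambda>x. c * A f x)) \<and>
     (\<exists>C. \<forall>f\<in>H. hnorm ip (A f) \<le> C * hnorm ip f)"

definition is_adjoint ::
  "('a \<Rightarrow> complex) set \<Rightarrow> (('a \<Rightarrow> complex) \<Rightarrow> ('a \<Rightarrow> complex) \<Rightarrow> complex)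
    \<Rightarrow> (('a \<Rightarrow> complex) \<Rightarrow> ('a \<Rightarrow> complex)) \<Rightarrow> (('a \<Rightarrow> complex) \<Rightarrow> ('a \<Rightarrow> complex)) \<Rightarrow> bool" where
  "is_adjoint H ip A B \<longleftrightarrow>
     bounded_operator H ip B \<and> (\<forall>f\<in>H. \<forall>g\<in>H. ip (A f) g = ip f (B g))"

definition positive_operator ::
  "('a \<Rightarrow> complex) set \<Rightarrow> (('a \<Rightarrow> complex) \<Rightarrow> ('a \<Rightarrow> complex) \<Rightarrow> complex)
    \<Rightarrow> (('a \<Rightarrow> complex) \<Rightarrow> ('a \<Rightarrow> complex)) \<Rightarrow> bool" where
  "positive_operator H ip P \<longleftrightarrow>
     bounded_operator H ip P \<and> (\<forall>f\<in>H. ip (P f) f \<in> \<real>\<^sub>\<ge>\<^sub>0)"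

text \<open>\<open>P\<close> is \<open>|A|\<close>, the positive square root of \<open>A\<^sup>* A\<close>.\<close>

definition is_absolute_value ::
  "('a \<Rightarrow> complex) set \<Rightarrow> (('a \<Rightarrow> complex) \<Rightarrow> ('a \<Rightarrow> complex) \<Rightarrow> complex)
    \<Rightarrow> (('a \<Rightarrow> complex) \<Rightarrow> ('a \<Rightarrow> complex)) \<Rightarrow> (('a \<Rightarrow> complex) \<Rightarrow> ('a \<Rightarrow> complex)) \<Rightarrow> bool" where
  "is_absolute_value H ip A P \<longleftrightarrow>
     positive_operator H ip P \<and> (\<exists>B. is_adjoint H ip A B \<and> (\<forall>f\<in>H. P (P f) = B (A f)))"

text \<open>Orthonormal bases in the Hilbert space sense: maximal orthonormal subsets.\<close>

definition orthonormal_basis ::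
  "('a \<Rightarrow> complex) set \<Rightarrow> (('a \<Rightarrow> complex) \<Rightarrow> ('a \<Rightarrow> complex) \<Rightarrow> complex)
    \<Rightarrow> ('a \<Rightarrow> complex) set \<Rightarrow> bool" where
  "orthonormal_basis H ip E \<longleftrightarrow>
     E \<subseteq> H \<and>
     (\<forall>e\<in>E. \<forall>e'\<in>E. ip e e' = (if e = e' then 1 else 0)) \<and>
     (\<forall>f\<in>H. (\<forall>e\<in>E. ip f e = 0) \<longrightarrow> f = (\<lambda>x. 0))"

text \<open>
  \<open>A\<close> is trace class if the trace of \<open>|A|\<close>, the sum of \<open>\<langle>|A| e, e\<rangle>\<close> over an orthonormal basis,
  is finite.  As \<open>|A|\<close> is positive, the value of this sum does not depend on the choice of the basis.
\<close>

definition trace_class ::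
  "('a \<Rightarrow> complex) set \<Rightarrow> (('a \<Rightarrow> complex) \<Rightarrow> ('a \<Rightarrow> complex) \<Rightarrow> complex)
    \<Rightarrow> (('a \<Rightarrow> complex) \<Rightarrow> ('a \<Rightarrow> complex)) \<Rightarrow> bool" where
  "trace_class H ip A \<longleftrightarrow>
     bounded_operator H ip A \<and>
     (\<exists>P E. is_absolute_value H ip A P \<and> orthonormal_basis H ip E \<and>
            (\<lambda>e. Re (ip (P e) e)) summable_on E)"


section \<open>Pluriharmonic functions\<close>

definition wirtinger :: "'n \<Rightarrow> (complex ^ 'n \<Rightarrow> complex) \<Rightarrow> complex ^ 'n \<Rightarrow> complex" where
  "wirtinger j f z =
     (frechet_derivative f (at z) (axis j 1) - \<i> * frechet_derivative f (at z) (axis j \<i>)) / 2"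

definition wirtinger_bar :: "'n \<Rightarrow> (complex ^ 'n \<Rightarrow> complex) \<Rightarrow> complex ^ 'n \<Rightarrow> complex" where
  "wirtinger_bar j f z =
     (frechet_derivative f (at z) (axis j 1) + \<i> * frechet_derivative f (at z) (axis j \<i>)) / 2"

text \<open>
  Twice continuously differentiable in the real sense; \<open>Basis\<close> consists of the vectors
  \<open>axis j 1\<close> and \<open>axis j \<i>\<close>.
\<close>

definition C2_function :: "(complex ^ 'n \<Rightarrow> complex) \<Rightarrow> bool" where
  "C2_function f \<longleftrightarrow>
     (\<forall>z. f differentiable at z) \<and>
     (\<forall>b\<in>Basis. \<forall>z. (\<lambda>w. frechet_derivative f (at w) b) differentiable at z) \<and>
     (\<forall>b\<in>Basis. \<forall>c\<in>Basis. continuous_on UNIV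
        (\<lambda>z. frechet_derivative (\<lambda>w. frechet_derivative f (at w) b) (at z) c))"

text \<open>
  The regularity, implicit in the differential equation, is needed because
  \<^const>\<open>frechet_derivative\<close> is a total function, with arbitrary values off the points
  of differentiability.
\<close>

definition pluriharmonic :: "(complex ^ 'n \<Rightarrow> complex) \<Rightarrow> bool" where
  "pluriharmonic f \<longleftrightarrow>
     C2_function f \<and> (\<forall>j k z. wirtinger j (wirtinger_bar k f) z = 0)"


section \<open>The pluriharmonic Fock space and its Toeplitz operators\<close>

definition PH2 :: "real \<Rightarrow> (complex ^ 'n \<Rightarrow> complex) set" where
  "PH2 \<alpha> = {f. pluriharmonic f \<and>
     (\<integral>\<^sup>+ z. ennreal ((cmod (f z))\<^sup>2 * exp (- (norm z)\<^sup>2 / \<alpha>)) \<partial>lborel) < \<infinity>}"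

definition PH2_inner ::
  "real \<Rightarrow> (complex ^ 'n \<Rightarrow> complex) \<Rightarrow> (complex ^ 'n \<Rightarrow> complex) \<Rightarrow> complex" where
  "PH2_inner \<alpha> f g =
     (LINT z|lborel. f z * cnj (g z) * of_real (exp (- (norm z)\<^sup>2 / \<alpha>)))
       / of_real ((\<alpha> * pi) ^ CARD('n))"

definition hdot :: "complex ^ 'n \<Rightarrow> complex ^ 'n \<Rightarrow> complex" where
  "hdot z w = (\<Sum>j\<in>UNIV. z $ j * cnj (w $ j))"

definition Kph :: "real \<Rightarrow> complex ^ 'n \<Rightarrow> complex ^ 'n \<Rightarrow> complex" where
  "Kph \<alpha> z w = exp (hdot z w / of_real \<alpha>) + exp (hdot w z / of_real \<alpha>) - 1"

definition kernel_span :: "real \<Rightarrow> (complex ^ 'n \<Rightarrow> complex) set" where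
  "kernel_span \<alpha> = {(\<lambda>z. \<Sum>w\<in>S. c w * Kph \<alpha> z w) | S c. finite S}"

definition toeplitz ::
  "real \<Rightarrow> (complex ^ 'n) measure \<Rightarrow> (complex ^ 'n \<Rightarrow> complex) \<Rightarrow> complex ^ 'n \<Rightarrow> complex" where
  "toeplitz \<alpha> \<mu> f z =
     (LINT w|\<mu>. Kph \<alpha> z w * f w * of_real (exp (- (norm w)\<^sup>2 / \<alpha>)))"

text \<open>
  \<open>T\<^sub>\<mu> \<in> S\<^sub>1\<close>: the operator, densely defined on the span of the kernels, has a trace class extension
  to the whole space.
\<close>

definition toeplitz_trace_class :: "real \<Rightarrow> (complex ^ 'n) measure \<Rightarrow> bool" where
  "toeplitz_trace_class \<alpha> \<mu> \<longleftrightarrow>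
     (\<exists>A. trace_class (PH2 \<alpha>) (PH2_inner \<alpha>) A \<and>
          (\<forall>f\<in>kernel_span \<alpha>. A f = toeplitz \<alpha> \<mu> f))"

end

theory Submission
  imports Defs "HOL-Probability.Distributions" "HOL-Complex_Analysis.Cauchy_Integral_Formula"
    "HOL-Library.Function_Algebras"
begin

text \<open>
  Put \<open>d\<nu>(w) = e\<^bsup>-|w|\<^sup>2 / \<alpha>\<^esup> d\<mu>(w)\<close>.  By the reproducing property \<open>f(w) = \<langle>f, K\<^sub>w\<rangle>\<close>, the Toeplitz operator has the
  quadratic form \<open>\<langle>T\<^sub>\<mu> f, f\<rangle> = \<integral> |f|\<^sup>2 d\<nu>\<close>; hence it is positive, equals its own absolute value, and by Parseval has trace
  \<open>\<integral> \<Sum>\<^sub>e |e(w)|\<^sup>2 d\<nu>(w) = \<integral> K(w,w) d\<nu>(w) = \<integral> (2 - e\<^bsup>-|w|\<^sup>2 / \<alpha>\<^esup>) d\<mu>(w)\<close>, which lies between \<open>\<mu>(\<complex>\<^sup>n)\<close> and \<open>2 \<mu>(\<complex>\<^sup>n)\<close>.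

  The reproducing property comes from the decomposition \<open>f = g + h\<close> of a pluriharmonic function into a holomorphic
  and an antiholomorphic part, by the mean value property on circles, the rotation
  invariance of the Gaussian measure, and translation.  Conversely, a function reproduced by \<open>K\<close> is
  pluriharmonic, by differentiation under the integral; so \<open>PH\<^sup>2\<close> is exactly the space of
  square integrable functions reproduced by \<open>K\<close>, and completeness follows.
\<close>

section \<open>Wirtinger derivatives and pluriharmonic functions\<close>

text \<open>Membership in the space is tested throughout by the reproducing identity. Being an
  integral condition, it passes through limits and interchanges of integrals, where the differential
  equation is hard to follow.

  If \<mu> is finite, the operator must first be shown to map the space into itself. The form
  identity is therefore proved in the ambient L2, and testing it against kernels then places
  \<open>T f\<close> in the space.

  In the converse, the given operator \<open>A\<close> is tied to the Toeplitz integral only on the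
  span of the kernels, and the trace is that of some positive \<open>P\<close> with
  \<open>P (P f) = Q (A f)\<close>, \<open>Q\<close> an adjoint of \<open>A\<close>. Instead of
  identifying \<open>P\<close> with \<open>A\<close>, one-sided bounds are chained: density and
  Fatou's lemma bound the \<nu>-integral of |f|^2 by <A f, f>, a numerical range argument gives <A
  f, f> \<le> <P f, f>, and finite Parseval sums recover K(w,w) up to an error 1/2, which is
  affordable because K(w,w) \<ge> 1.\<close>

lemma axis_in_Basis_complex [simp]:
  "axis j (1::complex) \<in> Basis" "axis j \<i> \<in> Basis"
  by (auto simp: Basis_vec_def Basis_complex_def)

lemma vec_complex_decompose:
  fixes h :: "complex ^ 'n"
  shows "h = (\<Sum>j\<in>UNIV. Re (h $ j) *\<^sub>R axis j 1 + Im (h $ j) *\<^sub>R axis j \<i>)"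
proof -
  have "h $ i = (\<Sum>j\<in>UNIV. if i = j then h $ j else 0)" for i
    by simp
  also have "(\<Sum>j\<in>UNIV. if i = j then h $ j else 0) =
      (\<Sum>j\<in>UNIV. (Re (h $ j) *\<^sub>R axis j 1 + Im (h $ j) *\<^sub>R axis j \<i>) $ i)" for i
    by (intro sum.cong) (auto simp: axis_def complex_eq_iff)
  finally show ?thesis unfolding vec_eq_iff sum_component by blast
qed

text \<open>A real-linear map is the sum of a complex-linear and an antilinear one. For a Frechet
  derivative the coefficients are the two Wirtinger derivatives, so vanishing of the second family
  means complex differentiability.\<close>

lemma linear_Wirtinger_decompose:
  fixes D :: "complex ^ 'n \<Rightarrow> complex"
  assumes "linear D"
  shows "D h = (\<Sum>j\<in>UNIV. h $ j * ((D (axis j 1) - \<i> * D (axis j \<i>)) / 2))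
             + (\<Sum>j\<in>UNIV. cnj (h $ j) * ((D (axis j 1) + \<i> * D (axis j \<i>)) / 2))"
proof -
  have "D h = (\<Sum>j\<in>UNIV. Re (h $ j) *\<^sub>R D (axis j 1) + Im (h $ j) *\<^sub>R D (axis j \<i>))"
    by (subst vec_complex_decompose [of h])
       (simp add: linear_sum [OF assms] linear_add [OF assms] linear_cmul [OF assms])
  also have "\<dots> = (\<Sum>j\<in>UNIV. h $ j * ((D (axis j 1) - \<i> * D (axis j \<i>)) / 2)
      + cnj (h $ j) * ((D (axis j 1) + \<i> * D (axis j \<i>)) / 2))"
  proof (intro sum.cong refl)
    fix j
    have *: "x * ((A - \<i> * B) / 2) + y * ((A + \<i> * B) / 2) = (x + y) / 2 * A - \<i> * (x - y) / 2 * B"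
      for x y A B :: complex
      by (simp add: diff_divide_distrib add_divide_distrib algebra_simps)
    show "Re (h $ j) *\<^sub>R D (axis j 1) + Im (h $ j) *\<^sub>R D (axis j \<i>) =
      h $ j * ((D (axis j 1) - \<i> * D (axis j \<i>)) / 2) + cnj (h $ j) * ((D (axis j 1) + \<i> * D (axis j \<i>)) / 2)"
      unfolding * complex_add_cnj complex_diff_cnj
      by (simp add: scaleR_conv_of_real mult.left_commute [of \<i> _ \<i>])
  qed
  finally show ?thesis by (simp add: sum.distrib)
qed

lemma has_derivative_Wirtinger:
  fixes f :: "complex ^ 'n \<Rightarrow> complex"
  assumes "f differentiable (at z)"
  shows "(f has_derivative (\<lambda>h. (\<Sum>j\<in>UNIV. h $ j * wirtinger j f z)
             + (\<Sum>j\<in>UNIV. cnj (h $ j) * wirtinger_bar j f z))) (at z)"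
proof -
  have D: "(f has_derivative frechet_derivative f (at z)) (at z)"
    using assms by (simp add: frechet_derivative_works)
  then have "linear (frechet_derivative f (at z))"
    by (simp add: has_derivative_linear)
  then have "frechet_derivative f (at z) = (\<lambda>h. (\<Sum>j\<in>UNIV. h $ j * wirtinger j f z)
             + (\<Sum>j\<in>UNIV. cnj (h $ j) * wirtinger_bar j f z))"
    unfolding wirtinger_def wirtinger_bar_def by (intro ext linear_Wirtinger_decompose)
  with D show ?thesis by metis
qed

lemma frechet_derivative_directional:
  fixes f :: "'a::real_normed_vector \<Rightarrow> 'b::real_normed_vector"
  assumes "f differentiable (at (z + s *\<^sub>R a))"
  shows "((\<lambda>s. f (z + s *\<^sub>R a)) has_vector_derivative frechet_derivative f (at (z + s *\<^sub>R a)) a) (at s within S)"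
proof -
  have D: "(f has_derivative frechet_derivative f (at (z + s *\<^sub>R a))) (at (z + s *\<^sub>R a))"
    using assms by (simp add: frechet_derivative_works)
  have "((\<lambda>s. z + s *\<^sub>R a) has_derivative (\<lambda>h. h *\<^sub>R a)) (at s within S)"
    by (auto intro!: derivative_eq_intros)
  from has_derivative_compose [OF this D]
  have "((\<lambda>s. f (z + s *\<^sub>R a)) has_derivative (\<lambda>h. frechet_derivative f (at (z + s *\<^sub>R a)) (h *\<^sub>R a))) (at s within S)" .
  then show ?thesis
    using has_derivative_linear[OF D] by (simp add: has_vector_derivative_def linear_cmul)
qed

text \<open>
  The identity \<open>f (z + s a + t b) - f (z + t b) = \<integral>\<^sub>0\<^sup>s D\<^sub>a f (z + t b + x a) dx\<close> is differentiated first in \<open>t\<close>, under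
  the integral, and then in \<open>s\<close>.
\<close>

lemma symmetric_second_derivative:
  fixes f :: "complex ^ 'n \<Rightarrow> complex"
  assumes "C2_function f" "a \<in> Basis" "b \<in> Basis"
  shows "frechet_derivative (\<lambda>w. frechet_derivative f (at w) a) (at z) b
       = frechet_derivative (\<lambda>w. frechet_derivative f (at w) b) (at z) a"
proof -
  define Da where "Da w = frechet_derivative f (at w) a" for w
  define Db where "Db w = frechet_derivative f (at w) b" for w
  define Dba where "Dba w = frechet_derivative Da (at w) b" for w
  define Dab where "Dab w = frechet_derivative Db (at w) a" for w
  have diff: "f differentiable (at w)" "Da differentiable (at w)" "Db differentiable (at w)" for w
    using assms unfolding C2_function_def Da_def Db_def by auto
  have cont: "continuous_on UNIV Dba" "continuous_on UNIV Dab"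
    using assms unfolding C2_function_def Da_def Db_def Dba_def Dab_def by auto
  have contDa: "continuous_on UNIV Da"
    using diff(2) differentiable_imp_continuous_within by (auto simp: continuous_on_eq_continuous_within)
  have ftc: "f (z + t *\<^sub>R b + s *\<^sub>R a) - f (z + t *\<^sub>R b) = integral {0..s} (\<lambda>x. Da (z + t *\<^sub>R b + x *\<^sub>R a))" 
    if "0 \<le> s" for s t
  proof -
    have "((\<lambda>x. Da (z + t *\<^sub>R b + x *\<^sub>R a)) has_integral
        f (z + t *\<^sub>R b + s *\<^sub>R a) - f (z + t *\<^sub>R b + 0 *\<^sub>R a)) {0..s}"
      unfolding Da_def
      by (rule fundamental_theorem_of_calculus [OF that]) (rule frechet_derivative_directional [OF diff(1)])
    then show ?thesis by (simp add: integral_unique)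
  qed
  have eq: "Db (z + s *\<^sub>R a) - Db z = integral {0..s} (\<lambda>x. Dba (z + x *\<^sub>R a))" if "0 \<le> s" for s
  proof -
    have 1: "((\<lambda>t. f (z + t *\<^sub>R b + s *\<^sub>R a) - f (z + t *\<^sub>R b)) has_vector_derivative
        Db (z + s *\<^sub>R a) - Db z) (at 0)"
    proof (rule has_vector_derivative_diff)
      show "((\<lambda>t. f (z + t *\<^sub>R b + s *\<^sub>R a)) has_vector_derivative Db (z + s *\<^sub>R a)) (at 0)"
        using frechet_derivative_directional [OF diff(1), where z = "z + s *\<^sub>R a" and s = 0 and a = b and S = UNIV]
        by (simp add: Db_def add_ac)
      show "((\<lambda>t. f (z + t *\<^sub>R b)) has_vector_derivative Db z) (at 0)"
        using frechet_derivative_directional [OF diff(1), where z = z and s = 0 and a = b and S = UNIV]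
        by (simp add: Db_def)
    qed
    have 2: "((\<lambda>t. integral (cbox 0 s) (\<lambda>x. Da (z + t *\<^sub>R b + x *\<^sub>R a))) has_vector_derivative
      integral (cbox 0 s) (\<lambda>x. Dba (z + 0 *\<^sub>R b + x *\<^sub>R a))) (at 0 within UNIV)"
    proof (rule leibniz_rule_vector_derivative)
      show "((\<lambda>t. Da (z + t *\<^sub>R b + x *\<^sub>R a)) has_vector_derivative Dba (z + t *\<^sub>R b + x *\<^sub>R a)) (at t within UNIV)" for t x
        using frechet_derivative_directional [OF diff(2), where z = "z + x *\<^sub>R a" and s = t and a = b and S = UNIV]
        by (simp add: Dba_def add_ac)
      show "(\<lambda>x. Da (z + t *\<^sub>R b + x *\<^sub>R a)) integrable_on cbox 0 s" for t
        by (intro integrable_continuous continuous_on_compose2 [OF contDa] continuous_intros) auto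
      show "continuous_on (UNIV \<times> cbox 0 s) (\<lambda>(t, x). Dba (z + t *\<^sub>R b + x *\<^sub>R a))"
        unfolding split_beta
        by (intro continuous_on_compose2 [OF cont(1)] continuous_intros) auto
    qed auto
    show ?thesis
      using vector_derivative_unique_at [OF 1, of "integral {0..s} (\<lambda>x. Dba (z + x *\<^sub>R a))"]
        2 [folded ftc [OF that], simplified] unfolding ftc [OF that] by simp
  qed
  have contI: "continuous_on {0..1} (\<lambda>x. Dba (z + x *\<^sub>R a))"
    by (intro continuous_on_compose2 [OF cont(1)] continuous_intros) auto
  \<comment> \<open>\<open>eq\<close> holds only for nonnegative s, so both derivatives at 0 are
    taken within {0..1}; uniqueness of vector derivatives within a closed interval still identifies
    them.\<close>
  have "((\<lambda>s. Db z + integral {0..s} (\<lambda>x. Dba (z + x *\<^sub>R a))) has_vector_derivative 0 + Dba (z + 0 *\<^sub>R a)) (at 0 within {0..1})"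
    by (intro has_vector_derivative_add has_vector_derivative_const integral_has_vector_derivative [OF contI]) auto
  moreover have "((\<lambda>s. Db (z + s *\<^sub>R a)) has_vector_derivative Dab z) (at 0 within {0..1})"
    using frechet_derivative_directional [OF diff(3), where z = z and s = 0 and a = a and S = "{0..1}"] by (simp add: Dab_def)
  moreover have "Db (z + s *\<^sub>R a) = Db z + integral {0..s} (\<lambda>x. Dba (z + x *\<^sub>R a))" if "s \<in> {0..1}" for s
    using eq[of s] that by (simp add: algebra_simps)
  ultimately have "((\<lambda>s. Db (z + s *\<^sub>R a)) has_vector_derivative 0 + Dba (z + 0 *\<^sub>R a)) (at 0 within {0..1})"
      "((\<lambda>s. Db (z + s *\<^sub>R a)) has_vector_derivative Dab z) (at 0 within {0..1})"
    using has_vector_derivative_transform [of 0 "{0..1}" "\<lambda>s. Db (z + s *\<^sub>R a)"] by auto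
  then have "0 + Dba (z + 0 *\<^sub>R a) = Dab z"
    by (intro vector_derivative_unique_within_closed_interval [of 0 1 0]) auto
  then show ?thesis by (simp add: Dab_def Dba_def Da_def[abs_def] Db_def[abs_def])
qed

text \<open>Both Wirtinger operators have the shape (u + c v) / 2, with c = -\<i> or c = \<i>.
  Iterated derivatives can then be computed by rewriting with this one rule.\<close>

lemma frechet_derivative_half_combination:
  fixes u v :: "'a::real_normed_vector \<Rightarrow> complex"
  assumes "u differentiable (at z)" "v differentiable (at z)"
  shows "frechet_derivative (\<lambda>w. (u w + c * v w) / 2) (at z)
       = (\<lambda>h. (frechet_derivative u (at z) h + c * frechet_derivative v (at z) h) / 2)"
    and "(\<lambda>w. (u w + c * v w) / 2) differentiable (at z)"
proof -
  have "(u has_derivative frechet_derivative u (at z)) (at z)"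
       "(v has_derivative frechet_derivative v (at z)) (at z)"
    using assms by (simp_all add: frechet_derivative_works)
  then have *: "((\<lambda>w. (u w + c * v w) * (1/2)) has_derivative
     (\<lambda>h. (frechet_derivative u (at z) h + c * frechet_derivative v (at z) h) * (1/2))) (at z)"
    by (intro has_derivative_mult_left has_derivative_add has_derivative_mult_right)
  from frechet_derivative_at [OF *]
  show "frechet_derivative (\<lambda>w. (u w + c * v w) / 2) (at z)
       = (\<lambda>h. (frechet_derivative u (at z) h + c * frechet_derivative v (at z) h) / 2)"
    by simp
  show "(\<lambda>w. (u w + c * v w) / 2) differentiable (at z)"
    using * by (auto simp: differentiable_def)
qed

lemma wirtinger_alt: "wirtinger j f = (\<lambda>w. (frechet_derivative f (at w) (axis j 1) + (- \<i>) * frechet_derivative f (at w) (axis j \<i>)) / 2)"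
  by (simp add: wirtinger_def fun_eq_iff)

lemma wirtinger_bar_alt: "wirtinger_bar j f = (\<lambda>w. (frechet_derivative f (at w) (axis j 1) + \<i> * frechet_derivative f (at w) (axis j \<i>)) / 2)"
  by (simp add: wirtinger_bar_def fun_eq_iff)

lemma C2_function_wirtinger:
  fixes f :: "complex ^ 'n \<Rightarrow> complex"
  assumes f: "C2_function f"
  shows "wirtinger j f differentiable (at z)" "wirtinger_bar j f differentiable (at z)"
    and "continuous_on UNIV (wirtinger k (wirtinger j f))"
        "continuous_on UNIV (wirtinger_bar k (wirtinger_bar j f))"
    and wirtinger_bar_wirtinger_commute: "wirtinger_bar k (wirtinger j f) = wirtinger j (wirtinger_bar k f)"
proof -
  have d: "(\<lambda>w. frechet_derivative f (at w) b) differentiable (at z)" if "b \<in> Basis" for b z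
    using f that by (simp add: C2_function_def)
  have c: "continuous_on UNIV (\<lambda>z. frechet_derivative (\<lambda>w. frechet_derivative f (at w) b) (at z) c)"
    if "b \<in> Basis" "c \<in> Basis" for b c
    using f that by (simp add: C2_function_def)
  note D = frechet_derivative_half_combination [OF d d, OF axis_in_Basis_complex]
  show "wirtinger j f differentiable (at z)" "wirtinger_bar j f differentiable (at z)"
    unfolding wirtinger_alt wirtinger_bar_alt by (rule D)+
  note C = c [OF axis_in_Basis_complex(1) axis_in_Basis_complex(1)]
     c [OF axis_in_Basis_complex(1) axis_in_Basis_complex(2)]
     c [OF axis_in_Basis_complex(2) axis_in_Basis_complex(1)]
     c [OF axis_in_Basis_complex(2) axis_in_Basis_complex(2)]
  show "continuous_on UNIV (wirtinger k (wirtinger j f))"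
        "continuous_on UNIV (wirtinger_bar k (wirtinger_bar j f))"
    unfolding wirtinger_alt wirtinger_bar_alt D(1)
    by (intro continuous_intros C; simp)+
  show "wirtinger_bar k (wirtinger j f) = wirtinger j (wirtinger_bar k f)"
    unfolding wirtinger_alt wirtinger_bar_alt D(1)
    by (simp add: symmetric_second_derivative [OF f, of "axis j _" "axis k _"] field_simps)
qed

section \<open>Entire functions along complex lines and the splitting of pluriharmonic
  functions\<close>

text \<open>By Osgood's lemma this is holomorphy in several variables. The encoding offers what
  circle averages ask for, namely measurability and one-variable holomorphy, and it is visibly
  stable under products and translations.\<close>

definition line_entire :: "(complex ^ 'n \<Rightarrow> complex) \<Rightarrow> bool" where
  "line_entire G \<longleftrightarrow> continuous_on UNIV G \<and> (\<forall>z u. (\<lambda>s. G (z + s *s u)) holomorphic_on UNIV)"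

lemma bounded_linear_smult_vec: "bounded_linear (\<lambda>s::complex. s *s (u :: complex ^ 'n))"
proof -
  have "linear (\<lambda>s::complex. s *s u)"
    by (rule linearI) (simp_all add: vec_eq_iff algebra_simps)
  then show ?thesis by (simp add: linear_conv_bounded_linear)
qed

lemma has_derivative_smult_vec:
  "((\<lambda>s::complex. s *s (u :: complex ^ 'n)) has_derivative (\<lambda>h. h *s u)) F"
  by (rule bounded_linear_imp_has_derivative [OF bounded_linear_smult_vec])

lemma continuous_on_smult_vec [continuous_intros]:
  assumes "continuous_on S f" "continuous_on S g"
  shows "continuous_on S (\<lambda>x. f x *s (g x :: complex ^ 'n))"
  unfolding vector_scalar_mult_def by (intro continuous_intros assms)

text \<open>The Cauchy-Riemann equations at the point remove the antilinear part of the chain rule,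
  so the derivative in s is complex-linear. The real dilation t prepares the radial
  integration.\<close>

lemma has_field_derivative_along_line:
  fixes g :: "complex ^ 'n \<Rightarrow> complex" and t :: real
  assumes "g differentiable (at (t *\<^sub>R (z + s *s u)))"
    and "\<And>k. wirtinger_bar k g (t *\<^sub>R (z + s *s u)) = 0"
  shows "((\<lambda>s. g (t *\<^sub>R (z + s *s u))) has_field_derivative
      t * (\<Sum>k\<in>UNIV. u $ k * wirtinger k g (t *\<^sub>R (z + s *s u)))) (at s)"
proof -
  let ?p = "t *\<^sub>R (z + s *s u)"
  have D: "(g has_derivative (\<lambda>h. \<Sum>k\<in>UNIV. h $ k * wirtinger k g ?p)) (at ?p)"
    using has_derivative_Wirtinger [OF assms(1)] by (simp add: assms(2))
  have "((\<lambda>s. t *\<^sub>R (z + s *s u)) has_derivative (\<lambda>h. t *\<^sub>R (0 + h *s u))) (at s)"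
    by (intro has_derivative_scaleR_right has_derivative_add has_derivative_const has_derivative_smult_vec)
  from has_derivative_compose [OF this D]
  have "((\<lambda>s. g (t *\<^sub>R (z + s *s u))) has_derivative
      (\<lambda>h. \<Sum>k\<in>UNIV. (t *\<^sub>R (0 + h *s u)) $ k * wirtinger k g ?p)) (at s)" .
  moreover have "(\<lambda>h. \<Sum>k\<in>UNIV. (t *\<^sub>R (0 + h *s u)) $ k * wirtinger k g ?p) =
      (*) (t * (\<Sum>k\<in>UNIV. u $ k * wirtinger k g ?p))"
    by (simp add: fun_eq_iff sum_distrib_left sum_distrib_right scaleR_conv_of_real [where 'a = complex] mult_ac)
  ultimately show ?thesis
    by (simp add: has_field_derivative_def)
qed

text \<open>The function is the integral of the holomorphic 1-form with coefficients
  \<open>g j\<close> along the segment from 0 to z. The integrand is holomorphic along complex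
  lines, and the Leibniz rule carries this through the t-integral.\<close>

lemma line_entire_radial_primitive:
  fixes g :: "'n::finite \<Rightarrow> complex ^ 'n \<Rightarrow> complex"
  assumes diff: "\<And>j z. g j differentiable (at z)"
    and CR: "\<And>j k z. wirtinger_bar k (g j) z = 0"
    and cont: "\<And>j k. continuous_on UNIV (wirtinger k (g j))"
  shows "line_entire (\<lambda>z. integral {0..1} (\<lambda>t. \<Sum>j\<in>UNIV. z $ j * g j (t *\<^sub>R z)))"
proof -
  have contg: "continuous_on UNIV (g j)" for j
    by (intro continuous_at_imp_continuous_on ballI differentiable_imp_continuous_within diff)
  have "continuous_on UNIV (\<lambda>z. integral (cbox 0 (1::real)) (\<lambda>t. \<Sum>j\<in>UNIV. z $ j * g j (t *\<^sub>R z)))"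
    by (rule integral_continuous_on_param, unfold split_beta)
       (intro continuous_intros continuous_on_compose2 [OF contg]; simp)
  moreover have "(\<lambda>s. integral (cbox 0 (1::real)) (\<lambda>t. \<Sum>j\<in>UNIV. (z + s *s u) $ j * g j (t *\<^sub>R (z + s *s u))))
      holomorphic_on UNIV" for z u
  proof -
    define F where "F s t = (\<Sum>j\<in>UNIV. (z + s *s u) $ j * g j (t *\<^sub>R (z + s *s u)))" for s and t :: real
    define F' where "F' s t = (\<Sum>j\<in>UNIV. u $ j * g j (t *\<^sub>R (z + s *s u)) +
      (t * (\<Sum>k\<in>UNIV. u $ k * wirtinger k (g j) (t *\<^sub>R (z + s *s u)))) * (z + s *s u) $ j)" for s and t :: real
    have "((\<lambda>s. integral (cbox 0 1) (F s)) has_field_derivative integral (cbox 0 1) (F' s)) (at s within UNIV)" for s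
    proof (rule leibniz_rule_field_derivative)
      show "((\<lambda>s. F s t) has_field_derivative F' s t) (at s within UNIV)" for s t
      proof -
        have "((\<lambda>s. (z + s *s u) $ j) has_field_derivative u $ j) (at s)" for j
          by (auto intro!: derivative_eq_intros)
        then show ?thesis
          unfolding F_def F'_def
          by (intro DERIV_sum DERIV_mult has_field_derivative_along_line diff CR)
      qed
      show "F s integrable_on cbox 0 1" for s
        unfolding F_def
        by (intro integrable_continuous continuous_intros continuous_on_compose2 [OF contg]; simp)
      show "continuous_on (UNIV \<times> cbox 0 1) (\<lambda>(s, t). F' s t)"
        unfolding F'_def split_beta
        by (intro continuous_intros continuous_on_compose2 [OF contg] continuous_on_compose2 [OF cont]; simp)
    qed auto
    then show ?thesis
      unfolding F_def [abs_def] holomorphic_on_def by (auto simp: field_differentiable_def)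
  qed
  ultimately show ?thesis by (simp add: line_entire_def)
qed

lemma cnj_Wirtinger:
  assumes "u differentiable (at z)"
  shows "wirtinger k (\<lambda>w. cnj (u w)) z = cnj (wirtinger_bar k u z)"
    and "wirtinger_bar k (\<lambda>w. cnj (u w)) z = cnj (wirtinger k u z)"
    and "(\<lambda>w. cnj (u w)) differentiable (at z)"
proof -
  have "(u has_derivative frechet_derivative u (at z)) (at z)"
    using assms by (simp add: frechet_derivative_works)
  then have *: "((\<lambda>w. cnj (u w)) has_derivative (\<lambda>h. cnj (frechet_derivative u (at z) h))) (at z)"
    by (rule has_derivative_cnj)
  show "wirtinger k (\<lambda>w. cnj (u w)) z = cnj (wirtinger_bar k u z)"
    "wirtinger_bar k (\<lambda>w. cnj (u w)) z = cnj (wirtinger k u z)"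
    unfolding wirtinger_def wirtinger_bar_def frechet_derivative_at [OF *, symmetric] by simp_all
  show "(\<lambda>w. cnj (u w)) differentiable (at z)"
    using * by (auto simp: differentiable_def)
qed

text \<open>Pluriharmonicity makes the coefficients of the (1,0)-part of df holomorphic and those of
  the (0,1)-part antiholomorphic. Integrating both parts along the segment from 0 to z recovers f z
  - f 0. The constant f 0 is given to \<open>G\<close>; the normalisation \<open>H 0 = 0\<close>
  later makes the two parts orthogonal.\<close>

lemma pluriharmonic_decomposition:
  fixes f :: "complex ^ 'n \<Rightarrow> complex"
  assumes "pluriharmonic f"
  obtains G H where "line_entire G" "line_entire H" "H 0 = 0" "f = (\<lambda>z. G z + cnj (H z))"
proof -
  have C2: "C2_function f" and harm: "\<And>j k z. wirtinger j (wirtinger_bar k f) z = 0"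
    using assms by (auto simp: pluriharmonic_def)
  note d = C2_function_wirtinger(1,2) [OF C2]
  have df: "f differentiable (at z)" for z
    using C2 by (simp add: C2_function_def)
  have cont: "continuous_on UNIV (wirtinger j f)" "continuous_on UNIV (wirtinger_bar j f)" for j
    by (intro continuous_at_imp_continuous_on ballI differentiable_imp_continuous_within d)+
  define G where "G z = integral {0..1} (\<lambda>t. \<Sum>j\<in>UNIV. z $ j * wirtinger j f (t *\<^sub>R z))" for z
  define H where "H z = integral {0..1} (\<lambda>t. \<Sum>j\<in>UNIV. z $ j * cnj (wirtinger_bar j f (t *\<^sub>R z)))" for z
  have "line_entire G"
    unfolding G_def
  proof (rule line_entire_radial_primitive)
    show "wirtinger_bar k (wirtinger j f) z = 0" for j k z
      by (simp add: wirtinger_bar_wirtinger_commute [OF C2] harm)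
  qed (intro d C2_function_wirtinger(3) [OF C2])+
  then have G: "line_entire (\<lambda>z. f 0 + G z)"
    by (auto simp: line_entire_def intro!: continuous_intros holomorphic_intros)
  have H: "line_entire H"
    unfolding H_def
  proof (rule line_entire_radial_primitive)
    show "continuous_on UNIV (wirtinger k (\<lambda>z. cnj (wirtinger_bar j f z)))" for j k
      unfolding cnj_Wirtinger(1) [OF d(2), abs_def]
      by (intro continuous_intros C2_function_wirtinger(4) [OF C2])
  qed (simp_all add: cnj_Wirtinger d harm)
  have "f z = (f 0 + G z) + cnj (H z)" for z
  proof -
    let ?a = "\<lambda>t. \<Sum>j\<in>UNIV. z $ j * wirtinger j f (t *\<^sub>R z)"
    let ?b = "\<lambda>t. \<Sum>j\<in>UNIV. z $ j * cnj (wirtinger_bar j f (t *\<^sub>R z))"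
    have *: "(?a has_integral G z) {0..1}" "(?b has_integral H z) {0..1}"
      unfolding G_def H_def
      by (intro integrable_integral integrable_continuous_interval continuous_intros
            continuous_on_compose2 [OF cont(1)] continuous_on_compose2 [OF cont(2)]; simp)+
    have "((\<lambda>t. ?a t + cnj (?b t)) has_integral (G z + cnj (H z))) {0..1}"
      by (intro has_integral_add * has_integral_cnj [unfolded o_def, THEN iffD2])
    moreover have "((\<lambda>t. ?a t + cnj (?b t)) has_integral (f (0 + 1 *\<^sub>R z) - f (0 + 0 *\<^sub>R z))) {0..1}"
    proof (rule fundamental_theorem_of_calculus)
      fix t :: real
      have "?a t + cnj (?b t) = frechet_derivative f (at (0 + t *\<^sub>R z)) z"
        unfolding frechet_derivative_at [OF has_derivative_Wirtinger [OF df], symmetric]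
        by simp
      then show "((\<lambda>t. f (0 + t *\<^sub>R z)) has_vector_derivative (?a t + cnj (?b t))) (at t within {0..1})"
        using frechet_derivative_directional [OF df, where z = 0 and s = t and a = z and S = "{0..1}"] by simp
    qed simp
    ultimately have "G z + cnj (H z) = f z - f 0"
      by (simp add: has_integral_unique)
    then show ?thesis by (simp add: algebra_simps)
  qed
  moreover have "H 0 = 0" by (simp add: H_def)
  ultimately show ?thesis
    using that [OF G H] by blast
qed

section \<open>Gaussian measure and the reproducing property\<close>

lemma nn_integral_lborel_translate:
  fixes f :: "'a::euclidean_space \<Rightarrow> ennreal"
  assumes [measurable]: "f \<in> borel_measurable borel"
  shows "(\<integral>\<^sup>+x. f (a + x) \<partial>lborel) = (\<integral>\<^sup>+x. f x \<partial>lborel)"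
proof -
  have "(\<integral>\<^sup>+x. f x \<partial>lborel) = (\<integral>\<^sup>+x. f x \<partial>distr lborel borel ((+) a))"
    by (simp add: lborel_distr_plus)
  also have "\<dots> = (\<integral>\<^sup>+x. f (a + x) \<partial>lborel)"
    by (subst nn_integral_distr) auto
  finally show ?thesis ..
qed

lemma nn_integral_lborel_reflect:
  fixes f :: "'a::euclidean_space \<Rightarrow> ennreal"
  assumes [measurable]: "f \<in> borel_measurable borel"
  shows "(\<integral>\<^sup>+x. f (a - x) \<partial>lborel) = (\<integral>\<^sup>+x. f x \<partial>lborel)"
proof -
  have "(\<integral>\<^sup>+x. f x \<partial>lborel) = (\<integral>\<^sup>+x. f x \<partial>distr lborel borel (\<lambda>x. a + (-1) *\<^sub>R x))"
    using lborel_affine [of "-1" a] by (simp add: density_1)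
  also have "\<dots> = (\<integral>\<^sup>+x. f (a - x) \<partial>lborel)"
    by (subst nn_integral_distr) auto
  finally show ?thesis ..
qed

text \<open>
  Uniqueness of Haar measure: integrate \<open>f (T x + y) 1\<^sub>B(y)\<close> over \<open>x\<close> and \<open>y\<close>, with \<open>B\<close> the unit
  ball, which is invariant under \<open>T\<close>.
\<close>

lemma nn_integral_lborel_linear_isometry:
  fixes T :: "'a::euclidean_space \<Rightarrow> 'a" and f :: "'a \<Rightarrow> ennreal"
  assumes T: "linear T" "\<And>x. norm (T x) = norm x"
    and f [measurable]: "f \<in> borel_measurable borel"
  shows "(\<integral>\<^sup>+x. f (T x) \<partial>lborel) = (\<integral>\<^sup>+x. f x \<partial>lborel)"
proof -
  interpret linear T by fact
  have [measurable]: "T \<in> borel_measurable borel"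
    using T(1) by (intro borel_measurable_continuous_onI) (simp add: linear_continuous_on linear_conv_bounded_linear)
  have "inj T"
    using T(2) by (metis linear_injective_0 [OF T(1)] norm_eq_zero)
  then have "surj T"
    using T(1) linear_injective_imp_surjective by blast
  then obtain S where S: "\<And>y. T (S y) = y" by (metis surjD)
  define g :: "'a \<Rightarrow> ennreal" where "g = indicator (ball 0 1)"
  have [measurable]: "g \<in> borel_measurable borel"
    unfolding g_def by (intro borel_measurable_indicator borel_open open_ball)
  have gT: "g (T x) = g x" for x by (simp add: g_def T(2) indicator_def)
  define V where "V = (\<integral>\<^sup>+x. g x \<partial>lborel)"
  have V: "V \<noteq> 0" "V \<noteq> top"
    unfolding V_def g_def by (simp_all add: emeasure_ball ennreal_eq_0_iff not_le)
  have "(\<integral>\<^sup>+x. f (T x) \<partial>lborel) * V = (\<integral>\<^sup>+y. (\<integral>\<^sup>+x. f (T x) \<partial>lborel) * g y \<partial>lborel)"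
    unfolding V_def by (rule nn_integral_cmult [symmetric]) simp
  also have "\<dots> = (\<integral>\<^sup>+y. (\<integral>\<^sup>+x. f (T x + y) * g y \<partial>lborel) \<partial>lborel)"
  proof (rule nn_integral_cong)
    \<comment> \<open>Shifting x by a preimage \<open>S y\<close> of y replaces \<open>T x\<close>
      by \<open>T x + y\<close> without changing the integral.\<close>
    fix y
    have "(\<integral>\<^sup>+x. f (T x) \<partial>lborel) = (\<integral>\<^sup>+x. f (T (S y + x)) \<partial>lborel)"
      by (rule nn_integral_lborel_translate [symmetric]) simp
    then show "(\<integral>\<^sup>+x. f (T x) \<partial>lborel) * g y = (\<integral>\<^sup>+x. f (T x + y) * g y \<partial>lborel)"
      by (simp add: nn_integral_multc add S add.commute)
  qed
  also have "\<dots> = (\<integral>\<^sup>+x. (\<integral>\<^sup>+y. f (T x + y) * g y \<partial>lborel) \<partial>lborel)"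
    by (intro lborel_pair.Fubini') simp
  also have "\<dots> = (\<integral>\<^sup>+x. (\<integral>\<^sup>+y. f y * g (y - T x) \<partial>lborel) \<partial>lborel)"
  proof (rule nn_integral_cong)
    fix x
    show "(\<integral>\<^sup>+y. f (T x + y) * g y \<partial>lborel) = (\<integral>\<^sup>+y. f y * g (y - T x) \<partial>lborel)"
      using nn_integral_lborel_translate [of "\<lambda>y. f y * g (y - T x)" "T x"] by simp
  qed
  also have "\<dots> = (\<integral>\<^sup>+y. (\<integral>\<^sup>+x. f y * g (y - T x) \<partial>lborel) \<partial>lborel)"
    by (intro lborel_pair.Fubini') simp
  also have "\<dots> = (\<integral>\<^sup>+y. f y * V \<partial>lborel)"
  proof (rule nn_integral_cong)
    \<comment> \<open>Here y - T x = T (S y - x), so invariance of the ball moves the dependence on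
      x out of \<open>T\<close>, and a reflection evaluates the integral.\<close>
    fix y
    have "g (y - T x) = g (S y - x)" for x
      using gT [of "S y - x"] by (simp add: diff S)
    then show "(\<integral>\<^sup>+x. f y * g (y - T x) \<partial>lborel) = f y * V"
      by (simp add: nn_integral_cmult nn_integral_lborel_reflect V_def)
  qed
  also have "\<dots> = (\<integral>\<^sup>+x. f x \<partial>lborel) * V"
    by (rule nn_integral_multc) simp
  finally show ?thesis
    using V by (simp add: ennreal_mult_cancel_left mult.commute [of _ V])
qed

section \<open>The Gaussian probability measure\<close>

lemma nn_integral_Gaussian_1D:
  assumes "\<alpha> > 0"
  shows "(\<integral>\<^sup>+x. ennreal (exp (- x\<^sup>2 / \<alpha>)) \<partial>lborel) = ennreal (sqrt (\<alpha> * pi))"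
proof -
  \<comment> \<open>The variance \<alpha> / 2 is chosen so that twice the variance is
    \<alpha>.\<close>
  have "exp (- x\<^sup>2 / \<alpha>) = sqrt (\<alpha> * pi) * normal_density 0 (sqrt (\<alpha> / 2)) x" for x
    using assms by (simp add: normal_density_def mult.commute)
  then have "(\<integral>\<^sup>+x. ennreal (exp (- x\<^sup>2 / \<alpha>)) \<partial>lborel)
      = ennreal (sqrt (\<alpha> * pi)) * (\<integral>\<^sup>+x. ennreal (normal_density 0 (sqrt (\<alpha> / 2)) x) \<partial>lborel)"
    using assms by (simp add: ennreal_mult nn_integral_cmult)
  also have "(\<integral>\<^sup>+x. ennreal (normal_density 0 (sqrt (\<alpha> / 2)) x) \<partial>lborel) = 1"
    using assms by (subst nn_integral_eq_integral) auto
  finally show ?thesis by simp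
qed

lemma nn_integral_Gaussian:
  assumes "\<alpha> > 0"
  shows "(\<integral>\<^sup>+x. ennreal (exp (- (norm x)\<^sup>2 / \<alpha>)) \<partial>(lborel :: 'a::euclidean_space measure))
    = ennreal (sqrt (\<alpha> * pi) ^ DIM('a))"
proof -
  have "exp (- (norm x)\<^sup>2 / \<alpha>) = (\<Prod>b\<in>Basis. exp (- (x \<bullet> b)\<^sup>2 / \<alpha>))" for x :: 'a
  proof -
    have "(norm x)\<^sup>2 = (\<Sum>b\<in>Basis. (x \<bullet> b)\<^sup>2)"
      unfolding power2_norm_eq_inner by (subst euclidean_inner) (simp add: power2_eq_square)
    then show ?thesis
      by (simp add: exp_sum sum_negf sum_divide_distrib flip: exp_sum)
  qed
  then have "(\<integral>\<^sup>+x. ennreal (exp (- (norm x)\<^sup>2 / \<alpha>)) \<partial>(lborel :: 'a measure))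
     = (\<integral>\<^sup>+x. (\<Prod>b\<in>Basis. ennreal (exp (- (x \<bullet> b)\<^sup>2 / \<alpha>))) \<partial>(lborel :: 'a measure))"
    by (simp add: prod_ennreal)
  also have "\<dots> = (\<Prod>b\<in>(Basis :: 'a set). \<integral>\<^sup>+x. ennreal (exp (- x\<^sup>2 / \<alpha>)) \<partial>lborel)"
    by (subst nn_integral_lborel_prod) auto
  also have "\<dots> = ennreal (sqrt (\<alpha> * pi)) ^ DIM('a)"
    unfolding nn_integral_Gaussian_1D [OF assms] by simp
  finally show ?thesis
    using assms by (simp add: ennreal_power del: real_sqrt_mult)
qed

text \<open>Weight and normalisation are put into one probability measure, so that
  \<open>PH2_inner\<close> becomes the plain L2 product of \<open>fock\<close>.\<close>

definition fock :: "real \<Rightarrow> (complex ^ 'n) measure" where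
  "fock \<alpha> = density lborel (\<lambda>z. ennreal (exp (- (norm z)\<^sup>2 / \<alpha>) / (\<alpha> * pi) ^ CARD('n)))"

lemma sets_fock [simp, measurable_cong]: "sets (fock \<alpha>) = sets borel"
  and space_fock [simp]: "space (fock \<alpha>) = UNIV"
  by (simp_all add: fock_def)

lemma nn_integral_fock:
  fixes f :: "complex ^ 'n \<Rightarrow> ennreal"
  assumes "f \<in> borel_measurable borel"
  shows "(\<integral>\<^sup>+z. f z \<partial>fock \<alpha>) = (\<integral>\<^sup>+z. ennreal (exp (- (norm z)\<^sup>2 / \<alpha>) / (\<alpha> * pi) ^ CARD('n)) * f z \<partial>lborel)"
  unfolding fock_def using assms by (subst nn_integral_density) auto

lemma prob_space_fock:
  assumes "\<alpha> > 0"
  shows "prob_space (fock \<alpha> :: (complex ^ 'n) measure)"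
proof (rule prob_spaceI)
  have "emeasure (fock \<alpha>) (space (fock \<alpha> :: (complex ^ 'n) measure)) = (\<integral>\<^sup>+z. 1 \<partial>(fock \<alpha> :: (complex ^ 'n) measure))"
    by simp
  also have "\<dots> = ennreal (1 / (\<alpha> * pi) ^ CARD('n)) * (\<integral>\<^sup>+z. ennreal (exp (- (norm z)\<^sup>2 / \<alpha>)) \<partial>(lborel :: (complex ^ 'n) measure))"
    using assms by (subst nn_integral_fock, simp, subst nn_integral_cmult [symmetric])
       (auto simp flip: ennreal_mult)
  also have "(\<integral>\<^sup>+z. ennreal (exp (- (norm z)\<^sup>2 / \<alpha>)) \<partial>(lborel :: (complex ^ 'n) measure))
      = ennreal ((\<alpha> * pi) ^ CARD('n))"
    \<comment> \<open>The real dimension is 2 CARD('n), which turns the power of sqrt (\<alpha> *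
      pi) into a power of \<alpha> * pi.\<close>
    using nn_integral_Gaussian [OF assms, where 'a = "complex ^ 'n"] assms
    by (simp add: power_mult mult.commute [of _ 2] del: real_sqrt_mult)
  also have "ennreal (1 / (\<alpha> * pi) ^ CARD('n)) * ennreal ((\<alpha> * pi) ^ CARD('n)) = 1"
    using assms by (simp flip: ennreal_mult)
  finally show "emeasure (fock \<alpha>) (space (fock \<alpha> :: (complex ^ 'n) measure)) = 1" .
qed

lemma norm_smult_vec: "norm (c *s (z :: complex ^ 'n)) = cmod c * norm z"
  by (simp add: norm_vec_def L2_set_def norm_mult power_mult_distrib real_sqrt_mult flip: sum_distrib_left)

lemma nn_integral_fock_rotate:
  fixes f :: "complex ^ 'n \<Rightarrow> ennreal"
  assumes [measurable]: "f \<in> borel_measurable borel" and "cmod c = 1"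
  shows "(\<integral>\<^sup>+z. f (c *s z) \<partial>fock \<alpha>) = (\<integral>\<^sup>+z. f z \<partial>fock \<alpha>)"
proof -
  have [measurable]: "(\<lambda>z::complex^'n. c *s z) \<in> borel_measurable borel"
    by (intro borel_measurable_continuous_onI continuous_intros)
  have "linear (\<lambda>z::complex^'n. c *s z)"
    by (rule linearI) (simp_all add: vec_eq_iff algebra_simps)
  then show ?thesis
    using nn_integral_lborel_linear_isometry [of "\<lambda>z. c *s z"
        "\<lambda>z. ennreal (exp (- (norm z)\<^sup>2 / \<alpha>) / (\<alpha> * pi) ^ CARD('n)) * f z"] assms(2)
    by (simp add: nn_integral_fock norm_smult_vec)
qed

section \<open>Circle averages and orthogonality of holomorphic and antiholomorphic parts\<close>

text \<open>The uniform distribution on [0,1]; composed with \<open>cis (2 * pi * t)\<close> it is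
  normalised arc length. As a density on the line it keeps the Borel sets of the line as measurable
  sets.\<close>

definition circle_param :: "real measure" where
  "circle_param = density lborel (\<lambda>t. ennreal (indicator {0..1} t))"

lemma sets_circle_param [simp, measurable_cong]: "sets circle_param = sets borel"
  and space_circle_param [simp]: "space circle_param = UNIV"
  by (simp_all add: circle_param_def)

lemma prob_space_circle_param: "prob_space circle_param"
  by (rule prob_spaceI) (simp add: circle_param_def emeasure_density ennreal_indicator)

lemma integrable_circle_param:
  fixes f :: "real \<Rightarrow> 'a::euclidean_space"
  assumes "continuous_on UNIV f"
  shows "integrable circle_param f"
    and "integral\<^sup>L circle_param f = integral {0..1} f"
proof -
  have m: "f \<in> borel_measurable borel"
    using assms by (rule borel_measurable_continuous_onI)
  have s: "set_integrable lborel {0..1} f"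
    unfolding set_integrable_def
    by (rule borel_integrable_compact) (auto intro: continuous_on_subset [OF assms])
  show "integrable circle_param f"
    unfolding circle_param_def using s m by (subst integrable_density) (auto simp: set_integrable_def)
  have "integral\<^sup>L circle_param f = (LINT t:{0..1}|lborel. f t)"
    unfolding circle_param_def set_lebesgue_integral_def using m by (subst integral_density) auto
  then show "integral\<^sup>L circle_param f = integral {0..1} f"
    using set_borel_integral_eq_integral(2) [OF s] by simp
qed

text \<open>Cauchy's formula at the centre of the unit circle: the derivative of the parametrisation
  cancels the denominator and leaves the constant 2 pi \<i>.\<close>

lemma circle_mean_value:
  assumes "h holomorphic_on UNIV"
  shows "integral\<^sup>L circle_param (\<lambda>t. h (cis (2 * pi * t))) = h 0"
proof -
  have "((\<lambda>u. h u / (u - 0)) has_contour_integral (2 * of_real pi * \<i> * h 0)) (circlepath 0 1)"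
    by (rule Cauchy_integral_circlepath_simple) (auto intro: holomorphic_on_subset [OF assms])
  then have "((\<lambda>t. h (cis (2 * pi * t)) * (2 * of_real pi * \<i>)) has_integral (2 * of_real pi * \<i> * h 0)) {0..1}"
    unfolding has_contour_integral
    by (rule has_integral_eq [rotated])
       (simp add: vector_derivative_circlepath, simp add: circlepath cis_conv_exp mult_ac)
  then have "((\<lambda>t. h (cis (2 * pi * t)) * (2 * of_real pi * \<i>) * (1 / (2 * of_real pi * \<i>)))
      has_integral (2 * of_real pi * \<i> * h 0) * (1 / (2 * of_real pi * \<i>))) {0..1}"
    by (rule has_integral_mult_left)
  then have "((\<lambda>t. h (cis (2 * pi * t))) has_integral h 0) {0..1}"
    by simp
  then have "integral {0..1} (\<lambda>t. h (cis (2 * pi * t))) = h 0"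
    by (rule integral_unique)
  moreover have "continuous_on UNIV (\<lambda>t. h (cis (2 * pi * t)))"
    by (rule continuous_on_compose2 [OF holomorphic_on_imp_continuous_on [OF assms]])
       (auto intro!: continuous_intros)
  ultimately show ?thesis by (simp add: integrable_circle_param)
qed
lemma borel_measurable_cnj [measurable]:
  "f \<in> borel_measurable M \<Longrightarrow> (\<lambda>x. cnj (f x)) \<in> borel_measurable M"
  by (rule borel_measurable_continuous_on) (auto intro!: continuous_intros)

lemma line_entire_intros:
  fixes G H :: "complex ^ 'n \<Rightarrow> complex"
  shows line_entire_const: "line_entire (\<lambda>z::complex ^ 'n. c)"
    and line_entire_mult: "line_entire G \<Longrightarrow> line_entire H \<Longrightarrow> line_entire (\<lambda>z. G z * H z)"
    and line_entire_exp: "line_entire G \<Longrightarrow> line_entire (\<lambda>z. exp (G z))"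
    and line_entire_translate: "line_entire G \<Longrightarrow> line_entire (\<lambda>z. G (a + z))"
    and line_entire_continuous: "line_entire G \<Longrightarrow> continuous_on UNIV G"
    and line_entire_measurable: "line_entire G \<Longrightarrow> G \<in> borel_measurable borel"
    and line_entire_line: "line_entire G \<Longrightarrow> (\<lambda>s. G (s *s z)) holomorphic_on UNIV"
proof -
  show "line_entire (\<lambda>z. G (a + z))" if G: "line_entire G"
    unfolding line_entire_def
  proof (intro conjI allI)
    show "continuous_on UNIV (\<lambda>z. G (a + z))"
      using G unfolding line_entire_def
      by (auto intro!: continuous_on_compose2 [of UNIV G] continuous_intros)
    show "(\<lambda>s. G (a + (z + s *s u))) holomorphic_on UNIV" for z u
      using G unfolding line_entire_def add.assoc [symmetric] by blast
  qed
  show "(\<lambda>s. G (s *s z)) holomorphic_on UNIV" if G: "line_entire G"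
    using G [unfolded line_entire_def, THEN conjunct2, rule_format, of 0 z] by simp
qed (auto simp: line_entire_def intro!: continuous_intros holomorphic_intros borel_measurable_continuous_onI)

lemma hdot_simps:
  "hdot (z + w) u = hdot z u + hdot w u" "hdot u (z + w) = hdot u z + hdot u w"
  "hdot (c *s z) u = c * hdot z u" "hdot 0 u = 0" "hdot u 0 = 0" "hdot z (- w) = - hdot z w"
  by (simp_all add: hdot_def sum.distrib sum_distrib_left sum_negf algebra_simps)

lemma cnj_hdot: "cnj (hdot z w) = hdot w z"
  by (simp add: hdot_def mult.commute)

lemma hdot_self: "hdot z z = of_real ((norm z)\<^sup>2)"
proof -
  have "(norm z)\<^sup>2 = (\<Sum>j\<in>UNIV. (cmod (z $ j))\<^sup>2)"
    by (simp add: norm_vec_def L2_set_def sum_nonneg)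
  then show ?thesis
    by (simp add: hdot_def flip: complex_norm_square)
qed

lemma norm_hdot_le: "cmod (hdot z w) \<le> norm z * norm w"
proof -
  have "cmod (hdot z w) \<le> (\<Sum>j\<in>UNIV. \<bar>cmod (z $ j)\<bar> * \<bar>cmod (w $ j)\<bar>)"
    unfolding hdot_def by (rule order_trans [OF norm_sum]) (simp add: norm_mult)
  also have "\<dots> \<le> norm z * norm w"
    unfolding norm_vec_def by (rule L2_set_mult_ineq)
  finally show ?thesis .
qed

lemma continuous_on_hdot [continuous_intros]:
  "continuous_on S f \<Longrightarrow> continuous_on S g \<Longrightarrow> continuous_on S (\<lambda>x. hdot (f x) (g x))"
  unfolding hdot_def by (intro continuous_intros)

lemma borel_measurable_hdot [measurable]:
  assumes [measurable]: "f \<in> borel_measurable M" "g \<in> borel_measurable M"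
  shows "(\<lambda>x. hdot (f x) (g x)) \<in> borel_measurable M"
  by (rule borel_measurable_continuous_Pair [OF assms]) (intro continuous_intros)

lemma line_entire_hdot: "line_entire (\<lambda>w. hdot w z / c)"
  unfolding line_entire_def hdot_simps divide_inverse
  by (intro conjI allI continuous_intros holomorphic_intros)

lemma pair_circle_fock: "\<alpha> > 0 \<Longrightarrow> pair_prob_space circle_param (fock \<alpha>)"
  by (simp add: pair_prob_space_def pair_sigma_finite_def prob_space_circle_param prob_space_fock
      prob_space_imp_sigma_finite)

lemma measurable_rotate [measurable]:
  "(\<lambda>x. cis (2 * pi * fst x) *s snd x) \<in> borel_measurable (borel \<Otimes>\<^sub>M (borel :: (complex ^ 'n) measure))"
  "(\<lambda>x. cis (2 * pi * snd x) *s fst x) \<in> borel_measurable ((borel :: (complex ^ 'n) measure) \<Otimes>\<^sub>M borel)"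
  unfolding borel_prod by (intro borel_measurable_continuous_onI continuous_intros)+

text \<open>Every rotation preserves \<open>fock\<close>, so averaging over rotations changes
  nothing, and Tonelli moves the average inside.\<close>

lemma nn_integral_fock_circle:
  fixes f :: "complex ^ 'n \<Rightarrow> ennreal"
  assumes "\<alpha> > 0" and [measurable]: "f \<in> borel_measurable borel"
  shows "(\<integral>\<^sup>+z. f z \<partial>fock \<alpha>) = (\<integral>\<^sup>+z. (\<integral>\<^sup>+t. f (cis (2 * pi * t) *s z) \<partial>circle_param) \<partial>fock \<alpha>)"
proof -
  interpret pair_prob_space circle_param "fock \<alpha> :: (complex ^ 'n) measure"
    by (rule pair_circle_fock) fact
  have "(\<integral>\<^sup>+z. f z \<partial>fock \<alpha>) = (\<integral>\<^sup>+t. (\<integral>\<^sup>+z. f z \<partial>fock \<alpha>) \<partial>circle_param)"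
    using M1.emeasure_space_1 by simp
  also have "\<dots> = (\<integral>\<^sup>+t. (\<integral>\<^sup>+z. f (cis (2 * pi * t) *s z) \<partial>fock \<alpha>) \<partial>circle_param)"
    by (simp add: nn_integral_fock_rotate)
  also have "\<dots> = (\<integral>\<^sup>+z. (\<integral>\<^sup>+t. f (cis (2 * pi * t) *s z) \<partial>circle_param) \<partial>fock \<alpha>)"
    by (rule Fubini' [symmetric]) (simp add: split_beta')
  finally show ?thesis .
qed

lemma integral_fock_rotate:
  fixes f :: "complex ^ 'n \<Rightarrow> complex"
  assumes [measurable]: "f \<in> borel_measurable borel" and "cmod c = 1"
  shows "(\<integral>z. f (c *s z) \<partial>fock \<alpha>) = (\<integral>z. f z \<partial>fock \<alpha>)"
proof -
  have [measurable]: "(\<lambda>z::complex^'n. c *s z) \<in> borel_measurable borel"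
    by (intro borel_measurable_continuous_onI continuous_intros)
  have "distr (fock \<alpha>) borel (\<lambda>z::complex^'n. c *s z) = fock \<alpha>"
  proof (rule measure_eqI)
    fix A :: "(complex ^ 'n) set" assume "A \<in> sets (distr (fock \<alpha>) borel (\<lambda>z::complex^'n. c *s z))"
    then have [measurable]: "A \<in> sets borel" by simp
    have "emeasure (distr (fock \<alpha>) borel (\<lambda>z::complex^'n. c *s z)) A
        = (\<integral>\<^sup>+z. indicator A z \<partial>distr (fock \<alpha>) borel (\<lambda>z::complex^'n. c *s z))"
      by simp
    also have "\<dots> = (\<integral>\<^sup>+z. indicator A z \<partial>fock \<alpha>)"
      using assms(2) by (subst nn_integral_distr) (simp_all add: nn_integral_fock_rotate [of "indicator A"])
    finally show "emeasure (distr (fock \<alpha>) borel (\<lambda>z::complex^'n. c *s z)) A = emeasure (fock \<alpha>) A"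
      by simp
  qed simp
  then have "(\<integral>z. f z \<partial>fock \<alpha>) = (\<integral>z. f z \<partial>distr (fock \<alpha>) borel (\<lambda>z::complex^'n. c *s z))"
    by simp
  also have "\<dots> = (\<integral>z. f (c *s z) \<partial>fock \<alpha>)"
    by (rule integral_distr) simp_all
  finally show ?thesis ..
qed

text \<open>Rotation invariance transfers integrability of \<open>G\<close> to the product with the
  circle. Fubini then leaves, for each z, the circle average of s \<mapsto> G (s z), which is
  \<open>G 0\<close>.\<close>

lemma line_entire_fock_mean:
  fixes G :: "complex ^ 'n \<Rightarrow> complex"
  assumes "\<alpha> > 0" and G: "line_entire G" and int: "integrable (fock \<alpha>) G"
  shows "(\<integral>z. G z \<partial>fock \<alpha>) = G 0"
proof -
  interpret pair_prob_space circle_param "fock \<alpha> :: (complex ^ 'n) measure"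
    by (rule pair_circle_fock) fact
  note [measurable] = line_entire_measurable [OF G]
  have 1: "integrable (circle_param \<Otimes>\<^sub>M fock \<alpha>) (\<lambda>(t, z). G (cis (2 * pi * t) *s z))"
  proof (rule integrableI_bounded)
    have "(\<integral>\<^sup>+x. ennreal (norm (case x of (t, z) \<Rightarrow> G (cis (2 * pi * t) *s z))) \<partial>(circle_param \<Otimes>\<^sub>M fock \<alpha>))
      = (\<integral>\<^sup>+t. (\<integral>\<^sup>+z. ennreal (norm (G (cis (2 * pi * t) *s z))) \<partial>fock \<alpha>) \<partial>circle_param)"
      by (subst M2.nn_integral_fst [symmetric]) (simp_all add: split_beta')
    also have "\<dots> = (\<integral>\<^sup>+z. ennreal (norm (G z)) \<partial>fock \<alpha>)"
      using M1.emeasure_space_1 by (simp add: nn_integral_fock_rotate [of "\<lambda>z. ennreal (norm (G z))"])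
    also have "\<dots> < \<infinity>"
      using int by (simp add: integrable_iff_bounded)
    finally show "(\<integral>\<^sup>+x. ennreal (norm (case x of (t, z) \<Rightarrow> G (cis (2 * pi * t) *s z))) \<partial>(circle_param \<Otimes>\<^sub>M fock \<alpha>)) < \<infinity>" .
  qed (simp add: split_beta')
  have "(\<integral>z. G z \<partial>fock \<alpha>) = (\<integral>t. (\<integral>z. G (cis (2 * pi * t) *s z) \<partial>fock \<alpha>) \<partial>circle_param)"
    using M1.prob_space by (simp add: integral_fock_rotate)
  also have "\<dots> = (\<integral>z. (\<integral>t. G (cis (2 * pi * t) *s z) \<partial>circle_param) \<partial>fock \<alpha>)"
    using Fubini_integral [OF 1] by simp
  also have "\<dots> = (\<integral>z. G 0 \<partial>(fock \<alpha> :: (complex ^ 'n) measure))"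
    by (simp add: circle_mean_value [OF line_entire_line [OF G]])
  finally show ?thesis using M2.prob_space by simp
qed

text \<open>On each circle both functions are continuous, hence integrable, and the cross term is
  twice the real part of the average of \<open>G z * H z\<close>, which equals its value 0 at the
  centre. Arguing circle by circle in extended nonnegative integrals presupposes no integrability,
  so square integrability of the sum passes to both parts.\<close>

lemma line_entire_fock_orthogonal:
  fixes G H :: "complex ^ 'n \<Rightarrow> complex"
  assumes "\<alpha> > 0" and G: "line_entire G" and H: "line_entire H" and "H 0 = 0"
  shows "(\<integral>\<^sup>+z. ennreal ((cmod (G z + cnj (H z)))\<^sup>2) \<partial>fock \<alpha>)
       = (\<integral>\<^sup>+z. ennreal ((cmod (G z))\<^sup>2) \<partial>fock \<alpha>) + (\<integral>\<^sup>+z. ennreal ((cmod (H z))\<^sup>2) \<partial>fock \<alpha>)"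
proof -
  note [measurable] = line_entire_measurable [OF G] line_entire_measurable [OF H]
  interpret pair_prob_space circle_param "fock \<alpha> :: (complex ^ 'n) measure"
    by (rule pair_circle_fock) fact
  have circ: "(\<integral>\<^sup>+t. ennreal ((cmod (a t + cnj (b t)))\<^sup>2) \<partial>circle_param)
      = (\<integral>\<^sup>+t. ennreal ((cmod (a t))\<^sup>2) \<partial>circle_param) + (\<integral>\<^sup>+t. ennreal ((cmod (b t))\<^sup>2) \<partial>circle_param)"
    if a: "continuous_on UNIV a" and b: "continuous_on UNIV b" and 0: "integral\<^sup>L circle_param (\<lambda>t. a t * b t) = 0" for a b
  proof -
    have int: "integrable circle_param (\<lambda>t. (cmod (a t + cnj (b t)))\<^sup>2)"
      "integrable circle_param (\<lambda>t. (cmod (a t))\<^sup>2)" "integrable circle_param (\<lambda>t. (cmod (b t))\<^sup>2)"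
      "integrable circle_param (\<lambda>t. a t * b t)"
      by (intro integrable_circle_param continuous_intros a b)+
    have "(cmod (a t + cnj (b t)))\<^sup>2 = (cmod (a t))\<^sup>2 + (cmod (b t))\<^sup>2 + 2 * Re (a t * b t)" for t
      unfolding cmod_power2 by (simp add: power2_eq_square algebra_simps)
    then have "integral\<^sup>L circle_param (\<lambda>t. (cmod (a t + cnj (b t)))\<^sup>2)
      = integral\<^sup>L circle_param (\<lambda>t. (cmod (a t))\<^sup>2) + integral\<^sup>L circle_param (\<lambda>t. (cmod (b t))\<^sup>2)
        + 2 * integral\<^sup>L circle_param (\<lambda>t. Re (a t * b t))"
      using int by (simp del: times_complex.simps)
    also have "integral\<^sup>L circle_param (\<lambda>t. Re (a t * b t)) = 0"
      using int(4) 0 by (simp only: integral_Re) simp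
    finally show ?thesis
      using int by (simp add: nn_integral_eq_integral flip: ennreal_plus)
  qed
  have "(\<integral>\<^sup>+z. ennreal ((cmod (G z + cnj (H z)))\<^sup>2) \<partial>fock \<alpha>)
    = (\<integral>\<^sup>+z. (\<integral>\<^sup>+t. ennreal ((cmod (G (cis (2 * pi * t) *s z) + cnj (H (cis (2 * pi * t) *s z))))\<^sup>2) \<partial>circle_param) \<partial>fock \<alpha>)"
    by (rule nn_integral_fock_circle) (use assms(1) in simp_all)
  also have "\<dots> = (\<integral>\<^sup>+z. (\<integral>\<^sup>+t. ennreal ((cmod (G (cis (2 * pi * t) *s z)))\<^sup>2) \<partial>circle_param)
     + (\<integral>\<^sup>+t. ennreal ((cmod (H (cis (2 * pi * t) *s z)))\<^sup>2) \<partial>circle_param) \<partial>fock \<alpha>)"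
  proof (rule nn_integral_cong, rule circ)
    fix z
    show "continuous_on UNIV (\<lambda>t. G (cis (2 * pi * t) *s z))" "continuous_on UNIV (\<lambda>t. H (cis (2 * pi * t) *s z))"
      by (auto intro!: continuous_on_compose2 [OF line_entire_continuous [OF G]]
         continuous_on_compose2 [OF line_entire_continuous [OF H]] continuous_intros)
    show "(\<integral>t. G (cis (2 * pi * t) *s z) * H (cis (2 * pi * t) *s z) \<partial>circle_param) = 0"
      using circle_mean_value [OF line_entire_line [OF line_entire_mult [OF G H], of z]] \<open>H 0 = 0\<close> by simp
  qed
  also have "\<dots> = (\<integral>\<^sup>+z. (\<integral>\<^sup>+t. ennreal ((cmod (G (cis (2 * pi * t) *s z)))\<^sup>2) \<partial>circle_param) \<partial>fock \<alpha>)
     + (\<integral>\<^sup>+z. (\<integral>\<^sup>+t. ennreal ((cmod (H (cis (2 * pi * t) *s z)))\<^sup>2) \<partial>circle_param) \<partial>fock \<alpha>)"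
    by (rule nn_integral_add) (auto intro!: M1.borel_measurable_nn_integral simp: split_beta')
  also have "\<dots> = (\<integral>\<^sup>+z. ennreal ((cmod (G z))\<^sup>2) \<partial>fock \<alpha>) + (\<integral>\<^sup>+z. ennreal ((cmod (H z))\<^sup>2) \<partial>fock \<alpha>)"
    using assms(1) by (simp add: nn_integral_fock_circle [of _ "\<lambda>z. ennreal ((cmod (G z))\<^sup>2)"]
      nn_integral_fock_circle [of _ "\<lambda>z. ennreal ((cmod (H z))\<^sup>2)"])
  finally show ?thesis .
qed
text \<open>Expanding |z + u|^2, the kernel factor absorbs |z|^2 and one of the two cross terms. The
  cross term that survives is holomorphic in u and vanishes at u = 0, so the mean value property
  applies after translation.\<close>

lemma fock_weight_translate:
  fixes z u :: "complex ^ 'n"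
  assumes "\<alpha> > 0"
  shows "exp (- (norm (z + u))\<^sup>2 / \<alpha>) *\<^sub>R exp (hdot z (z + u) / \<alpha>) = exp (- (norm u)\<^sup>2 / \<alpha>) *\<^sub>R exp (- hdot u z / \<alpha>)"
proof -
  have "complex_of_real (- (norm (z + u))\<^sup>2 / \<alpha>) + hdot z (z + u) / \<alpha>
      = of_real (- (norm u)\<^sup>2 / \<alpha>) + (- hdot u z / \<alpha>)"
    unfolding of_real_divide of_real_minus hdot_self [symmetric]
    by (simp add: hdot_simps add_divide_distrib diff_divide_distrib)
  then have "exp (complex_of_real (- (norm (z + u))\<^sup>2 / \<alpha>)) * exp (hdot z (z + u) / \<alpha>)
      = exp (complex_of_real (- (norm u)\<^sup>2 / \<alpha>)) * exp (- hdot u z / \<alpha>)"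
    by (simp only: exp_add [symmetric])
  then show ?thesis
    by (simp only: scaleR_conv_of_real exp_of_real)
qed

lemma fock_translate:
  fixes F :: "complex ^ 'n \<Rightarrow> complex"
  assumes "\<alpha> > 0" and [measurable]: "F \<in> borel_measurable borel"
  shows "integrable (fock \<alpha>) (\<lambda>u. F (z + u) * exp (- hdot u z / \<alpha>)) \<longleftrightarrow> integrable (fock \<alpha>) (\<lambda>w. F w * exp (hdot z w / \<alpha>))"
    and "(\<integral>u. F (z + u) * exp (- hdot u z / \<alpha>) \<partial>fock \<alpha>) = (\<integral>w. F w * exp (hdot z w / \<alpha>) \<partial>fock \<alpha>)"
proof -
  let ?c = "(\<alpha> * pi) ^ CARD('n)"
  let ?g = "\<lambda>w. (exp (- (norm w)\<^sup>2 / \<alpha>) / ?c) *\<^sub>R (F w * exp (hdot z w / \<alpha>))"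
  have eq: "?g (z + u) = (exp (- (norm u)\<^sup>2 / \<alpha>) / ?c) *\<^sub>R (F (z + u) * exp (- hdot u z / \<alpha>))" for u
    using fock_weight_translate [OF assms(1), of z u]
    by (simp add: scaleR_conv_of_real mult_ac)
  have [measurable]: "?g \<in> borel_measurable borel" by measurable
  have d: "distr lborel borel ((+) z) = (lborel :: (complex ^ 'n) measure)"
    by (rule lborel_distr_plus)
  have "integrable lborel ?g \<longleftrightarrow> integrable lborel (\<lambda>u. ?g (z + u))"
    by (subst d [symmetric], rule integrable_distr_eq) auto
  then show "integrable (fock \<alpha>) (\<lambda>u. F (z + u) * exp (- hdot u z / \<alpha>)) \<longleftrightarrow> integrable (fock \<alpha>) (\<lambda>w. F w * exp (hdot z w / \<alpha>))"
    unfolding eq fock_def using assms(1) by (subst (1 2) integrable_density) auto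
  have "integral\<^sup>L lborel ?g = integral\<^sup>L lborel (\<lambda>u. ?g (z + u))"
    by (subst d [symmetric], rule integral_distr) auto
  then show "(\<integral>u. F (z + u) * exp (- hdot u z / \<alpha>) \<partial>fock \<alpha>) = (\<integral>w. F w * exp (hdot z w / \<alpha>) \<partial>fock \<alpha>)"
    unfolding eq fock_def using assms(1) by (subst (1 2) integral_density) auto
qed

section \<open>Square integrability and the reproducing identity\<close>

text \<open>Membership in L2 of functions rather than classes. The extended integral cannot hide
  divergence behind the default value 0 of the Bochner integral.\<close>

definition sqint :: "'a measure \<Rightarrow> ('a \<Rightarrow> complex) \<Rightarrow> bool" where
  "sqint M f \<longleftrightarrow> f \<in> borel_measurable M \<and> (\<integral>\<^sup>+x. ennreal ((cmod (f x))\<^sup>2) \<partial>M) < \<infinity>"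

lemma sqint_iff: "sqint M f \<longleftrightarrow> f \<in> borel_measurable M \<and> integrable M (\<lambda>x. (cmod (f x))\<^sup>2)"
  by (auto simp: sqint_def integrable_iff_bounded)

lemma sqint_mult:
  assumes "sqint M f" "sqint M g"
  shows "integrable M (\<lambda>x. f x * g x)"
proof (rule Bochner_Integration.integrable_bound)
  show "integrable M (\<lambda>x. (cmod (f x))\<^sup>2 + (cmod (g x))\<^sup>2)"
    using assms by (auto simp: sqint_iff)
  show "(\<lambda>x. f x * g x) \<in> borel_measurable M"
    using assms by (auto simp: sqint_iff)
  have "cmod (f x) * cmod (g x) \<le> (cmod (f x))\<^sup>2 + (cmod (g x))\<^sup>2" for x
    using sum_squares_bound [of "cmod (f x)" "cmod (g x)"]
      mult_nonneg_nonneg [OF norm_ge_zero [of "f x"] norm_ge_zero [of "g x"]] by linarith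
  then show "AE x in M. norm (f x * g x) \<le> norm ((cmod (f x))\<^sup>2 + (cmod (g x))\<^sup>2)"
    by (simp add: norm_mult)
qed

lemma sqint_cmult: "sqint M f \<Longrightarrow> sqint M (\<lambda>x. c * f x)"
  by (auto simp: sqint_iff norm_mult power_mult_distrib)

lemma sqint_cnj: "sqint M f \<Longrightarrow> sqint M (\<lambda>x. cnj (f x))"
  by (auto simp: sqint_iff)

lemma sqint_add:
  assumes "sqint M f" "sqint M g"
  shows "sqint M (\<lambda>x. f x + g x)"
proof -
  have "integrable M (\<lambda>x. (cmod (f x + g x))\<^sup>2)"
  proof (rule Bochner_Integration.integrable_bound)
    show "integrable M (\<lambda>x. 2 * (cmod (f x))\<^sup>2 + 2 * (cmod (g x))\<^sup>2)"
      using assms by (auto simp: sqint_iff)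
    show "(\<lambda>x. (cmod (f x + g x))\<^sup>2) \<in> borel_measurable M"
      using assms by (auto simp: sqint_iff)
    have "(cmod (f x + g x))\<^sup>2 \<le> 2 * (cmod (f x))\<^sup>2 + 2 * (cmod (g x))\<^sup>2" for x
    proof -
      have "(cmod (f x + g x))\<^sup>2 \<le> (cmod (f x) + cmod (g x))\<^sup>2"
        by (intro power_mono norm_triangle_ineq) simp
      also have "\<dots> \<le> 2 * (cmod (f x))\<^sup>2 + 2 * (cmod (g x))\<^sup>2"
        using sum_squares_bound [of "cmod (f x)" "cmod (g x)"] by (simp add: power2_sum)
      finally show ?thesis .
    qed
    then show "AE x in M. norm ((cmod (f x + g x))\<^sup>2) \<le> norm (2 * (cmod (f x))\<^sup>2 + 2 * (cmod (g x))\<^sup>2)"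
      by simp
  qed
  then show ?thesis using assms by (auto simp: sqint_iff)
qed

lemma sqint_exp_norm:
  assumes "\<alpha> > 0"
  shows "sqint (fock \<alpha>) (\<lambda>w :: complex ^ 'n. of_real (exp (R * norm w)))"
  unfolding sqint_def
proof
  show "(\<lambda>w :: complex ^ 'n. complex_of_real (exp (R * norm w))) \<in> borel_measurable (fock \<alpha>)"
    by measurable
  let ?c = "(\<alpha> * pi) ^ CARD('n)"
  \<comment> \<open>Completing the square in t - 2 \<alpha> R: half of the Gaussian exponent pays
    for the exponential at the cost of the factor exp (2 \<alpha> R^2), and the other half, a
    Gaussian of parameter 2 \<alpha>, remains integrable.\<close>
  let ?C = "exp (2 * \<alpha> * R\<^sup>2) / ?c"
  have "exp (- t\<^sup>2 / \<alpha>) / ?c * (exp (R * t))\<^sup>2 \<le> ?C * exp (- t\<^sup>2 / (2 * \<alpha>))" for t :: real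
  proof -
    have "- t\<^sup>2 / \<alpha> + 2 * (R * t) \<le> 2 * \<alpha> * R\<^sup>2 + - t\<^sup>2 / (2 * \<alpha>)"
    proof -
      have "0 \<le> (t - 2 * \<alpha> * R)\<^sup>2 / (2 * \<alpha>)" using assms by simp
      also have "\<dots> = t\<^sup>2 / \<alpha> - t\<^sup>2 / (2 * \<alpha>) - 2 * (R * t) + 2 * \<alpha> * R\<^sup>2"
        using assms by (simp add: field_simps power2_eq_square)
      finally show ?thesis by simp
    qed
    then have "exp (- t\<^sup>2 / \<alpha>) * (exp (R * t))\<^sup>2 \<le> exp (2 * \<alpha> * R\<^sup>2) * exp (- t\<^sup>2 / (2 * \<alpha>))"
      by (simp add: exp_double [symmetric] flip: exp_add)
    then show ?thesis using assms by (simp add: divide_right_mono)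
  qed
  then have "(\<integral>\<^sup>+w. ennreal ((cmod (of_real (exp (R * norm w))))\<^sup>2) \<partial>(fock \<alpha> :: (complex ^ 'n) measure))
    \<le> (\<integral>\<^sup>+w. ennreal ?C * ennreal (exp (- (norm w)\<^sup>2 / (2 * \<alpha>))) \<partial>(lborel :: (complex ^ 'n) measure))"
    using assms by (subst nn_integral_fock) (auto intro!: nn_integral_mono simp flip: ennreal_mult)
  also have "\<dots> = ennreal ?C * (\<integral>\<^sup>+w. ennreal (exp (- (norm w)\<^sup>2 / (2 * \<alpha>))) \<partial>(lborel :: (complex ^ 'n) measure))"
    by (rule nn_integral_cmult) simp
  also have "\<dots> < \<infinity>"
    unfolding nn_integral_Gaussian [OF mult_pos_pos [OF zero_less_numeral assms]]
    by (simp add: ennreal_mult_less_top)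
  finally show "(\<integral>\<^sup>+w. ennreal ((cmod (of_real (exp (R * norm w))))\<^sup>2) \<partial>(fock \<alpha> :: (complex ^ 'n) measure)) < \<infinity>" .
qed

lemma sqint_bound:
  assumes "sqint M g" "f \<in> borel_measurable M" "\<And>x. cmod (f x) \<le> cmod (g x)"
  shows "sqint M f"
  unfolding sqint_def
proof
  have "(\<integral>\<^sup>+x. ennreal ((cmod (f x))\<^sup>2) \<partial>M) \<le> (\<integral>\<^sup>+x. ennreal ((cmod (g x))\<^sup>2) \<partial>M)"
    by (intro nn_integral_mono ennreal_leI power_mono assms) simp
  also have "\<dots> < \<infinity>" using assms by (simp add: sqint_def)
  finally show "(\<integral>\<^sup>+x. ennreal ((cmod (f x))\<^sup>2) \<partial>M) < \<infinity>" .
qed fact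

lemma sqint_exp_hdot:
  assumes "\<alpha> > 0"
  shows "sqint (fock \<alpha>) (\<lambda>w. exp (hdot z w / \<alpha>))" "sqint (fock \<alpha>) (\<lambda>w. exp (hdot w z / \<alpha>))"
proof -
  have *: "cmod (exp (b / \<alpha>)) \<le> cmod (of_real (exp (norm z / \<alpha> * norm w)))" if "cmod b \<le> norm z * norm w" for b w
  proof -
    have "Re (b / \<alpha>) \<le> cmod b / \<alpha>"
      using complex_Re_le_cmod [of "b / \<alpha>"] assms by (simp add: norm_divide)
    also have "\<dots> \<le> norm z / \<alpha> * norm w"
      using that assms by (simp add: field_simps)
    finally show ?thesis by simp
  qed
  show "sqint (fock \<alpha>) (\<lambda>w. exp (hdot z w / \<alpha>))" "sqint (fock \<alpha>) (\<lambda>w. exp (hdot w z / \<alpha>))"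
    using norm_hdot_le [of z] norm_hdot_le [of _ z]
    by (auto intro!: sqint_bound [OF sqint_exp_norm [OF assms, of "norm z / \<alpha>"]] * simp: mult.commute)
qed

lemma sqint_fock_const:
  assumes "\<alpha> > 0"
  shows "sqint (fock \<alpha>) (\<lambda>w :: complex ^ 'n. c)"
proof -
  interpret prob_space "fock \<alpha> :: (complex ^ 'n) measure" by (rule prob_space_fock) fact
  show ?thesis by (simp add: sqint_iff)
qed

lemma sqint_imp_integrable:
  assumes "\<alpha> > 0" "sqint (fock \<alpha>) f"
  shows "integrable (fock \<alpha>) f"
  using sqint_mult [OF assms(2) sqint_fock_const [OF assms(1), of 1]] by simp

lemma sqint_Kph:
  assumes "\<alpha> > 0"
  shows "sqint (fock \<alpha>) (Kph \<alpha> z)"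
  using sqint_add [OF sqint_add [OF sqint_exp_hdot(1) sqint_exp_hdot(2)] sqint_fock_const [of \<alpha> "-1"]] assms
  unfolding Kph_def by simp

lemma Kph_commute: "Kph \<alpha> z w = Kph \<alpha> w z"
  by (simp add: Kph_def add.commute)

lemma cnj_Kph [simp]: "cnj (Kph \<alpha> z w) = Kph \<alpha> z w"
  by (simp add: Kph_def exp_cnj cnj_hdot add.commute)

text \<open>The term \<open>exp (hdot z w / \<alpha>)\<close> yields G z by translation and the mean
  value property. The term \<open>exp (hdot w z / \<alpha>)\<close> is holomorphic in w and equals 1
  at w = 0, so it yields G 0, which the -1 in the kernel cancels.\<close>

lemma line_entire_reproducing:
  fixes G :: "complex ^ 'n \<Rightarrow> complex"
  assumes "\<alpha> > 0" and G: "line_entire G" and sq: "sqint (fock \<alpha>) G"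
  shows "(\<integral>w. Kph \<alpha> z w * G w \<partial>fock \<alpha>) = G z"
proof -
  note [measurable] = line_entire_measurable [OF G]
  let ?E = "\<lambda>w. exp (hdot z w / \<alpha>)" and ?E' = "\<lambda>w. exp (hdot w z / \<alpha>)"
  have int: "integrable (fock \<alpha>) (\<lambda>w. G w * ?E w)" "integrable (fock \<alpha>) (\<lambda>w. G w * ?E' w)"
      "integrable (fock \<alpha>) G"
    by (intro sqint_mult sqint_exp_hdot sq assms(1), intro sqint_mult sqint_exp_hdot sq assms(1),
        rule sqint_imp_integrable [OF assms(1) sq])
  have "(\<integral>w. G w * ?E w \<partial>fock \<alpha>) = (\<integral>u. G (z + u) * exp (- hdot u z / \<alpha>) \<partial>fock \<alpha>)"
    by (rule fock_translate [symmetric]) fact+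
  also have "\<dots> = G (z + 0) * exp (- hdot 0 z / \<alpha>)"
  proof (rule line_entire_fock_mean)
    show "line_entire (\<lambda>u. G (z + u) * exp (- hdot u z / \<alpha>))"
      using line_entire_mult [OF line_entire_translate [OF G] line_entire_exp [OF line_entire_hdot [of z "- \<alpha>"]]] by simp
    show "integrable (fock \<alpha>) (\<lambda>u. G (z + u) * exp (- hdot u z / \<alpha>))"
      using int(1) by (subst fock_translate(1)) (simp_all add: assms(1))
  qed fact
  finally have 1: "(\<integral>w. G w * ?E w \<partial>fock \<alpha>) = G z"
    by (simp add: hdot_simps)
  have 2: "(\<integral>w. G w * ?E' w \<partial>fock \<alpha>) = G 0"
    using line_entire_fock_mean [OF assms(1) line_entire_mult [OF G line_entire_exp [OF line_entire_hdot]] int(2)]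
    by (simp add: hdot_simps)
  have 3: "(\<integral>w. G w \<partial>fock \<alpha>) = G 0"
    using line_entire_fock_mean [OF assms(1) G int(3)] .
  have "(\<integral>w. Kph \<alpha> z w * G w \<partial>fock \<alpha>) = (\<integral>w. G w * ?E w + G w * ?E' w - G w \<partial>fock \<alpha>)"
    by (simp add: Kph_def algebra_simps)
  also have "\<dots> = G z"
    using int by (simp add: 1 2 3)
  finally show ?thesis .
qed

lemma PH2_iff_sqint:
  assumes "\<alpha> > 0"
  shows "f \<in> PH2 \<alpha> \<longleftrightarrow> pluriharmonic f \<and> sqint (fock \<alpha>) f"
proof -
  have "f \<in> borel_measurable borel \<and> ((\<integral>\<^sup>+ z. ennreal ((cmod (f z))\<^sup>2 * exp (- (norm z)\<^sup>2 / \<alpha>)) \<partial>lborel) < \<infinity> \<longleftrightarrow>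
      (\<integral>\<^sup>+ z. ennreal ((cmod (f z))\<^sup>2) \<partial>fock \<alpha>) < \<infinity>)" if "pluriharmonic f" for f :: "complex ^ 'n \<Rightarrow> complex"
  proof -
    let ?c = "(\<alpha> * pi) ^ CARD('n)"
    have "continuous_on UNIV f"
      using that unfolding pluriharmonic_def C2_function_def
      by (auto intro!: continuous_at_imp_continuous_on differentiable_imp_continuous_within)
    then have [measurable]: "f \<in> borel_measurable borel"
      by (rule borel_measurable_continuous_onI)
    define k where "k = ennreal (1 / ?c)"
    have k: "k \<noteq> 0" "k \<noteq> top"
      using assms by (auto simp: k_def)
    have "(\<integral>\<^sup>+ z. ennreal ((cmod (f z))\<^sup>2) \<partial>fock \<alpha>)
      = (\<integral>\<^sup>+ z. k * ennreal ((cmod (f z))\<^sup>2 * exp (- (norm z)\<^sup>2 / \<alpha>)) \<partial>lborel)"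
      unfolding k_def using assms
      by (subst nn_integral_fock) (auto intro!: nn_integral_cong simp: mult.commute simp flip: ennreal_mult)
    also have "\<dots> = k * (\<integral>\<^sup>+ z. ennreal ((cmod (f z))\<^sup>2 * exp (- (norm z)\<^sup>2 / \<alpha>)) \<partial>lborel)"
      by (rule nn_integral_cmult) simp
    finally show ?thesis
      using k by (auto simp: ennreal_mult_less_top less_top)
  qed
  then show ?thesis by (auto simp: PH2_def sqint_def measurable_cong_sets [OF sets_fock refl])
qed

text \<open>The kernel is real, so the antiholomorphic part follows from the holomorphic one by
  conjugation. Orthogonality is what makes each part square integrable by itself.\<close>

lemma PH2_reproducing:
  fixes f :: "complex ^ 'n \<Rightarrow> complex"
  assumes "\<alpha> > 0" "f \<in> PH2 \<alpha>"
  shows "(\<integral>w. Kph \<alpha> z w * f w \<partial>fock \<alpha>) = f z"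
proof -
  have f: "pluriharmonic f" "sqint (fock \<alpha>) f"
    using assms by (simp_all add: PH2_iff_sqint)
  obtain G H where G: "line_entire G" and H: "line_entire H" "H 0 = 0" and eq: "f = (\<lambda>z. G z + cnj (H z))"
    by (rule pluriharmonic_decomposition [OF f(1)])
  note [measurable] = line_entire_measurable [OF G] line_entire_measurable [OF H(1)]
  have sq: "sqint (fock \<alpha>) G" "sqint (fock \<alpha>) H"
    using f(2) line_entire_fock_orthogonal [OF assms(1) G H] by (auto simp: sqint_def eq)
  have "(\<integral>w. Kph \<alpha> z w * f w \<partial>fock \<alpha>) = (\<integral>w. Kph \<alpha> z w * G w + cnj (Kph \<alpha> z w * H w) \<partial>fock \<alpha>)"
    by (simp add: eq algebra_simps)
  also have "\<dots> = (\<integral>w. Kph \<alpha> z w * G w \<partial>fock \<alpha>) + cnj (\<integral>w. Kph \<alpha> z w * H w \<partial>fock \<alpha>)"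
    using sq assms(1) by (subst Bochner_Integration.integral_add)
      (auto intro!: sqint_mult sqint_Kph simp del: complex_cnj_mult)
  also have "\<dots> = f z"
    using sq G H assms(1) by (simp add: line_entire_reproducing eq)
  finally show ?thesis .
qed

text \<open>
  The regularity of \<open>z \<mapsto> \<integral> e\<^bsup>z w / \<alpha>\<^esup> \<phi>(w) dw\<close> only needs integrability against all exponentials
  \<open>e\<^bsup>R |w|\<^esup>\<close>, a condition which is stable under multiplication of \<open>\<phi>\<close> by the coordinates of \<open>w\<close>.
\<close>

definition exp_integrable :: "real \<Rightarrow> (complex ^ 'n \<Rightarrow> complex) \<Rightarrow> bool" where
  "exp_integrable \<alpha> \<phi> \<longleftrightarrow> \<phi> \<in> borel_measurable borel \<and>
     (\<forall>R. integrable (fock \<alpha>) (\<lambda>w. exp (R * norm w) * cmod (\<phi> w)))"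

definition laplace :: "real \<Rightarrow> (complex ^ 'n \<Rightarrow> complex) \<Rightarrow> complex ^ 'n \<Rightarrow> complex" where
  "laplace \<alpha> \<phi> z = (\<integral>w. exp (hdot z w / \<alpha>) * \<phi> w \<partial>fock \<alpha>)"

lemma sqint_imp_exp_integrable:
  assumes "\<alpha> > 0" "sqint (fock \<alpha>) \<phi>"
  shows "exp_integrable \<alpha> \<phi>"
  unfolding exp_integrable_def
proof (intro conjI allI)
  show "\<phi> \<in> borel_measurable borel"
    using assms(2) by (simp add: sqint_def measurable_cong_sets [OF sets_fock refl])
  have "integrable (fock \<alpha>) (\<lambda>w. of_real (exp (R * norm w)) * \<phi> w)" for R
    by (intro sqint_mult sqint_exp_norm assms)
  from integrable_norm [OF this]
  show "integrable (fock \<alpha>) (\<lambda>w. exp (R * norm w) * cmod (\<phi> w))" for R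
    by (simp add: norm_mult)
qed

text \<open>A coordinate is absorbed by raising R to R + 1, since |w_j| \<le> |w| \<le> exp |w|.
  This factor is the one produced by differentiating the transform.\<close>

lemma exp_integrable_coordinate:
  fixes \<phi> :: "complex ^ 'n \<Rightarrow> complex"
  assumes "\<alpha> > 0" "exp_integrable \<alpha> \<phi>"
  shows "exp_integrable \<alpha> (\<lambda>w. cnj (w $ j) / \<alpha> * \<phi> w)"
  unfolding exp_integrable_def
proof (intro conjI allI)
  have [measurable]: "\<phi> \<in> borel_measurable borel"
    using assms(2) by (simp add: exp_integrable_def)
  have [measurable]: "(\<lambda>w :: complex ^ 'n. cnj (w $ j)) \<in> borel_measurable borel"
    by (intro borel_measurable_continuous_onI continuous_intros)
  show m: "(\<lambda>w. cnj (w $ j) / \<alpha> * \<phi> w) \<in> borel_measurable borel"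
    by measurable
  note [measurable] = m
  show "integrable (fock \<alpha>) (\<lambda>w. exp (R * norm w) * cmod (cnj (w $ j) / \<alpha> * \<phi> w))" for R
  proof (rule Bochner_Integration.integrable_bound)
    show "integrable (fock \<alpha>) (\<lambda>w. (1 / \<alpha>) * (exp ((R + 1) * norm w) * cmod (\<phi> w)))"
      using assms(2) by (simp add: exp_integrable_def)
    show "(\<lambda>w. exp (R * norm w) * cmod (cnj (w $ j) / \<alpha> * \<phi> w)) \<in> borel_measurable (fock \<alpha>)"
      by measurable
    have "exp (R * norm w) * cmod (cnj (w $ j) / \<alpha> * \<phi> w) \<le> (1 / \<alpha>) * (exp ((R + 1) * norm w) * cmod (\<phi> w))" for w
    proof -
      have "cmod (w $ j) \<le> norm w" by (rule Finite_Cartesian_Product.norm_nth_le)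
      also have "norm w \<le> exp (norm w)" using exp_ge_add_one_self [of "norm w"] by linarith
      finally have "exp (R * norm w) * (cmod (w $ j) * cmod (\<phi> w) / \<alpha>) \<le> exp (R * norm w) * (exp (norm w) * cmod (\<phi> w) / \<alpha>)"
        using assms(1) by (intro mult_left_mono divide_right_mono mult_right_mono) auto
      then show ?thesis
        using assms(1) by (simp add: norm_mult norm_divide distrib_right exp_add)
    qed
    then show "AE w in fock \<alpha>. norm (exp (R * norm w) * cmod (cnj (w $ j) / \<alpha> * \<phi> w))
        \<le> norm ((1 / \<alpha>) * (exp ((R + 1) * norm w) * cmod (\<phi> w)))"
      using assms(1) by auto
  qed
qed

lemma cmod_exp_hdot_le:
  assumes "\<alpha> > 0"
  shows "cmod (exp (hdot z w / \<alpha>)) \<le> exp (norm z / \<alpha> * norm w)"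
proof -
  have "Re (hdot z w / \<alpha>) \<le> cmod (hdot z w / \<alpha>)" by (rule complex_Re_le_cmod)
  also have "\<dots> \<le> norm z / \<alpha> * norm w"
    using norm_hdot_le [of z w] assms by (simp add: norm_divide field_simps)
  finally show ?thesis by simp
qed

lemma integrable_laplace:
  assumes "\<alpha> > 0" "exp_integrable \<alpha> \<phi>"
  shows "integrable (fock \<alpha>) (\<lambda>w. exp (hdot z w / \<alpha>) * \<phi> w)"
proof (rule Bochner_Integration.integrable_bound)
  have [measurable]: "\<phi> \<in> borel_measurable borel"
    using assms(2) by (simp add: exp_integrable_def)
  show "integrable (fock \<alpha>) (\<lambda>w. exp (norm z / \<alpha> * norm w) * cmod (\<phi> w))"
    using assms(2) unfolding exp_integrable_def by blast
  show "(\<lambda>w. exp (hdot z w / \<alpha>) * \<phi> w) \<in> borel_measurable (fock \<alpha>)"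
    by measurable
  show "AE w in fock \<alpha>. norm (exp (hdot z w / \<alpha>) * \<phi> w) \<le> norm (exp (norm z / \<alpha> * norm w) * cmod (\<phi> w))"
  proof (rule AE_I2)
    fix w
    show "norm (exp (hdot z w / \<alpha>) * \<phi> w) \<le> norm (exp (norm z / \<alpha> * norm w) * cmod (\<phi> w))"
      using mult_right_mono [OF cmod_exp_hdot_le [OF assms(1), of z w] norm_ge_zero [of "\<phi> w"]]
      by (simp add: norm_mult del: norm_exp_eq_Re)
  qed
qed

lemma norm_exp_minus_linear_le: "cmod (exp b - 1 - b) \<le> exp (cmod b) * (cmod b)\<^sup>2" for b :: complex
proof -
  have "cmod (exp b - (\<Sum>i\<le>1. b ^ i / fact i)) \<le> exp \<bar>Re b\<bar> * (cmod b) ^ Suc 1 / fact 1"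
    by (rule Taylor_exp)
  also have "\<dots> \<le> exp (cmod b) * (cmod b)\<^sup>2"
    using abs_Re_le_cmod [of b] by (auto simp: power2_eq_square intro!: mult_right_mono)
  finally show ?thesis by (simp add: atMost_Suc algebra_simps)
qed

text \<open>The remainder of the integrand is e^a (e^b - 1 - b) \<phi>(w), with b linear in h. For
  |h| \<le> 1 it is at most |h|^2 times one integrable function, which bounds the remainder of the
  transform quadratically.\<close>

lemma has_derivative_laplace:
  fixes \<phi> :: "complex ^ 'n \<Rightarrow> complex"
  assumes "\<alpha> > 0" and \<phi>: "exp_integrable \<alpha> \<phi>"
  shows "(laplace \<alpha> \<phi> has_derivative (\<lambda>h. \<Sum>j\<in>UNIV. h $ j * laplace \<alpha> (\<lambda>w. cnj (w $ j) / \<alpha> * \<phi> w) z)) (at z)"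
    (is "(_ has_derivative ?D) _")
proof -
  have [measurable]: "\<phi> \<in> borel_measurable borel"
    using \<phi> by (simp add: exp_integrable_def)
  \<comment> \<open>In R, the summand norm z / \<alpha> comes from e^a, 1 / \<alpha> from e^|b| with
    |h| \<le> 1, and the last 1 from (norm w)^2 \<le> 2 exp (norm w). That 2 and the \<alpha>^2 of
    |b|^2 make up the factor in \<open>C\<close>.\<close>
  define R where "R = (norm z + 1) / \<alpha> + 1"
  define C where "C = (\<integral>w. (2 / \<alpha>\<^sup>2) * (exp (R * norm w) * cmod (\<phi> w)) \<partial>fock \<alpha>)"
  have intR: "integrable (fock \<alpha>) (\<lambda>w. (2 / \<alpha>\<^sup>2) * (exp (R * norm w) * cmod (\<phi> w)))"
    using \<phi> by (simp add: exp_integrable_def)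
  have C0: "0 \<le> C" unfolding C_def by (rule integral_nonneg_AE) auto
  have D: "?D h = (\<integral>w. exp (hdot z w / \<alpha>) * (hdot h w / \<alpha>) * \<phi> w \<partial>fock \<alpha>)"
    and intD: "integrable (fock \<alpha>) (\<lambda>w. exp (hdot z w / \<alpha>) * (hdot h w / \<alpha>) * \<phi> w)" for h
  proof -
    have eq: "exp (hdot z w / \<alpha>) * (hdot h w / \<alpha>) * \<phi> w
       = (\<Sum>j\<in>UNIV. h $ j * (exp (hdot z w / \<alpha>) * (cnj (w $ j) / \<alpha> * \<phi> w)))" for w
      unfolding hdot_def [of h] by (simp add: sum_distrib_left sum_distrib_right sum_divide_distrib mult_ac)
    show "?D h = (\<integral>w. exp (hdot z w / \<alpha>) * (hdot h w / \<alpha>) * \<phi> w \<partial>fock \<alpha>)"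
      unfolding eq laplace_def
      by (subst Bochner_Integration.integral_sum)
         (auto intro!: integrable_laplace exp_integrable_coordinate assms simp del: times_divide_eq_left)
    show "integrable (fock \<alpha>) (\<lambda>w. exp (hdot z w / \<alpha>) * (hdot h w / \<alpha>) * \<phi> w)"
      unfolding eq
      by (intro Bochner_Integration.integrable_sum Bochner_Integration.integrable_mult_right
          integrable_laplace exp_integrable_coordinate assms)
  qed
  have bound: "norm (laplace \<alpha> \<phi> (z + h) - laplace \<alpha> \<phi> z - ?D h) \<le> C * (norm h)\<^sup>2" if "norm h \<le> 1" for h
  proof -
    have int: "integrable (fock \<alpha>) (\<lambda>w. exp (hdot z w / \<alpha>) * \<phi> w)" "integrable (fock \<alpha>) (\<lambda>w. exp (hdot (z + h) w / \<alpha>) * \<phi> w)"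
      by (intro integrable_laplace assms)+
    let ?I = "\<lambda>w. exp (hdot (z + h) w / \<alpha>) * \<phi> w - exp (hdot z w / \<alpha>) * \<phi> w - exp (hdot z w / \<alpha>) * (hdot h w / \<alpha>) * \<phi> w"
    have "laplace \<alpha> \<phi> (z + h) - laplace \<alpha> \<phi> z - ?D h = (\<integral>w. ?I w \<partial>fock \<alpha>)"
      unfolding D unfolding laplace_def using int intD [of h] by simp
    also have "norm \<dots> \<le> (\<integral>w. (norm h)\<^sup>2 * ((2 / \<alpha>\<^sup>2) * (exp (R * norm w) * cmod (\<phi> w))) \<partial>fock \<alpha>)"
    proof (rule order_trans [OF integral_norm_bound integral_mono])
      show "integrable (fock \<alpha>) (\<lambda>w. norm (?I w))"
        by (intro integrable_norm Bochner_Integration.integrable_diff int intD)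
      show "integrable (fock \<alpha>) (\<lambda>w. (norm h)\<^sup>2 * ((2 / \<alpha>\<^sup>2) * (exp (R * norm w) * cmod (\<phi> w))))"
        using intR by (rule Bochner_Integration.integrable_mult_right)
      fix w
      let ?a = "hdot z w / \<alpha>" and ?b = "hdot h w / \<alpha>"
      have b: "cmod ?b \<le> norm h * norm w / \<alpha>"
        using norm_hdot_le [of h w] assms(1) by (simp add: norm_divide divide_right_mono)
      also have "\<dots> \<le> norm w / \<alpha>"
        using that assms(1) by (simp add: divide_right_mono mult_left_le_one_le)
      finally have b': "cmod ?b \<le> norm w / \<alpha>" .
      have "?I w = exp ?a * (exp ?b - 1 - ?b) * \<phi> w"
        by (simp add: hdot_simps add_divide_distrib exp_add algebra_simps)
      then have "norm (?I w) = cmod (exp ?a) * cmod (exp ?b - 1 - ?b) * cmod (\<phi> w)"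
        by (simp only: norm_mult)
      also have "\<dots> \<le> exp (norm z / \<alpha> * norm w) * (exp (norm w / \<alpha>) * (norm h * norm w / \<alpha>)\<^sup>2) * cmod (\<phi> w)"
      proof (intro mult_right_mono mult_mono)
        show "cmod (exp ?b - 1 - ?b) \<le> exp (norm w / \<alpha>) * (norm h * norm w / \<alpha>)\<^sup>2"
          by (rule order_trans [OF norm_exp_minus_linear_le]) (intro mult_mono power_mono b, use b' in auto)
      qed (use cmod_exp_hdot_le [OF assms(1)] in \<open>auto simp del: norm_exp_eq_Re\<close>)
      also have "\<dots> = (norm h)\<^sup>2 * ((1 / \<alpha>\<^sup>2) * (exp ((norm z + 1) / \<alpha> * norm w) * (norm w)\<^sup>2 * cmod (\<phi> w)))"
        by (simp add: power_mult_distrib power_divide add_divide_distrib distrib_right exp_add)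
      also have "\<dots> \<le> (norm h)\<^sup>2 * ((1 / \<alpha>\<^sup>2) * (exp ((norm z + 1) / \<alpha> * norm w) * (2 * exp (norm w)) * cmod (\<phi> w)))"
      proof (intro mult_left_mono mult_right_mono)
        show "(norm w)\<^sup>2 \<le> 2 * exp (norm w)"
          using exp_lower_Taylor_quadratic [of "norm w"] norm_ge_zero [of w] by linarith
      qed auto
      also have "\<dots> = (norm h)\<^sup>2 * ((2 / \<alpha>\<^sup>2) * (exp (R * norm w) * cmod (\<phi> w)))"
        by (simp add: R_def distrib_right exp_add)
      finally show "norm (?I w) \<le> (norm h)\<^sup>2 * ((2 / \<alpha>\<^sup>2) * (exp (R * norm w) * cmod (\<phi> w)))" .
    qed
    also have "\<dots> = C * (norm h)\<^sup>2"
      unfolding C_def by (subst integral_mult_right_zero) (rule mult.commute)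
    finally show ?thesis .
  qed
  have "bounded_linear ?D"
    by (intro bounded_linear_sum bounded_linear_mult_const bounded_linear_vec_nth)
  moreover have "((\<lambda>h. norm (laplace \<alpha> \<phi> (z + h) - laplace \<alpha> \<phi> z - ?D h) / norm h) \<longlongrightarrow> 0) (at 0)"
  proof (rule Lim_null_comparison)
    show "\<forall>\<^sub>F h in at 0. norm (norm (laplace \<alpha> \<phi> (z + h) - laplace \<alpha> \<phi> z - ?D h) / norm h) \<le> C * norm h"
      unfolding eventually_at
    proof (intro exI [of _ 1] conjI ballI impI)
      fix h :: "complex ^ 'n" assume h: "h \<noteq> 0 \<and> dist h 0 < 1"
      then show "norm (norm (laplace \<alpha> \<phi> (z + h) - laplace \<alpha> \<phi> z - ?D h) / norm h) \<le> C * norm h"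
        using bound [of h] by (simp add: divide_le_eq power2_eq_square mult.assoc)
    qed simp
    show "((\<lambda>h. C * norm h) \<longlongrightarrow> 0) (at 0)"
      by (intro tendsto_eq_intros) auto
  qed
  ultimately show ?thesis
    by (simp add: has_derivative_at)
qed

lemma laplace_Wirtinger:
  assumes "\<alpha> > 0" "exp_integrable \<alpha> \<phi>"
  shows "laplace \<alpha> \<phi> differentiable (at z)"
    and "wirtinger_bar j (laplace \<alpha> \<phi>) z = 0"
    and "continuous_on UNIV (laplace \<alpha> \<phi>)"
proof -
  note D = has_derivative_laplace [OF assms]
  show d: "laplace \<alpha> \<phi> differentiable (at z)" for z
    using D by (auto simp: differentiable_def)
  have fd: "frechet_derivative (laplace \<alpha> \<phi>) (at z) h = (\<Sum>j\<in>UNIV. h $ j * laplace \<alpha> (\<lambda>w. cnj (w $ j) / \<alpha> * \<phi> w) z)" for h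
    by (simp add: frechet_derivative_at [OF D, symmetric])
  have s: "(\<Sum>k\<in>UNIV. axis j c $ k * a k) = c * a j" for c :: complex and a
    by (simp add: axis_def if_distrib [of "\<lambda>x. x * _"] cong: if_cong)
  show "wirtinger_bar j (laplace \<alpha> \<phi>) z = 0"
    by (simp only: wirtinger_bar_def fd s) (simp flip: mult.assoc)
  show "continuous_on UNIV (laplace \<alpha> \<phi>)"
    by (intro continuous_at_imp_continuous_on ballI differentiable_imp_continuous_within d)
qed

text \<open>The derivatives of a transform are transforms again, so differentiating twice gives the
  required regularity. \<open>wirtinger_bar\<close> keeps only the conjugated transform, which
  \<open>wirtinger\<close> annihilates.\<close>

lemma pluriharmonic_laplace:
  fixes \<phi> \<psi> :: "complex ^ 'n \<Rightarrow> complex"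
  assumes "\<alpha> > 0" and \<phi>: "exp_integrable \<alpha> \<phi>" and \<psi>: "exp_integrable \<alpha> \<psi>"
  shows "pluriharmonic (\<lambda>z. laplace \<alpha> \<phi> z + cnj (laplace \<alpha> \<psi> z) + c)"
proof -
  let ?x = "\<lambda>\<phi> j w. cnj (w $ j) / \<alpha> * (\<phi> w :: complex)"
  have D: "((\<lambda>z. laplace \<alpha> \<phi> z + cnj (laplace \<alpha> \<psi> z) + c) has_derivative
      (\<lambda>h. (\<Sum>j\<in>UNIV. h $ j * laplace \<alpha> (?x \<phi> j) z) + cnj (\<Sum>j\<in>UNIV. h $ j * laplace \<alpha> (?x \<psi> j) z) + 0)) (at z)"
    if "exp_integrable \<alpha> \<phi>" "exp_integrable \<alpha> \<psi>" for \<phi> \<psi> :: "complex ^ 'n \<Rightarrow> complex" and c z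
    by (intro has_derivative_add has_derivative_const has_derivative_cnj has_derivative_laplace assms(1) that)
  note fd = frechet_derivative_at [OF D, symmetric]
  let ?f = "\<lambda>z. laplace \<alpha> \<phi> z + cnj (laplace \<alpha> \<psi> z) + c"
  note x = exp_integrable_coordinate [OF assms(1)]
  note D1 = has_derivative_laplace [OF assms(1) x [OF \<phi>]] has_derivative_laplace [OF assms(1) x [OF \<psi>]]
  have fd1: "frechet_derivative ?f (at z) b = (\<Sum>j\<in>UNIV. b $ j * laplace \<alpha> (?x \<phi> j) z) + cnj (\<Sum>j\<in>UNIV. b $ j * laplace \<alpha> (?x \<psi> j) z)" for z b
    by (simp add: fd [OF \<phi> \<psi>])
  have D2: "((\<lambda>z. frechet_derivative ?f (at z) b) has_derivative
     (\<lambda>h. (\<Sum>j\<in>UNIV. b $ j * (\<Sum>k\<in>UNIV. h $ k * laplace \<alpha> (?x (?x \<phi> j) k) z))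
       + cnj (\<Sum>j\<in>UNIV. b $ j * (\<Sum>k\<in>UNIV. h $ k * laplace \<alpha> (?x (?x \<psi> j) k) z)))) (at z)" for z b
    unfolding fd1
    by (intro has_derivative_add has_derivative_cnj has_derivative_sum has_derivative_mult_right D1)
  have fd2: "frechet_derivative (\<lambda>z. frechet_derivative ?f (at z) b) (at z) h =
     (\<Sum>j\<in>UNIV. b $ j * (\<Sum>k\<in>UNIV. h $ k * laplace \<alpha> (?x (?x \<phi> j) k) z))
       + cnj (\<Sum>j\<in>UNIV. b $ j * (\<Sum>k\<in>UNIV. h $ k * laplace \<alpha> (?x (?x \<psi> j) k) z))" for z b h
    by (simp add: frechet_derivative_at [OF D2, symmetric])
  have C2: "C2_function ?f"
    unfolding C2_function_def
  proof (intro conjI allI ballI)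
    show "?f differentiable (at z)" for z
      using D [OF \<phi> \<psi>] unfolding differentiable_def by blast
    show "(\<lambda>z. frechet_derivative ?f (at z) b) differentiable (at z)" for z b
      using D2 unfolding differentiable_def by blast
    show "continuous_on UNIV (\<lambda>z. frechet_derivative (\<lambda>z. frechet_derivative ?f (at z) b) (at z) h)" for b h
      unfolding fd2
      by (intro continuous_intros laplace_Wirtinger(3) assms(1) x \<phi> \<psi>)
  qed
  have s: "(\<Sum>k\<in>UNIV. axis j c $ k * a k) = c * a j" for c :: complex and a and j :: 'n
    by (simp add: axis_def if_distrib [of "\<lambda>x. x * _"] cong: if_cong)
  have "wirtinger_bar k ?f = (\<lambda>z. cnj (laplace \<alpha> (?x \<psi> k) z))" for k
    by (rule ext) (simp only: wirtinger_bar_def fd1 s, simp add: distrib_left right_diff_distrib flip: mult.assoc)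
  moreover have "wirtinger j (\<lambda>z. cnj (laplace \<alpha> (?x \<psi> k) z)) z = 0" for j k z
    by (simp only: cnj_Wirtinger(1) [OF laplace_Wirtinger(1) [OF assms(1) x [OF \<psi>]]]
        laplace_Wirtinger(2) [OF assms(1) x [OF \<psi>]] complex_cnj_zero)
  ultimately show ?thesis
    using C2 by (simp add: pluriharmonic_def)
qed

text \<open>For the converse, the kernel is written as e + cnj e - 1: the integral becomes a
  transform of f, the conjugate of a transform of its conjugate, and a constant.\<close>

lemma PH2_iff_reproducing:
  fixes f :: "complex ^ 'n \<Rightarrow> complex"
  assumes "\<alpha> > 0"
  shows "f \<in> PH2 \<alpha> \<longleftrightarrow> sqint (fock \<alpha>) f \<and> (\<forall>z. f z = (\<integral>w. Kph \<alpha> z w * f w \<partial>fock \<alpha>))"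
proof
  assume "f \<in> PH2 \<alpha>"
  then show "sqint (fock \<alpha>) f \<and> (\<forall>z. f z = (\<integral>w. Kph \<alpha> z w * f w \<partial>fock \<alpha>))"
    using assms by (simp add: PH2_reproducing PH2_iff_sqint)
next
  assume f: "sqint (fock \<alpha>) f \<and> (\<forall>z. f z = (\<integral>w. Kph \<alpha> z w * f w \<partial>fock \<alpha>))"
  then have sq: "sqint (fock \<alpha>) f" by blast
  then have e: "exp_integrable \<alpha> f" "exp_integrable \<alpha> (\<lambda>w. cnj (f w))"
    using assms by (auto intro!: sqint_imp_exp_integrable sqint_cnj)
  have "f = (\<lambda>z. laplace \<alpha> f z + cnj (laplace \<alpha> (\<lambda>w. cnj (f w)) z) + (- (\<integral>w. f w \<partial>fock \<alpha>)))"
  proof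
    fix z
    have "f z = (\<integral>w. Kph \<alpha> z w * f w \<partial>fock \<alpha>)"
      using f by blast
    also have "\<dots> = (\<integral>w. exp (hdot z w / \<alpha>) * f w + cnj (exp (hdot z w / \<alpha>) * cnj (f w)) - f w \<partial>fock \<alpha>)"
      by (simp add: Kph_def exp_cnj cnj_hdot algebra_simps)
    also have "\<dots> = laplace \<alpha> f z + cnj (laplace \<alpha> (\<lambda>w. cnj (f w)) z) + (- (\<integral>w. f w \<partial>fock \<alpha>))"
      unfolding laplace_def
      using integrable_laplace [OF assms e(1), of z] integrable_cnj [OF integrable_laplace [OF assms e(2), of z]]
        sqint_imp_integrable [OF assms sq]
      by (simp del: complex_cnj_mult)
    finally show "f z = \<dots>" .
  qed
  then have "pluriharmonic f"
    using pluriharmonic_laplace [OF assms e] by metis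
  then show "f \<in> PH2 \<alpha>" using sq assms by (simp add: PH2_iff_sqint)
qed

section \<open>Positive forms and Hilbert spaces\<close>

locale psd_form = vector_space sc for sc :: "complex \<Rightarrow> 'v::ab_group_add \<Rightarrow> 'v" +
  fixes H :: "'v set" and B :: "'v \<Rightarrow> 'v \<Rightarrow> complex"
  assumes subspace_H: "subspace H"
    and add_left: "f \<in> H \<Longrightarrow> g \<in> H \<Longrightarrow> h \<in> H \<Longrightarrow> B (f + g) h = B f h + B g h"
    and scale_left: "f \<in> H \<Longrightarrow> h \<in> H \<Longrightarrow> B (sc c f) h = c * B f h"
    and hermitian: "f \<in> H \<Longrightarrow> g \<in> H \<Longrightarrow> B g f = cnj (B f g)"
    and nonneg: "f \<in> H \<Longrightarrow> 0 \<le> Re (B f f)"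
begin

lemma H_closed [simp, intro]:
  "0 \<in> H" "f \<in> H \<Longrightarrow> g \<in> H \<Longrightarrow> f + g \<in> H" "f \<in> H \<Longrightarrow> g \<in> H \<Longrightarrow> f - g \<in> H"
  "f \<in> H \<Longrightarrow> - f \<in> H" "f \<in> H \<Longrightarrow> sc c f \<in> H"
  using subspace_H by (auto simp: subspace_0 subspace_add subspace_diff subspace_neg subspace_scale)

lemma add_right: "f \<in> H \<Longrightarrow> g \<in> H \<Longrightarrow> h \<in> H \<Longrightarrow> B h (f + g) = B h f + B h g"
  using hermitian [of "f + g" h] hermitian [of f h] hermitian [of g h] by (simp add: add_left)

lemma scale_right: "f \<in> H \<Longrightarrow> h \<in> H \<Longrightarrow> B h (sc c f) = cnj c * B h f"
  using hermitian [of "sc c f" h] hermitian [of f h] by (simp add: scale_left)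

lemma zero_left [simp]: "h \<in> H \<Longrightarrow> B 0 h = 0"
  using scale_left [of 0 h 0] by simp

lemma zero_right [simp]: "h \<in> H \<Longrightarrow> B h 0 = 0"
  using scale_right [of 0 h 0] by simp

lemma minus_left: "f \<in> H \<Longrightarrow> h \<in> H \<Longrightarrow> B (- f) h = - B f h"
  using scale_left [of f h "-1"] by simp

lemma minus_right: "f \<in> H \<Longrightarrow> h \<in> H \<Longrightarrow> B h (- f) = - B h f"
  using scale_right [of f h "-1"] by simp

lemma diff_left: "f \<in> H \<Longrightarrow> g \<in> H \<Longrightarrow> h \<in> H \<Longrightarrow> B (f - g) h = B f h - B g h"
  using add_left [of f "- g" h] by (simp add: minus_left)

lemma diff_right: "f \<in> H \<Longrightarrow> g \<in> H \<Longrightarrow> h \<in> H \<Longrightarrow> B h (f - g) = B h f - B h g"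
  using add_right [of f "- g" h] by (simp add: minus_right)

lemmas form_simps = add_left add_right scale_left scale_right minus_left minus_right diff_left diff_right

lemma sum_left: "finite S \<Longrightarrow> (\<And>i. i \<in> S \<Longrightarrow> v i \<in> H) \<Longrightarrow> h \<in> H \<Longrightarrow> B (\<Sum>i\<in>S. v i) h = (\<Sum>i\<in>S. B (v i) h)"
  by (induction S rule: finite_induct) (auto simp: add_left subspace_sum [OF subspace_H])

lemma sum_right: "finite S \<Longrightarrow> (\<And>i. i \<in> S \<Longrightarrow> v i \<in> H) \<Longrightarrow> h \<in> H \<Longrightarrow> B h (\<Sum>i\<in>S. v i) = (\<Sum>i\<in>S. B h (v i))"
  by (induction S rule: finite_induct) (auto simp: add_right subspace_sum [OF subspace_H])

lemma form_self: "f \<in> H \<Longrightarrow> B f f = of_real (Re (B f f))"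
  using hermitian [of f f] by (simp add: complex_eq_iff)

text \<open>The factor \<open>B f g\<close> in the perturbation aligns the phase, so the cross terms
  are real and the expression is a real quadratic polynomial in t. Cauchy-Schwarz and the projection
  argument both choose t in it.\<close>

lemma form_self_diff_scale:
  assumes "f \<in> H" "g \<in> H"
  shows "Re (B (f - sc (of_real t * B f g) g) (f - sc (of_real t * B f g) g))
    = Re (B f f) - 2 * t * (cmod (B f g))\<^sup>2 + t\<^sup>2 * (cmod (B f g))\<^sup>2 * Re (B g g)"
proof -
  let ?b = "B f g"
  have "B (f - sc (of_real t * ?b) g) (f - sc (of_real t * ?b) g)
    = B f f - of_real t * (?b * cnj ?b) - of_real t * (?b * cnj ?b) + (of_real t)\<^sup>2 * (?b * cnj ?b) * B g g"
    using assms hermitian [OF assms] by (simp add: form_simps algebra_simps power2_eq_square)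
  also have "\<dots> = of_real (Re (B f f) - 2 * t * (cmod ?b)\<^sup>2 + t\<^sup>2 * (cmod ?b)\<^sup>2 * Re (B g g))"
    unfolding complex_norm_square [symmetric] using form_self [OF assms(1)] form_self [OF assms(2)] by simp
  finally show ?thesis by simp
qed

lemma Cauchy_Schwarz:
  assumes "f \<in> H" "g \<in> H"
  shows "(cmod (B f g))\<^sup>2 \<le> Re (B f f) * Re (B g g)"
proof -
  let ?b = "(cmod (B f g))\<^sup>2"
  have *: "0 \<le> Re (B f f) - 2 * t * ?b + t\<^sup>2 * ?b * Re (B g g)" for t
    using nonneg [of "f - sc (of_real t * B f g) g"] form_self_diff_scale [OF assms, of t] assms by simp
  show ?thesis
  proof (cases "Re (B g g) = 0")
    case True
    have "?b = 0"
    proof (rule ccontr)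
      assume "?b \<noteq> 0"
      then show False
        \<comment> \<open>Without its quadratic term the bound is affine in t; this t makes it
          -1.\<close>
        using * [of "(Re (B f f) + 1) / (2 * ?b)"] True by (simp add: field_simps)
    qed
    then show ?thesis using True by simp
  next
    case False
    then have "Re (B g g) > 0" using nonneg [OF assms(2)] by simp
    then show ?thesis
      using * [of "1 / Re (B g g)"] by (simp add: field_simps power2_eq_square)
  qed
qed

definition nrm :: "'v \<Rightarrow> real" where
  "nrm f = sqrt (Re (B f f))"

lemma nrm_nonneg [simp]: "f \<in> H \<Longrightarrow> 0 \<le> nrm f"
  by (simp add: nrm_def nonneg)

lemma nrm_square: "f \<in> H \<Longrightarrow> (nrm f)\<^sup>2 = Re (B f f)"
  by (simp add: nrm_def nonneg)

lemma Cauchy_Schwarz_nrm: "f \<in> H \<Longrightarrow> g \<in> H \<Longrightarrow> cmod (B f g) \<le> nrm f * nrm g"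
  by (rule power2_le_imp_le) (simp_all add: power_mult_distrib nrm_square Cauchy_Schwarz)

lemma nrm_scale: "f \<in> H \<Longrightarrow> nrm (sc c f) = cmod c * nrm f"
proof -
  assume f: "f \<in> H"
  have "B (sc c f) (sc c f) = of_real ((cmod c)\<^sup>2) * B f f"
    using f by (simp add: form_simps complex_norm_square mult_ac del: of_real_power)
  then show ?thesis by (simp add: nrm_def real_sqrt_mult)
qed

lemma nrm_minus_commute: "f \<in> H \<Longrightarrow> g \<in> H \<Longrightarrow> nrm (f - g) = nrm (g - f)"
  by (simp add: nrm_def form_simps algebra_simps)

lemma nrm_triangle:
  assumes "f \<in> H" "g \<in> H"
  shows "nrm (f + g) \<le> nrm f + nrm g"
proof (rule power2_le_imp_le)
  have "(nrm (f + g))\<^sup>2 = (nrm f)\<^sup>2 + (nrm g)\<^sup>2 + 2 * Re (B f g)"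
    using assms hermitian [OF assms] by (simp add: nrm_square form_simps)
  also have "\<dots> \<le> (nrm f)\<^sup>2 + (nrm g)\<^sup>2 + 2 * (nrm f * nrm g)"
    using complex_Re_le_cmod [of "B f g"] Cauchy_Schwarz_nrm [OF assms] by linarith
  finally show "(nrm (f + g))\<^sup>2 \<le> (nrm f + nrm g)\<^sup>2"
    by (simp add: power2_sum algebra_simps)
qed (use assms in auto)

lemma parallelogram:
  assumes "f \<in> H" "g \<in> H"
  shows "(nrm (f - g))\<^sup>2 + (nrm (f + g))\<^sup>2 = 2 * (nrm f)\<^sup>2 + 2 * (nrm g)\<^sup>2"
  using assms by (simp add: nrm_square form_simps)

section \<open>Orthonormal systems\<close>

definition orthonormal :: "'v set \<Rightarrow> bool" where
  "orthonormal E \<longleftrightarrow> E \<subseteq> H \<and> (\<forall>e\<in>E. \<forall>e'\<in>E. B e e' = (if e = e' then 1 else 0))"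

text \<open>Completing the square in every coefficient. Taking r = B f gives Bessel's inequality; a
  general r shows that the Bessel defect is at most the squared distance to any combination.\<close>

lemma nrm_diff_combination:
  assumes "orthonormal E" "finite E" "f \<in> H"
  shows "(nrm (f - (\<Sum>e\<in>E. sc (r e) e)))\<^sup>2 = (nrm f)\<^sup>2 - (\<Sum>e\<in>E. (cmod (B f e))\<^sup>2) + (\<Sum>e\<in>E. (cmod (B f e - r e))\<^sup>2)"
proof -
  let ?s = "\<Sum>e\<in>E. sc (r e) e"
  have E: "e \<in> H" if "e \<in> E" for e
    using assms that by (auto simp: orthonormal_def)
  have s: "?s \<in> H"
    using E by (auto intro: subspace_sum [OF subspace_H])
  have fs: "B f ?s = (\<Sum>e\<in>E. cnj (r e) * B f e)"
    using assms E by (simp add: sum_right scale_right)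
  have es: "B e ?s = cnj (r e)" if "e \<in> E" for e
  proof -
    have "B e ?s = (\<Sum>e'\<in>E. cnj (r e') * B e e')"
      using assms E that by (simp add: sum_right scale_right)
    also have "\<dots> = (\<Sum>e'\<in>E. if e = e' then cnj (r e') else 0)"
      using assms(1) that by (intro sum.cong) (auto simp: orthonormal_def)
    finally show ?thesis using that assms(2) by simp
  qed
  have ss: "B ?s ?s = (\<Sum>e\<in>E. r e * cnj (r e))"
    using assms E s by (subst sum_left) (auto simp: scale_left es)
  have "B (f - ?s) (f - ?s) = B f f - (\<Sum>e\<in>E. cnj (r e) * B f e + r e * cnj (B f e) - r e * cnj (r e))"
    using assms(3) s hermitian [OF assms(3) s]
    by (simp add: form_simps fs ss sum.distrib sum_subtractf)
  also have "\<dots> = B f f - (\<Sum>e\<in>E. of_real ((cmod (B f e))\<^sup>2 - (cmod (B f e - r e))\<^sup>2))"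
    by (simp only: of_real_diff complex_norm_square) (simp add: algebra_simps)
  finally show ?thesis
    using assms(3) s by (simp add: nrm_square sum_subtractf)
qed

lemma Bessel:
  assumes "orthonormal E" "finite E" "f \<in> H"
  shows "(\<Sum>e\<in>E. (cmod (B f e))\<^sup>2) \<le> (nrm f)\<^sup>2"
  using nrm_diff_combination [OF assms, of "B f"] zero_le_power2 [of "nrm (f - (\<Sum>e\<in>E. sc (B f e) e))"]
  by simp

section \<open>Symmetric operators and absolute values\<close>

text \<open>Polarisation: the sesquilinear defect \<open>D\<close> vanishes on the diagonal, and
  evaluating it at f + g and f + \<i> g gives both D f g + D g f = 0 and D g f - D f g = 0.\<close>

lemma symmetric_if_real:
  assumes T: "\<And>f. f \<in> H \<Longrightarrow> T f \<in> H" "\<And>f g. f \<in> H \<Longrightarrow> g \<in> H \<Longrightarrow> T (f + g) = T f + T g"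
    "\<And>c f. f \<in> H \<Longrightarrow> T (sc c f) = sc c (T f)"
    and re: "\<And>f. f \<in> H \<Longrightarrow> Im (B (T f) f) = 0"
    and fg: "f \<in> H" "g \<in> H"
  shows "B (T f) g = B f (T g)"
proof -
  define D where "D f g = B (T f) g - B f (T g)" for f g
  have D0: "D f f = 0" if "f \<in> H" for f
    using re [OF that] hermitian [OF that T(1) [OF that]] by (simp add: D_def complex_eq_iff)
  have "D (f + g) (f + g) = D f f + D g g + (D f g + D g f)"
    using fg by (simp add: D_def T form_simps)
  then have 1: "D f g + D g f = 0" using fg by (simp add: D0)
  have "D (f + sc \<i> g) (f + sc \<i> g) = D f f + D g g + \<i> * (D g f - D f g)"
    using fg by (simp add: D_def T form_simps algebra_simps)
  then have "\<i> * (D g f - D f g) = 0" using fg by (simp add: D0)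
  with 1 have "D f g = 0" by simp
  then show ?thesis by (simp add: D_def)
qed

text \<open>
  Comparison of a symmetric operator \<open>A\<close> with its absolute value \<open>P\<close>.  If the supremum \<open>\<lambda>\<close> of the
  numerical range of \<open>D = A - P\<close> were positive, it would be an approximate eigenvalue of \<open>D\<close>, by
  the Cauchy-Schwarz inequality for the form \<open>\<langle>(\<lambda> - D) f, g\<rangle>\<close>.  For approximate unit eigenvectors \<open>x\<close>, however,
  \<open>0 = \<bar>A x\<bar>\<^sup>2 - \<bar>P x\<bar>\<^sup>2 = Re \<langle>D x, (A + P) x\<rangle> \<approx> \<lambda> \<langle>x, (A + P) x\<rangle> \<ge> \<lambda> \<langle>x, D x\<rangle> \<approx> \<lambda>\<^sup>2\<close>.
\<close>

lemma symmetric_le_absolute_value: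
  assumes A: "\<And>f. f \<in> H \<Longrightarrow> A f \<in> H" "\<And>f g. f \<in> H \<Longrightarrow> g \<in> H \<Longrightarrow> A (f + g) = A f + A g"
      "\<And>c f. f \<in> H \<Longrightarrow> A (sc c f) = sc c (A f)" "\<And>f. f \<in> H \<Longrightarrow> nrm (A f) \<le> CA * nrm f"
      "\<And>f g. f \<in> H \<Longrightarrow> g \<in> H \<Longrightarrow> B (A f) g = B f (A g)"
    and P: "\<And>f. f \<in> H \<Longrightarrow> P f \<in> H" "\<And>f g. f \<in> H \<Longrightarrow> g \<in> H \<Longrightarrow> P (f + g) = P f + P g"
      "\<And>c f. f \<in> H \<Longrightarrow> P (sc c f) = sc c (P f)" "\<And>f. f \<in> H \<Longrightarrow> nrm (P f) \<le> CP * nrm f"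
      "\<And>f g. f \<in> H \<Longrightarrow> g \<in> H \<Longrightarrow> B (P f) g = B f (P g)"
      "\<And>f. f \<in> H \<Longrightarrow> 0 \<le> Re (B (P f) f)"
    and eq: "\<And>f. f \<in> H \<Longrightarrow> nrm (A f) = nrm (P f)"
    and f: "f \<in> H"
  shows "Re (B (A f) f) \<le> Re (B (P f) f)"
proof (rule ccontr)
  assume less: "\<not> ?thesis"
  define D where "D f = A f - P f" for f
  define S where "S f = A f + P f" for f
  define C where "C = \<bar>CA\<bar> + \<bar>CP\<bar>"
  have C0: "C \<ge> 0" by (simp add: C_def)
  have DS: "D f \<in> H" "S f \<in> H" if "f \<in> H" for f
    using that by (auto simp: D_def S_def A P)
  have AP: "nrm (A x) + nrm (P x) \<le> C * nrm x" if "x \<in> H" for x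
    using A(4) [OF that] P(4) [OF that] mult_right_mono [OF abs_ge_self [of CA] nrm_nonneg [OF that]]
      mult_right_mono [OF abs_ge_self [of CP] nrm_nonneg [OF that]]
    by (simp add: C_def algebra_simps)
  have D_bound: "nrm (D x) \<le> C * nrm x" if "x \<in> H" for x
  proof -
    have "nrm (- P x) = nrm (P x)" using that by (simp add: nrm_def form_simps P)
    then show ?thesis
      using nrm_triangle [of "A x" "- P x"] AP [OF that] that A(1) P(1) by (simp add: D_def)
  qed
  have S_bound: "nrm (S x) \<le> C * nrm x" if "x \<in> H" for x
    using nrm_triangle [of "A x" "P x"] AP [OF that] that A(1) P(1) by (simp add: S_def)
  have q_bound: "Re (B (D x) x) \<le> C * (nrm x)\<^sup>2" if "x \<in> H" for x
  proof -
    have "Re (B (D x) x) \<le> nrm (D x) * nrm x"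
      using complex_Re_le_cmod Cauchy_Schwarz_nrm [OF DS(1) [OF that] that] order_trans by blast
    also have "\<dots> \<le> (C * nrm x) * nrm x"
      using that by (intro mult_right_mono D_bound) auto
    finally show ?thesis by (simp add: power2_eq_square)
  qed
  define U where "U = {x \<in> H. nrm x = 1}"
  define lam where "lam = (SUP x\<in>U. Re (B (D x) x))"
  have bdd: "bdd_above ((\<lambda>x. Re (B (D x) x)) ` U)"
  proof (rule bdd_aboveI2)
    show "Re (B (D x) x) \<le> C" if "x \<in> U" for x
      using q_bound [of x] that by (simp add: U_def)
  qed
  have scaleD: "Re (B (D (sc (of_real c) x)) (sc (of_real c) x)) = c\<^sup>2 * Re (B (D x) x)" if "x \<in> H" for x c
    using that by (simp add: D_def A P form_simps algebra_simps power2_eq_square)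
  have nz: "nrm x > 0" if "x \<in> H" "Re (B (D x) x) > 0" for x
  proof -
    have "nrm x \<noteq> 0" using q_bound [OF that(1)] that(2) by auto
    then show ?thesis using nrm_nonneg [OF that(1)] by simp
  qed
  have lam: "Re (B (D x) x) \<le> lam * (nrm x)\<^sup>2" if "x \<in> H" "nrm x > 0" for x
  proof -
    have "sc (of_real (1 / nrm x)) x \<in> U"
      using that by (simp add: U_def nrm_scale norm_divide)
    then have "Re (B (D (sc (of_real (1 / nrm x)) x)) (sc (of_real (1 / nrm x)) x)) \<le> lam"
      unfolding lam_def by (rule cSUP_upper [OF _ bdd])
    then show ?thesis
      unfolding scaleD [OF that(1)] using that(2) by (simp add: field_simps power2_eq_square)
  qed
  have "Re (B (D f) f) > 0"
    using less f by (simp add: D_def form_simps A P)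
  then have lam0: "lam > 0" and "U \<noteq> {}"
  proof -
    assume *: "Re (B (D f) f) > 0"
    then have "0 < lam * (nrm f)\<^sup>2"
      using lam [OF f nz [OF f]] by simp
    then show "lam > 0" by (simp add: zero_less_mult_iff)
    have "sc (of_real (1 / nrm f)) f \<in> U"
      using nz [OF f *] f by (simp add: U_def nrm_scale norm_divide)
    then show "U \<noteq> {}" by blast
  qed
  define B' where "B' f g = of_real lam * B f g - B (D f) g" for f g
  interpret B': psd_form sc H B'
  proof unfold_locales
    \<comment> \<open>Only vectors with positive value of the form of \<open>D\<close> are
      normalised. For the others the sign suffices, which covers vectors of norm 0.\<close>
    show "0 \<le> Re (B' x x)" if "x \<in> H" for x
    proof (cases "Re (B (D x) x) > 0")
      case True
      then show ?thesis using lam [OF that nz [OF that True]] that by (simp add: B'_def nrm_square)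
    next
      case False
      moreover have "0 \<le> lam * Re (B x x)" using nonneg [OF that] lam0 by simp
      ultimately show ?thesis by (simp add: B'_def)
    qed
    show "B' g f = cnj (B' f g)" if "f \<in> H" "g \<in> H" for f g
      using hermitian [OF that] hermitian [of "A f" g] hermitian [of "P f" g] that
      by (simp add: B'_def D_def form_simps A P)
  qed (auto simp: B'_def D_def form_simps A P subspace_H algebra_simps)
  define K where "K = lam + C"
  have K: "K > 0" using lam0 C0 by (simp add: K_def)
  have main: "lam\<^sup>2 \<le> lam * \<epsilon> + C * sqrt (K * \<epsilon>)" if "\<epsilon> > 0" for \<epsilon>
  proof -
    have "lam - \<epsilon> < (SUP x\<in>U. Re (B (D x) x))" using that by (simp add: lam_def [symmetric])
    then obtain x where "x \<in> U" and "lam - \<epsilon> < Re (B (D x) x)"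
      unfolding less_cSUP_iff [OF \<open>U \<noteq> {}\<close> bdd] by blast
    then have x: "x \<in> H" "nrm x = 1" "lam - \<epsilon> < Re (B (D x) x)"
      by (simp_all add: U_def)
    \<comment> \<open>The residual of x as an approximate eigenvector. Since B' x y = B y y,
      Cauchy-Schwarz for \<open>B'\<close> controls it by Re (B' x x) \<le> \<epsilon> and by the
      bound \<open>K\<close> of the form \<open>B'\<close>.\<close>
    define y where "y = sc (of_real lam) x - D x"
    have y: "y \<in> H" using x DS by (simp add: y_def)
    have xx: "Re (B x x) = 1" using nrm_square [OF x(1)] x(2) by simp
    have B'xx: "Re (B' x x) \<le> \<epsilon>" using x(3) xx by (simp add: B'_def)
    have "B y y = B (sc (of_real lam) x - D x) y"
      by (simp add: y_def)
    also have "\<dots> = B' x y"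
      using x y DS by (simp add: B'_def form_simps)
    finally have "B' x y = B y y" ..
    then have "((nrm y)\<^sup>2)\<^sup>2 \<le> (cmod (B' x y))\<^sup>2"
      using form_self [OF y] nrm_square [OF y] by (metis norm_of_real real_sqrt_abs real_sqrt_pow2_iff order_refl zero_le_power2 abs_of_nonneg)
    also have "\<dots> \<le> Re (B' x x) * Re (B' y y)"
      by (rule B'.Cauchy_Schwarz [OF x(1) y])
    also have "\<dots> \<le> \<epsilon> * (K * (nrm y)\<^sup>2)"
    proof (rule mult_mono [OF B'xx])
      have "- Re (B (D y) y) \<le> C * (nrm y)\<^sup>2"
      proof -
        have "- Re (B (D y) y) \<le> nrm (D y) * nrm y"
          using abs_Re_le_cmod [of "B (D y) y"] Cauchy_Schwarz_nrm [OF DS(1) [OF y] y] by linarith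
        also have "\<dots> \<le> (C * nrm y) * nrm y"
          using y by (intro mult_right_mono D_bound) auto
        finally show ?thesis by (simp add: power2_eq_square)
      qed
      then show "Re (B' y y) \<le> K * (nrm y)\<^sup>2"
        by (simp add: B'_def K_def nrm_square [OF y] algebra_simps)
    qed (use that B'.nonneg y in auto)
    finally have le: "(nrm y)\<^sup>2 * (nrm y)\<^sup>2 \<le> (K * \<epsilon>) * (nrm y)\<^sup>2"
      by (simp add: power2_eq_square mult_ac)
    have "(nrm y)\<^sup>2 \<le> K * \<epsilon>"
    proof (cases "nrm y = 0")
      case False
      then show ?thesis using mult_right_le_imp_le [OF le] by simp
    qed (use K that in simp)
    then have y_small: "nrm y \<le> sqrt (K * \<epsilon>)"
      by (rule real_le_rsqrt)
    have "Re (B (D x) (S x)) = (nrm (A x))\<^sup>2 - (nrm (P x))\<^sup>2"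
      using x A(1) P(1) hermitian [of "A x" "P x"] by (simp add: D_def S_def form_simps nrm_square)
    then have "0 = Re (B (D x) (S x))" using eq [OF x(1)] by simp
    also have "\<dots> = lam * Re (B x (S x)) - Re (B y (S x))"
      using x DS by (simp add: y_def form_simps)
    finally have "lam * Re (B x (S x)) = Re (B y (S x))" by linarith
    moreover have "lam * (lam - \<epsilon>) \<le> lam * Re (B x (S x))"
    proof (rule mult_left_mono)
      \<comment> \<open>S = D + 2 P, so positivity of \<open>P\<close> enters here.\<close>
      have "Re (B x (S x)) = Re (B (D x) x) + 2 * Re (B (P x) x)"
        using x(1) A(1) P(1) A(5) [OF x(1) x(1)] P(5) [OF x(1) x(1)]
        by (simp add: D_def S_def form_simps)
      then show "lam - \<epsilon> \<le> Re (B x (S x))"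
        using x(3) P(6) [OF x(1)] by simp
    qed (use lam0 in simp)
    moreover have "Re (B y (S x)) \<le> sqrt (K * \<epsilon>) * C"
    proof -
      have "Re (B y (S x)) \<le> nrm y * nrm (S x)"
        using complex_Re_le_cmod [of "B y (S x)"] Cauchy_Schwarz_nrm [OF y DS(2) [OF x(1)]] by linarith
      also have "\<dots> \<le> sqrt (K * \<epsilon>) * C"
        using y_small S_bound [OF x(1)] x(2) DS(2) [OF x(1)] K that by (intro mult_mono) auto
      finally show ?thesis .
    qed
    ultimately show ?thesis
      by (simp add: power2_eq_square algebra_simps)
  qed
  have "((\<lambda>\<epsilon>. lam * \<epsilon> + C * sqrt (K * \<epsilon>)) \<longlongrightarrow> lam * 0 + C * sqrt (K * 0)) (at_right 0)"
    by (intro tendsto_intros)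
  moreover have "\<forall>\<^sub>F \<epsilon> in at_right 0. lam\<^sup>2 \<le> lam * \<epsilon> + C * sqrt (K * \<epsilon>)"
    using main by (auto simp: eventually_at_right_field intro!: exI [of _ 1])
  ultimately have "lam\<^sup>2 \<le> lam * 0 + C * sqrt (K * 0)"
    by (rule tendsto_lowerbound) simp
  then show False using lam0 by simp
qed

end

section \<open>Completeness: orthonormal bases, orthogonal projection and Parseval\<close>

locale hilbert_form = psd_form +
  assumes definite: "f \<in> H \<Longrightarrow> Re (B f f) = 0 \<Longrightarrow> f = 0"
    and complete: "(\<And>n. s n \<in> H) \<Longrightarrow> (\<And>e. e > 0 \<Longrightarrow> \<exists>N. \<forall>m\<ge>N. \<forall>n\<ge>N. nrm (s m - s n) < e)
      \<Longrightarrow> \<exists>l\<in>H. (\<lambda>n. nrm (s n - l)) \<longlonglongrightarrow> 0"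
begin

definition total :: "'a set \<Rightarrow> bool" where
  "total E \<longleftrightarrow> (\<forall>f\<in>H. (\<forall>e\<in>E. B f e = 0) \<longrightarrow> f = 0)"

text \<open>Zorn's lemma: a nonzero vector orthogonal to a maximal system could be normalised and
  adjoined to it. This supplies the basis that \<open>trace_class\<close> asks for.\<close>

lemma total_orthonormal_exists: "\<exists>E. orthonormal E \<and> total E"
proof -
  let ?S = "{E. orthonormal E}"
  have "\<exists>M\<in>?S. \<forall>X\<in>?S. M \<subseteq> X \<longrightarrow> X = M"
  proof (rule subset_Zorn_nonempty)
    show "?S \<noteq> {}" by (auto simp: orthonormal_def)
    fix \<C> assume C: "\<C> \<noteq> {}" "subset.chain ?S \<C>"
    have "B e e' = (if e = e' then 1 else 0)" if e: "e \<in> X" "X \<in> \<C>" "e' \<in> Y" "Y \<in> \<C>" for e e' X Y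
    proof -
      have "orthonormal X" "orthonormal Y" "X \<subseteq> Y \<or> Y \<subseteq> X"
        using C e by (auto simp: subset.chain_def)
      then show ?thesis using e unfolding orthonormal_def by blast
    qed
    moreover have "\<Union>\<C> \<subseteq> H"
      using C by (auto simp: subset.chain_def orthonormal_def)
    ultimately show "\<Union>\<C> \<in> ?S" by (auto simp: orthonormal_def)
  qed
  then obtain E where E: "orthonormal E" and max: "\<And>X. orthonormal X \<Longrightarrow> E \<subseteq> X \<Longrightarrow> X = E"
    by auto
  have "f = 0" if f: "f \<in> H" "\<And>e. e \<in> E \<Longrightarrow> B f e = 0" for f
  proof (rule ccontr)
    assume "f \<noteq> 0"
    then have "Re (B f f) \<noteq> 0" using f definite by blast
    then have pos: "nrm f > 0"
      using nonneg [OF f(1)] by (simp add: nrm_def)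
    define g where "g = sc (of_real (1 / nrm f)) f"
    have g: "g \<in> H" "B g g = 1"
    proof -
      show g: "g \<in> H" using f by (simp add: g_def)
      have "nrm g = 1" using f pos by (simp add: g_def nrm_scale norm_divide)
      then show "B g g = 1" using form_self [OF g] nrm_square [OF g] by simp
    qed
    have ge: "B g e = 0" "B e g = 0" if "e \<in> E" for e
    proof -
      have e: "e \<in> H" using E that by (auto simp: orthonormal_def)
      show "B g e = 0" using f e that by (simp add: g_def form_simps)
      then show "B e g = 0" using hermitian [OF g(1) e] by simp
    qed
    have "orthonormal (insert g E)"
      using E g ge by (auto simp: orthonormal_def)
    then have "insert g E = E" by (rule max) auto
    then show False using ge [of g] g by auto
  qed
  then show ?thesis using E by (auto simp: total_def)
qed

text \<open>\<open>V\<close> need not be closed, so the minimising sequence, Cauchy by the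
  parallelogram law, has its limit l only in \<open>H\<close>. Orthogonality of f - l to
  \<open>V\<close> is obtained as the limit of near-orthogonality of f - v n, and totality gives f =
  l.\<close>

lemma dense_if_total:
  assumes V: "subspace V" "V \<subseteq> H" "total V" and f: "f \<in> H" and "\<epsilon> > 0"
  shows "\<exists>v\<in>V. nrm (f - v) < \<epsilon>"
proof -
  define d where "d = (INF v\<in>V. (nrm (f - v))\<^sup>2)"
  have bdd: "bdd_below ((\<lambda>v. (nrm (f - v))\<^sup>2) ` V)"
    by (rule bdd_belowI2 [of _ 0]) simp
  have d: "d \<le> (nrm (f - v))\<^sup>2" if "v \<in> V" for v
    unfolding d_def using that by (rule cINF_lower [OF bdd])
  have "\<exists>v\<in>V. (nrm (f - v))\<^sup>2 < d + 1 / real (Suc n)" for n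
    using cINF_less_iff [of V "\<lambda>v. (nrm (f - v))\<^sup>2" "d + 1 / real (Suc n)"] bdd subspace_0 [OF V(1)]
    by (auto simp: d_def)
  then obtain v where vV: "\<And>n. v n \<in> V" and v: "\<And>n. (nrm (f - v n))\<^sup>2 < d + 1 / real (Suc n)"
    by metis
  have vH: "v n \<in> H" for n using vV V by blast
  have cauchy: "(nrm (v m - v n))\<^sup>2 \<le> 2 / real (Suc m) + 2 / real (Suc n)" for m n
  proof -
    have "(nrm ((f - v n) + (f - v m)))\<^sup>2 = 4 * (nrm (f - sc (1/2) (v n + v m)))\<^sup>2"
    proof -
      have "(f - v n) + (f - v m) = sc 2 (f - sc (1/2) (v n + v m))"
        by (simp add: algebra_simps scale_right_diff_distrib flip: scale_left_distrib [of 1 1, simplified])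
      then show ?thesis using f vH by (simp add: nrm_scale power_mult_distrib)
    qed
    moreover have "d \<le> (nrm (f - sc (1/2) (v n + v m)))\<^sup>2"
      by (intro d subspace_scale subspace_add vV V)
    moreover have "(f - v n) - (f - v m) = v m - v n" by simp
    ultimately show ?thesis
      using parallelogram [of "f - v n" "f - v m"] v [of n] v [of m] f vH by simp
  qed
  have "\<exists>l\<in>H. (\<lambda>n. nrm (v n - l)) \<longlonglongrightarrow> 0"
  proof (rule complete [OF vH])
    fix e :: real assume "e > 0"
    then obtain N where N: "4 / e\<^sup>2 < real N" using reals_Archimedean2 by blast
    have "nrm (v m - v n) < e" if "m \<ge> N" "n \<ge> N" for m n
    proof (rule power2_less_imp_less)
      have N0: "0 < real N" using N \<open>e > 0\<close> by (smt (verit) divide_pos_pos zero_less_power)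
      have *: "2 / real (Suc k) \<le> 2 / real N" if "k \<ge> N" for k
        using that N0 by (intro divide_left_mono) auto
      have "(nrm (v m - v n))\<^sup>2 \<le> 2 / real N + 2 / real N"
        using cauchy [of m n] * [OF that(1)] * [OF that(2)] by linarith
      also have "\<dots> < e\<^sup>2" using N N0 \<open>e > 0\<close> by (simp add: field_simps)
      finally show "(nrm (v m - v n))\<^sup>2 < e\<^sup>2" .
    qed (use \<open>e > 0\<close> in simp)
    then show "\<exists>N. \<forall>m\<ge>N. \<forall>n\<ge>N. nrm (v m - v n) < e" by blast
  qed
  then obtain l where l: "l \<in> H" and lim: "(\<lambda>n. nrm (v n - l)) \<longlonglongrightarrow> 0" by blast
  have "f - l = 0"
  proof (rule V(3) [unfolded total_def, rule_format])
    show "f - l \<in> H" using f l by simp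
    fix u assume u: "u \<in> V"
    then have uH: "u \<in> H" using V by blast
    define c where "c = Re (B u u)"
    have c: "c \<ge> 0" using nonneg [OF uH] by (simp add: c_def)
    have small: "(cmod (B (f - v n) u))\<^sup>2 \<le> (c + 1) * (1 / real (Suc n))" for n
    proof -
      \<comment> \<open>The optimal parameter along u would be 1 / c. With c + 1 the division is
        safe also for u = 0, and the squared distance still drops by at least t |b|^2.\<close>
      let ?b = "B (f - v n) u" and ?t = "1 / (c + 1)"
      let ?w = "sc (of_real ?t * ?b) u"
      have "d \<le> (nrm (f - (v n + ?w)))\<^sup>2"
        by (intro d subspace_scale subspace_add vV u V)
      also have "f - (v n + ?w) = (f - v n) - ?w" by simp
      also have "(nrm \<dots>)\<^sup>2 = (nrm (f - v n))\<^sup>2 - 2 * ?t * (cmod ?b)\<^sup>2 + ?t\<^sup>2 * (cmod ?b)\<^sup>2 * c"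
        using form_self_diff_scale [of "f - v n" u ?t] f vH uH by (simp add: nrm_square c_def)
      finally have "2 * ?t * (cmod ?b)\<^sup>2 - ?t\<^sup>2 * (cmod ?b)\<^sup>2 * c \<le> 1 / real (Suc n)"
        using v [of n] by linarith
      moreover have "?t * (cmod ?b)\<^sup>2 \<le> 2 * ?t * (cmod ?b)\<^sup>2 - ?t\<^sup>2 * (cmod ?b)\<^sup>2 * c"
      proof -
        have "?t * c \<le> 1" using c by (simp add: field_simps)
        moreover have "0 \<le> ?t" using c by simp
        ultimately have "?t * (?t * c) \<le> ?t * 1" by (rule mult_left_mono)
        then have "(cmod ?b)\<^sup>2 * (?t * (?t * c)) \<le> (cmod ?b)\<^sup>2 * (?t * 1)"
          by (rule mult_left_mono) simp
        then show ?thesis by (simp add: power2_eq_square mult_ac)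
      qed
      ultimately have "?t * (cmod ?b)\<^sup>2 \<le> 1 / real (Suc n)" by linarith
      then show ?thesis using c by (simp add: field_simps)
    qed
    have "(\<lambda>n. sqrt ((c + 1) * (1 / real (Suc n))) + nrm (v n - l) * nrm u) \<longlonglongrightarrow> sqrt ((c + 1) * 0) + 0 * nrm u"
      using LIMSEQ_inverse_real_of_nat by (intro tendsto_intros lim) (simp add: inverse_eq_divide)
    moreover have "cmod (B (f - l) u) \<le> sqrt ((c + 1) * (1 / real (Suc n))) + nrm (v n - l) * nrm u" for n
    proof -
      have "B (f - l) u = B (f - v n) u + B (v n - l) u"
        using f l vH uH by (simp add: form_simps)
      then have "cmod (B (f - l) u) \<le> cmod (B (f - v n) u) + cmod (B (v n - l) u)"
        by (simp add: norm_triangle_ineq)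
      also have "\<dots> \<le> sqrt ((c + 1) * (1 / real (Suc n))) + nrm (v n - l) * nrm u"
        using real_le_rsqrt [OF small [of n]] Cauchy_Schwarz_nrm [of "v n - l" u] l vH uH by (intro add_mono) auto
      finally show ?thesis .
    qed
    ultimately have "cmod (B (f - l) u) \<le> sqrt ((c + 1) * 0) + 0 * nrm u"
      by (intro LIMSEQ_le_const) auto
    then show "B (f - l) u = 0" by simp
  qed
  then have "(\<lambda>n. nrm (f - v n)) \<longlonglongrightarrow> 0"
    using lim nrm_minus_commute [OF f vH] by simp
  then have "eventually (\<lambda>n. nrm (f - v n) < \<epsilon>) sequentially"
    by (rule order_tendstoD) fact
  then show ?thesis using vV eventually_sequentially by auto
qed

text \<open>A combination of finitely many basis vectors approximates f, and the Bessel defect over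
  these vectors is at most the squared distance. Finite subfamilies avoid any summation over a
  possibly uncountable basis.\<close>

lemma Parseval_lower:
  assumes E: "orthonormal E" "total E" and f: "f \<in> H" and "\<epsilon> > 0"
  shows "\<exists>F\<subseteq>E. finite F \<and> (nrm f)\<^sup>2 - \<epsilon> \<le> (\<Sum>e\<in>F. (cmod (B f e))\<^sup>2)"
proof -
  have EH: "E \<subseteq> H" using E by (simp add: orthonormal_def)
  have "total (span E)"
    using E(2) span_base [of _ E] unfolding total_def by blast
  moreover have "span E \<subseteq> H" by (rule span_minimal [OF EH subspace_H])
  ultimately obtain v where v: "v \<in> span E" "nrm (f - v) < sqrt \<epsilon>"
    using dense_if_total [OF subspace_span _ _ f, of E "sqrt \<epsilon>"] \<open>\<epsilon> > 0\<close> by auto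
  obtain F r where F: "finite F" "F \<subseteq> E" "v = (\<Sum>e\<in>F. sc (r e) e)"
    using v(1) unfolding span_explicit by blast
  have "orthonormal F" using E(1) F(2) unfolding orthonormal_def by blast
  from nrm_diff_combination [OF this F(1) f, of r]
  have "(nrm f)\<^sup>2 - (\<Sum>e\<in>F. (cmod (B f e))\<^sup>2) \<le> (nrm (f - v))\<^sup>2"
    by (simp add: F(3) sum_nonneg)
  also have "\<dots> \<le> (sqrt \<epsilon>)\<^sup>2"
    using v f \<open>span E \<subseteq> H\<close> by (intro power_mono) auto
  finally show ?thesis using F \<open>\<epsilon> > 0\<close> by (intro exI [of _ F]) auto
qed

end

section \<open>The pluriharmonic Fock space as a Hilbert space\<close>

definition L2_inner :: "'a measure \<Rightarrow> ('a \<Rightarrow> complex) \<Rightarrow> ('a \<Rightarrow> complex) \<Rightarrow> complex" where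
  "L2_inner M f g = (\<integral>x. f x * cnj (g x) \<partial>M)"

abbreviation (input) fscale :: "complex \<Rightarrow> ('a \<Rightarrow> complex) \<Rightarrow> 'a \<Rightarrow> complex" where
  "fscale c f \<equiv> (\<lambda>x. c * f x)"

lemma vector_space_fscale: "vector_space (fscale :: complex \<Rightarrow> ('a \<Rightarrow> complex) \<Rightarrow> 'a \<Rightarrow> complex)"
  by unfold_locales (auto simp: fun_eq_iff algebra_simps)

lemma sum_apply: "(\<Sum>i\<in>S. f i) x = (\<Sum>i\<in>S. f i x)" for f :: "'i \<Rightarrow> 'a \<Rightarrow> complex"
  by (induction S rule: infinite_finite_induct) auto

lemma sqint_zero: "sqint M (\<lambda>x. 0)"
  by (simp add: sqint_iff)

lemma L2_inner_self: "L2_inner M f f = of_real (\<integral>x. (cmod (f x))\<^sup>2 \<partial>M)"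
  unfolding L2_inner_def by (simp only: complex_norm_square [symmetric] integral_complex_of_real)

lemma psd_form_L2: "psd_form fscale {f. sqint M f} (L2_inner M)"
proof -
  interpret vector_space "fscale :: complex \<Rightarrow> ('a \<Rightarrow> complex) \<Rightarrow> 'a \<Rightarrow> complex"
    by (rule vector_space_fscale)
  show ?thesis
  proof
    show "subspace {f. sqint M f}"
      by (auto simp: subspace_def zero_fun_def plus_fun_def sqint_zero sqint_add sqint_cmult)
    show "L2_inner M (f + g) h = L2_inner M f h + L2_inner M g h"
      if "f \<in> {f. sqint M f}" "g \<in> {f. sqint M f}" "h \<in> {f. sqint M f}" for f g h
      using that by (simp add: L2_inner_def distrib_right sqint_mult sqint_cnj)
    show "L2_inner M (fscale c f) h = c * L2_inner M f h" for f h c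
      by (simp add: L2_inner_def mult.assoc)
    show "L2_inner M g f = cnj (L2_inner M f g)" for f g
      unfolding L2_inner_def Bochner_Integration.integral_cnj [symmetric] complex_cnj_mult complex_cnj_cnj by (simp only: mult.commute)
    show "0 \<le> Re (L2_inner M f f)" for f
      by (simp add: L2_inner_self)
  qed
qed

lemma nn_integral_sqint:
  "sqint M f \<Longrightarrow> (\<integral>\<^sup>+x. ennreal ((cmod (f x))\<^sup>2) \<partial>M) = ennreal (Re (L2_inner M f f))"
  by (simp add: L2_inner_self sqint_iff nn_integral_eq_integral)

lemma L2_Cauchy_Schwarz:
  assumes "sqint M f" "sqint M g"
  shows "(cmod (\<integral>x. f x * g x \<partial>M))\<^sup>2 \<le> Re (L2_inner M f f) * Re (L2_inner M g g)"
  using psd_form.Cauchy_Schwarz [OF psd_form_L2, of f M "\<lambda>x. cnj (g x)"] assms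
  by (simp add: sqint_cnj L2_inner_self) (simp add: L2_inner_def)

lemma PH2_inner_eq_L2_inner:
  assumes "\<alpha> > 0" "sqint (fock \<alpha>) f" "sqint (fock \<alpha>) (g :: complex ^ 'n \<Rightarrow> complex)"
  shows "PH2_inner \<alpha> f g = L2_inner (fock \<alpha>) f g"
proof -
  have [measurable]: "f \<in> borel_measurable borel" "g \<in> borel_measurable borel"
    using assms by (simp_all add: sqint_def measurable_cong_sets [OF sets_fock refl])
  have "L2_inner (fock \<alpha>) f g =
      (\<integral>z. (exp (- (norm z)\<^sup>2 / \<alpha>) / (\<alpha> * pi) ^ CARD('n)) *\<^sub>R (f z * cnj (g z)) \<partial>lborel)"
    unfolding L2_inner_def fock_def using assms(1) by (subst integral_density) auto
  also have "\<dots> = (\<integral>z. f z * cnj (g z) * of_real (exp (- (norm z)\<^sup>2 / \<alpha>)) / of_real ((\<alpha> * pi) ^ CARD('n)) \<partial>lborel)"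
    by (intro Bochner_Integration.integral_cong refl) (simp add: scaleR_conv_of_real)
  also have "\<dots> = PH2_inner \<alpha> f g"
    unfolding PH2_inner_def by (rule integral_divide_zero)
  finally show ?thesis ..
qed

context
  fixes \<alpha> :: real
  assumes \<alpha>: "\<alpha> > 0"
begin

lemma PH2_sqint: "f \<in> PH2 \<alpha> \<Longrightarrow> sqint (fock \<alpha>) f"
  using \<alpha> by (simp add: PH2_iff_sqint)

lemma PH2_inner_L2: "f \<in> PH2 \<alpha> \<Longrightarrow> g \<in> PH2 \<alpha> \<Longrightarrow> PH2_inner \<alpha> f g = L2_inner (fock \<alpha>) f g"
  using \<alpha> by (simp add: PH2_inner_eq_L2_inner PH2_sqint)

lemma PH2_measurable: "f \<in> PH2 \<alpha> \<Longrightarrow> f \<in> borel_measurable borel"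
  using PH2_sqint [of f] by (simp add: sqint_def measurable_cong_sets [OF sets_fock refl])

lemma PH2_continuous: "f \<in> PH2 \<alpha> \<Longrightarrow> continuous_on UNIV f"
  using \<alpha> by (auto simp: PH2_iff_sqint pluriharmonic_def C2_function_def
    intro!: continuous_at_imp_continuous_on differentiable_imp_continuous_within)

lemma PH2I_reproducing:
  "sqint (fock \<alpha>) f \<Longrightarrow> (\<And>z. f z = (\<integral>w. Kph \<alpha> z w * f w \<partial>fock \<alpha>)) \<Longrightarrow> f \<in> PH2 \<alpha>"
  using PH2_iff_reproducing [OF \<alpha>] by blast

text \<open>As a function of w the kernel is G + cnj G - 1 with \<open>G\<close> entire, so the
  reproducing identity for \<open>G\<close> and for the constant 1 settles the claim.\<close>

lemma Kph_in_PH2: "Kph \<alpha> z \<in> PH2 \<alpha>"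
proof (rule PH2I_reproducing)
  show "sqint (fock \<alpha>) (Kph \<alpha> z)" by (rule sqint_Kph [OF \<alpha>])
  fix u
  let ?G = "\<lambda>w. exp (hdot w z / \<alpha>)"
  have K: "Kph \<alpha> z w = ?G w + cnj (?G w) - 1" for w
    by (simp add: Kph_def exp_cnj cnj_hdot)
  have int: "integrable (fock \<alpha>) (\<lambda>w. Kph \<alpha> u w * ?G w)" "integrable (fock \<alpha>) (\<lambda>w. cnj (Kph \<alpha> u w * ?G w))"
      "integrable (fock \<alpha>) (\<lambda>w. Kph \<alpha> u w * 1)"
    by (intro integrable_cnj sqint_mult sqint_Kph sqint_exp_hdot sqint_fock_const \<alpha>)+
  have "(\<integral>w. Kph \<alpha> u w * Kph \<alpha> z w \<partial>fock \<alpha>)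
      = (\<integral>w. Kph \<alpha> u w * ?G w + cnj (Kph \<alpha> u w * ?G w) - Kph \<alpha> u w * 1 \<partial>fock \<alpha>)"
    unfolding K by (simp add: algebra_simps)
  also have "\<dots> = (\<integral>w. Kph \<alpha> u w * ?G w \<partial>fock \<alpha>) + cnj (\<integral>w. Kph \<alpha> u w * ?G w \<partial>fock \<alpha>)
      - (\<integral>w. Kph \<alpha> u w * 1 \<partial>fock \<alpha>)"
    using int by (simp del: complex_cnj_mult mult_1_right)
  also have "\<dots> = Kph \<alpha> z u"
    unfolding line_entire_reproducing [OF \<alpha> line_entire_exp [OF line_entire_hdot] sqint_exp_hdot(2) [OF \<alpha>]]
      line_entire_reproducing [OF \<alpha> line_entire_const sqint_fock_const [OF \<alpha>]] K ..
  finally show "Kph \<alpha> z u = (\<integral>w. Kph \<alpha> u w * Kph \<alpha> z w \<partial>fock \<alpha>)" ..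
qed

lemma Kph_self: "Kph \<alpha> z z = of_real (2 * exp ((norm z)\<^sup>2 / \<alpha>) - 1)"
proof -
  have "exp (hdot z z / \<alpha>) = of_real (exp ((norm z)\<^sup>2 / \<alpha>))"
    unfolding hdot_self of_real_divide [symmetric] exp_of_real ..
  then show ?thesis by (simp add: Kph_def)
qed

lemma L2_inner_Kph: "f \<in> PH2 \<alpha> \<Longrightarrow> L2_inner (fock \<alpha>) f (Kph \<alpha> z) = f z"
  using PH2_reproducing [OF \<alpha>, of f z] by (simp add: L2_inner_def mult.commute)

lemma PH2_inner_Kph: "f \<in> PH2 \<alpha> \<Longrightarrow> PH2_inner \<alpha> f (Kph \<alpha> z) = f z"
  by (simp add: PH2_inner_L2 Kph_in_PH2 L2_inner_Kph)

lemma psd_form_PH2: "psd_form fscale (PH2 \<alpha> :: (complex ^ 'n \<Rightarrow> complex) set) (PH2_inner \<alpha>)"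
proof -
  interpret vector_space "fscale :: complex \<Rightarrow> (complex ^ 'n \<Rightarrow> complex) \<Rightarrow> complex ^ 'n \<Rightarrow> complex"
    by (rule vector_space_fscale)
  interpret L2: psd_form fscale "{f. sqint (fock \<alpha>) f}" "L2_inner (fock \<alpha> :: (complex ^ 'n) measure)"
    by (rule psd_form_L2)
  have sub: "subspace (PH2 \<alpha> :: (complex ^ 'n \<Rightarrow> complex) set)"
    unfolding subspace_def
  proof (intro conjI ballI allI)
    show "(0 :: complex ^ 'n \<Rightarrow> complex) \<in> PH2 \<alpha>"
      by (rule PH2I_reproducing) (simp_all add: zero_fun_def sqint_zero)
    fix f g :: "complex ^ 'n \<Rightarrow> complex" and c :: complex
    assume f: "f \<in> PH2 \<alpha>"
    show "fscale c f \<in> PH2 \<alpha>"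
    proof (rule PH2I_reproducing)
      show "c * f z = (\<integral>w. Kph \<alpha> z w * (c * f w) \<partial>fock \<alpha>)" for z
        using PH2_reproducing [OF \<alpha> f, of z] by (simp add: mult.left_commute)
    qed (intro sqint_cmult PH2_sqint f)
    assume g: "g \<in> PH2 \<alpha>"
    show "f + g \<in> PH2 \<alpha>"
    proof (rule PH2I_reproducing)
      show "sqint (fock \<alpha>) (f + g)"
        unfolding plus_fun_def by (intro sqint_add PH2_sqint f g)
      show "(f + g) z = (\<integral>w. Kph \<alpha> z w * (f + g) w \<partial>fock \<alpha>)" for z
        using PH2_reproducing [OF \<alpha> f, of z] PH2_reproducing [OF \<alpha> g, of z]
        by (simp add: distrib_left sqint_mult sqint_Kph \<alpha> PH2_sqint f g)
    qed
  qed
  show ?thesis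
  proof
    show "subspace (PH2 \<alpha> :: (complex ^ 'n \<Rightarrow> complex) set)" by (rule sub)
    fix f g h :: "complex ^ 'n \<Rightarrow> complex" and c :: complex
    assume f: "f \<in> PH2 \<alpha>"
    show "0 \<le> Re (PH2_inner \<alpha> f f)"
      using f by (simp add: PH2_inner_L2 L2.nonneg PH2_sqint)
    assume h: "h \<in> PH2 \<alpha>"
    show "PH2_inner \<alpha> (fscale c f) h = c * PH2_inner \<alpha> f h"
      using f h subspace_scale [OF sub f, of c] by (simp add: PH2_inner_L2 L2.scale_left PH2_sqint)
    show "PH2_inner \<alpha> h f = cnj (PH2_inner \<alpha> f h)"
      using f h L2.hermitian [of f h] by (simp add: PH2_inner_L2 PH2_sqint)
    assume g: "g \<in> PH2 \<alpha>"
    show "PH2_inner \<alpha> (f + g) h = PH2_inner \<alpha> f h + PH2_inner \<alpha> g h"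
      using f g h subspace_add [OF sub f g] by (simp add: PH2_inner_L2 L2.add_left PH2_sqint)
  qed
qed

text \<open>Evaluation at a point is bounded by the norm of the kernel, so a norm-Cauchy sequence
  converges pointwise. Fatou's lemma upgrades this to L2 convergence, and integration against a
  kernel is L2-continuous, so the limit is reproduced and lies in the space.\<close>

lemma hilbert_form_PH2: "hilbert_form fscale (PH2 \<alpha> :: (complex ^ 'n \<Rightarrow> complex) set) (PH2_inner \<alpha>)"
proof -
  interpret psd_form fscale "PH2 \<alpha> :: (complex ^ 'n \<Rightarrow> complex) set" "PH2_inner \<alpha>"
    by (rule psd_form_PH2)
  have point: "cmod (f z) \<le> nrm f * nrm (Kph \<alpha> z)" if "f \<in> PH2 \<alpha>" for f z
    using Cauchy_Schwarz_nrm [OF that Kph_in_PH2, of z] by (simp add: PH2_inner_Kph that)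
  show ?thesis
  proof
    fix f :: "complex ^ 'n \<Rightarrow> complex"
    assume f: "f \<in> PH2 \<alpha>" "Re (PH2_inner \<alpha> f f) = 0"
    then show "f = 0"
      using point [OF f(1)] by (simp add: nrm_def fun_eq_iff)
  next
    fix s :: "nat \<Rightarrow> complex ^ 'n \<Rightarrow> complex"
    assume s: "\<And>n. s n \<in> PH2 \<alpha>"
      and cauchy: "\<And>e. e > 0 \<Longrightarrow> \<exists>N. \<forall>m\<ge>N. \<forall>n\<ge>N. nrm (s m - s n) < e"
    have "\<exists>l. (\<lambda>n. s n z) \<longlonglongrightarrow> l" for z
    proof -
      have "Cauchy (\<lambda>n. s n z)"
      proof (rule metric_CauchyI)
        fix e :: real assume "e > 0"
        define c where "c = nrm (Kph \<alpha> z) + 1"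
        have c: "c > 0" using nrm_nonneg [OF Kph_in_PH2, of z] by (simp add: c_def)
        obtain N where N: "\<And>m n. m \<ge> N \<Longrightarrow> n \<ge> N \<Longrightarrow> nrm (s m - s n) < e / c"
          using cauchy [of "e / c"] c \<open>e > 0\<close> by auto
        have "dist (s m z) (s n z) < e" if "m \<ge> N" "n \<ge> N" for m n
        proof -
          have "dist (s m z) (s n z) \<le> nrm (s m - s n) * nrm (Kph \<alpha> z)"
            using point [of "s m - s n" z] s by (simp add: dist_norm)
          also have "\<dots> \<le> nrm (s m - s n) * c"
            using s by (intro mult_left_mono) (auto simp: c_def)
          also have "\<dots> < e" using N [OF that] c by (simp add: field_simps)
          finally show ?thesis .
        qed
        then show "\<exists>N. \<forall>m\<ge>N. \<forall>n\<ge>N. dist (s m z) (s n z) < e" by blast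
      qed
      then show ?thesis by (simp add: Cauchy_convergent_iff convergent_def)
    qed
    then obtain l where l: "\<And>z. (\<lambda>n. s n z) \<longlonglongrightarrow> l z" by metis
    note [measurable] = PH2_measurable [OF s]
    have [measurable]: "l \<in> borel_measurable borel"
      by (rule borel_measurable_LIMSEQ_metric [OF _ l]) simp
    have Fatou: "(\<integral>\<^sup>+z. ennreal ((cmod (s n z - l z))\<^sup>2) \<partial>fock \<alpha>) \<le> ennreal (e\<^sup>2)"
      if "e > 0" "\<And>m. m \<ge> N \<Longrightarrow> nrm (s n - s m) < e" for n N e
    proof -
      have "(\<integral>\<^sup>+z. ennreal ((cmod (s n z - l z))\<^sup>2) \<partial>fock \<alpha>)
          = (\<integral>\<^sup>+z. liminf (\<lambda>m. ennreal ((cmod (s n z - s m z))\<^sup>2)) \<partial>fock \<alpha>)"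
        by (intro nn_integral_cong lim_imp_Liminf [symmetric] tendsto_intros l) simp
      also have "\<dots> \<le> liminf (\<lambda>m. \<integral>\<^sup>+z. ennreal ((cmod (s n z - s m z))\<^sup>2) \<partial>fock \<alpha>)"
        by (rule nn_integral_liminf) measurable
      also have "\<dots> \<le> ennreal (e\<^sup>2)"
      proof (rule Liminf_le)
        show "\<forall>\<^sub>F m in sequentially. (\<integral>\<^sup>+z. ennreal ((cmod (s n z - s m z))\<^sup>2) \<partial>fock \<alpha>) \<le> ennreal (e\<^sup>2)"
          using eventually_ge_at_top [of N]
        proof eventually_elim
          case (elim m)
          have d: "s n - s m \<in> PH2 \<alpha>" using s by simp
          have "(\<integral>\<^sup>+z. ennreal ((cmod (s n z - s m z))\<^sup>2) \<partial>fock \<alpha>) = ennreal ((nrm (s n - s m))\<^sup>2)"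
            using nn_integral_sqint [OF PH2_sqint [OF d]] by (simp add: nrm_square d PH2_inner_L2)
          also have "\<dots> \<le> ennreal (e\<^sup>2)"
            using that(2) [OF elim] nrm_nonneg [OF d] by (intro ennreal_leI power_mono) auto
          finally show ?case .
        qed
      qed simp
      finally show ?thesis .
    qed
    have diff_sqint: "sqint (fock \<alpha>) (\<lambda>z. s n z - l z)"
      if "e > 0" "\<And>m. m \<ge> N \<Longrightarrow> nrm (s n - s m) < e" for n N e
      unfolding sqint_def using le_less_trans [OF Fatou [OF that]] by (simp add: measurable_cong_sets [OF sets_fock refl])
    have "sqint (fock \<alpha>) l"
    proof -
      obtain N where N: "\<And>m n. m \<ge> N \<Longrightarrow> n \<ge> N \<Longrightarrow> nrm (s m - s n) < 1"
        using cauchy [of 1] by auto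
      have "sqint (fock \<alpha>) (\<lambda>z. s N z + (-1) * (s N z - l z))"
        by (intro sqint_add sqint_cmult PH2_sqint s diff_sqint [of 1 N]) (use N in auto)
      then show ?thesis by simp
    qed
    have main: "\<exists>N. \<forall>n\<ge>N. sqint (fock \<alpha>) (\<lambda>z. s n z - l z) \<and> Re (L2_inner (fock \<alpha>) (\<lambda>z. s n z - l z) (\<lambda>z. s n z - l z)) \<le> e\<^sup>2"
      if "e > 0" for e
    proof -
      obtain N where N: "\<And>m n. m \<ge> N \<Longrightarrow> n \<ge> N \<Longrightarrow> nrm (s m - s n) < e"
        using cauchy [OF \<open>e > 0\<close>] by auto
      have "sqint (fock \<alpha>) (\<lambda>z. s n z - l z) \<and> Re (L2_inner (fock \<alpha>) (\<lambda>z. s n z - l z) (\<lambda>z. s n z - l z)) \<le> e\<^sup>2"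
        if n: "n \<ge> N" for n
      proof -
        have sq: "sqint (fock \<alpha>) (\<lambda>z. s n z - l z)"
          by (rule diff_sqint [OF \<open>e > 0\<close>, of N]) (use N n in auto)
        moreover have "ennreal (Re (L2_inner (fock \<alpha>) (\<lambda>z. s n z - l z) (\<lambda>z. s n z - l z))) \<le> ennreal (e\<^sup>2)"
          unfolding nn_integral_sqint [OF sq, symmetric] by (rule Fatou [OF \<open>e > 0\<close>, of N]) (use N n in auto)
        ultimately show ?thesis by simp
      qed
      then show ?thesis by blast
    qed
    have "l \<in> PH2 \<alpha>"
    proof (rule PH2I_reproducing)
      show "sqint (fock \<alpha>) l" by fact
      fix z :: "complex ^ 'n"
      let ?k = "Re (L2_inner (fock \<alpha>) (Kph \<alpha> z) (Kph \<alpha> z))"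
      have k0: "0 \<le> ?k" by (simp add: L2_inner_self)
      have "(\<lambda>n. s n z - (\<integral>w. Kph \<alpha> z w * l w \<partial>fock \<alpha>)) \<longlonglongrightarrow> 0"
      proof (rule metric_LIMSEQ_I)
        fix e :: real assume "e > 0"
        define d where "d = e / (sqrt ?k + 1)"
        have d: "d > 0" using \<open>e > 0\<close> k0 by (simp add: d_def add_nonneg_pos)
        obtain N where N: "\<And>n. n \<ge> N \<Longrightarrow> sqint (fock \<alpha>) (\<lambda>z. s n z - l z)"
            "\<And>n. n \<ge> N \<Longrightarrow> Re (L2_inner (fock \<alpha>) (\<lambda>z. s n z - l z) (\<lambda>z. s n z - l z)) \<le> d\<^sup>2"
          using main [OF d] by blast
        have "dist (s n z - (\<integral>w. Kph \<alpha> z w * l w \<partial>fock \<alpha>)) 0 < e" if "n \<ge> N" for n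
        proof -
          have "s n z - (\<integral>w. Kph \<alpha> z w * l w \<partial>fock \<alpha>) = (\<integral>w. Kph \<alpha> z w * (s n w - l w) \<partial>fock \<alpha>)"
            using PH2_reproducing [OF \<alpha> s, of z n] \<open>sqint (fock \<alpha>) l\<close>
            by (simp add: right_diff_distrib sqint_mult sqint_Kph \<alpha> PH2_sqint s)
          then have "(cmod (s n z - (\<integral>w. Kph \<alpha> z w * l w \<partial>fock \<alpha>)))\<^sup>2 \<le> ?k * d\<^sup>2"
            using L2_Cauchy_Schwarz [OF sqint_Kph [OF \<alpha>] N(1) [OF that], of z] mult_left_mono [OF N(2) [OF that] k0]
            by simp
          also have "\<dots> = (sqrt ?k * d)\<^sup>2" using k0 by (simp add: power_mult_distrib)
          finally have "cmod (s n z - (\<integral>w. Kph \<alpha> z w * l w \<partial>fock \<alpha>)) \<le> sqrt ?k * d"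
            by (rule power2_le_imp_le) (use d k0 in simp)
          also have "\<dots> < (sqrt ?k + 1) * d" using d by simp
          also have "\<dots> = e" using k0 by (simp add: d_def add_nonneg_eq_0_iff)
          finally show ?thesis by simp
        qed
        then show "\<exists>N. \<forall>n\<ge>N. dist (s n z - (\<integral>w. Kph \<alpha> z w * l w \<partial>fock \<alpha>)) 0 < e" by blast
      qed
      then have "(\<lambda>n. s n z) \<longlonglongrightarrow> (\<integral>w. Kph \<alpha> z w * l w \<partial>fock \<alpha>)"
        by (simp add: LIM_zero_iff)
      then show "l z = (\<integral>w. Kph \<alpha> z w * l w \<partial>fock \<alpha>)"
        using l LIMSEQ_unique by blast
    qed
    moreover have "(\<lambda>n. nrm (s n - l)) \<longlonglongrightarrow> 0"
    proof (rule metric_LIMSEQ_I)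
      fix e :: real assume "e > 0"
      then obtain N where N: "\<And>n. n \<ge> N \<Longrightarrow> Re (L2_inner (fock \<alpha>) (\<lambda>z. s n z - l z) (\<lambda>z. s n z - l z)) \<le> (e / 2)\<^sup>2"
        using main [of "e / 2"] by auto
      have "dist (nrm (s n - l)) 0 < e" if "n \<ge> N" for n
      proof -
        have d: "s n - l \<in> PH2 \<alpha>" using s \<open>l \<in> PH2 \<alpha>\<close> by simp
        have "(nrm (s n - l))\<^sup>2 \<le> (e / 2)\<^sup>2"
          using N [OF that] unfolding nrm_square [OF d] PH2_inner_L2 [OF d d] by (simp only: fun_diff_def)
        then have "nrm (s n - l) \<le> e / 2"
          by (rule power2_le_imp_le) (use \<open>e > 0\<close> in simp)
        then show ?thesis using nrm_nonneg [OF d] \<open>e > 0\<close> by simp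
      qed
      then show "\<exists>N. \<forall>n\<ge>N. dist (nrm (s n - l)) 0 < e" by blast
    qed
    ultimately show "\<exists>l\<in>PH2 \<alpha>. (\<lambda>n. nrm (s n - l)) \<longlonglongrightarrow> 0" by blast
  qed
qed

text \<open>The 2 comes from K(w,w) \<le> 2 exp (|w|^2 / \<alpha>). Integrated against a finite
  \<mu>, the estimate embeds the space continuously into L2(\<nu>).\<close>

lemma PH2_pointwise:
  assumes f: "f \<in> PH2 \<alpha>"
  shows "(cmod (f w))\<^sup>2 * exp (- (norm w)\<^sup>2 / \<alpha>) \<le> 2 * Re (PH2_inner \<alpha> f f)"
proof -
  interpret psd_form fscale "PH2 \<alpha>" "PH2_inner \<alpha>" by (rule psd_form_PH2)
  have "(cmod (f w))\<^sup>2 \<le> Re (PH2_inner \<alpha> f f) * (2 * exp ((norm w)\<^sup>2 / \<alpha>) - 1)"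
    using Cauchy_Schwarz [OF f Kph_in_PH2, of w]
    by (simp only: PH2_inner_Kph f Kph_in_PH2 Kph_self Re_complex_of_real)
  also have "\<dots> \<le> Re (PH2_inner \<alpha> f f) * (2 * exp ((norm w)\<^sup>2 / \<alpha>))"
    by (intro mult_left_mono nonneg f) simp
  finally have "(cmod (f w))\<^sup>2 * exp (- (norm w)\<^sup>2 / \<alpha>) \<le> Re (PH2_inner \<alpha> f f) * (2 * exp ((norm w)\<^sup>2 / \<alpha>)) * exp (- (norm w)\<^sup>2 / \<alpha>)"
    by (rule mult_right_mono) simp
  also have "\<dots> = 2 * Re (PH2_inner \<alpha> f f)"
    by (simp add: exp_minus)
  finally show ?thesis .
qed

end

section \<open>Trace class Toeplitz operators\<close>

context
  fixes \<alpha> :: real and \<mu> \<nu> :: "(complex ^ 'n) measure"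
  assumes \<alpha>: "\<alpha> > 0" and sets_\<mu>: "sets \<mu> = sets borel"
  defines "\<nu> \<equiv> density \<mu> (\<lambda>w. ennreal (exp (- (norm w)\<^sup>2 / \<alpha>)))"
begin

lemma sets_\<nu>: "sets \<nu> = sets borel"
  by (simp add: \<nu>_def sets_\<mu>)

lemma weight_measurable: "(\<lambda>w :: complex ^ 'n. ennreal (exp (- (norm w)\<^sup>2 / \<alpha>))) \<in> borel_measurable \<mu>"
  unfolding measurable_cong_sets [OF sets_\<mu> refl] by measurable

lemma measurable_\<mu>_\<nu>: "borel_measurable \<mu> = borel_measurable borel" "borel_measurable \<nu> = borel_measurable borel"
  using measurable_cong_sets [OF sets_\<mu> refl] measurable_cong_sets [OF sets_\<nu> refl] by auto

lemma nn_integral_\<nu>: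
  "f \<in> borel_measurable borel \<Longrightarrow> (\<integral>\<^sup>+w. f w \<partial>\<nu>) = (\<integral>\<^sup>+w. ennreal (exp (- (norm w)\<^sup>2 / \<alpha>)) * f w \<partial>\<mu>)"
  unfolding \<nu>_def by (rule nn_integral_density) (simp_all add: weight_measurable measurable_\<mu>_\<nu>)

lemma toeplitz_eq:
  assumes "f \<in> borel_measurable borel"
  shows "toeplitz \<alpha> \<mu> f z = (\<integral>w. Kph \<alpha> z w * f w \<partial>\<nu>)"
proof -
  have [measurable]: "Kph \<alpha> z \<in> borel_measurable borel"
    by (rule PH2_measurable [OF \<alpha> Kph_in_PH2 [OF \<alpha>]])
  have "(\<integral>w. Kph \<alpha> z w * f w \<partial>\<nu>) = (\<integral>w. exp (- (norm w)\<^sup>2 / \<alpha>) *\<^sub>R (Kph \<alpha> z w * f w) \<partial>\<mu>)"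
    unfolding \<nu>_def using assms
    by (intro integral_density) (auto simp: measurable_\<mu>_\<nu>)
  also have "\<dots> = toeplitz \<alpha> \<mu> f z"
    unfolding toeplitz_def by (intro Bochner_Integration.integral_cong refl) (simp add: scaleR_conv_of_real mult.commute)
  finally show ?thesis ..
qed

section \<open>Finite measure implies trace class\<close>

lemma toeplitz_trace_class_if_finite:
  assumes fin: "emeasure \<mu> UNIV < \<infinity>"
  shows "toeplitz_trace_class \<alpha> \<mu>"
proof -
  interpret hilbert_form fscale "PH2 \<alpha> :: (complex ^ 'n \<Rightarrow> complex) set" "PH2_inner \<alpha>"
    by (rule hilbert_form_PH2 [OF \<alpha>])
  let ?H = "PH2 \<alpha> :: (complex ^ 'n \<Rightarrow> complex) set"
  define T where "T = toeplitz \<alpha> \<mu>"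
  define m where "m = measure \<mu> UNIV"
  have m: "emeasure \<mu> UNIV = ennreal m" "m \<ge> 0"
    using fin by (simp_all add: m_def emeasure_eq_ennreal_measure less_top)
  have space_\<mu>: "space \<mu> = UNIV" using sets_eq_imp_space_eq [OF sets_\<mu>] by simp
  have space_\<nu>: "space \<nu> = UNIV" by (simp add: \<nu>_def space_\<mu>)
  have le_m: "(\<integral>\<^sup>+w. f w \<partial>\<nu>) \<le> ennreal (c * m)"
    if "f \<in> borel_measurable borel" "\<And>w. ennreal (exp (- (norm w)\<^sup>2 / \<alpha>)) * f w \<le> ennreal c" "c \<ge> 0" for f c
  proof -
    have "(\<integral>\<^sup>+w. f w \<partial>\<nu>) \<le> (\<integral>\<^sup>+w. ennreal c \<partial>\<mu>)"
      unfolding nn_integral_\<nu> [OF that(1)] by (intro nn_integral_mono that(2))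
    also have "\<dots> = ennreal (c * m)" using m that(3) by (simp add: space_\<mu> ennreal_mult)
    finally show ?thesis .
  qed
  have "finite_measure \<nu>"
  proof (rule finite_measureI)
    have "emeasure \<nu> (space \<nu>) = (\<integral>\<^sup>+w. 1 \<partial>\<nu>)" by simp
    also have "\<dots> \<le> ennreal (1 * m)"
      using \<alpha> by (intro le_m) auto
    finally show "emeasure \<nu> (space \<nu>) \<noteq> \<infinity>" by (auto simp: top_unique)
  qed
  then interpret \<nu>: finite_measure \<nu> .
  interpret \<gamma>: prob_space "fock \<alpha> :: (complex ^ 'n) measure" by (rule prob_space_fock [OF \<alpha>])
  interpret pair: pair_sigma_finite "fock \<alpha> :: (complex ^ 'n) measure" \<nu> ..
  have meas: "f \<in> borel_measurable borel" if "f \<in> ?H" for f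
    using that by (rule PH2_measurable [OF \<alpha>])
  have nn_bound: "(\<integral>\<^sup>+w. ennreal ((cmod (f w))\<^sup>2) \<partial>\<nu>) \<le> ennreal (2 * (nrm f)\<^sup>2 * m)" if f: "f \<in> ?H" for f
  proof (rule le_m)
    note [measurable] = meas [OF f]
    show "(\<lambda>w. ennreal ((cmod (f w))\<^sup>2)) \<in> borel_measurable borel" by measurable
    show "ennreal (exp (- (norm w)\<^sup>2 / \<alpha>)) * ennreal ((cmod (f w))\<^sup>2) \<le> ennreal (2 * (nrm f)\<^sup>2)" for w
      using PH2_pointwise [OF \<alpha> f, of w] f by (simp add: nrm_square mult.commute ennreal_leI flip: ennreal_mult)
  qed (use m in simp)
  have sq: "sqint \<nu> f" if "f \<in> ?H" for f
    unfolding sqint_def using le_less_trans [OF nn_bound [OF that]] meas [OF that] by (simp add: measurable_\<mu>_\<nu>)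
  \<comment> \<open>The weight times the kernel diagonal is 2 - exp (-a) \<le> 2 with a = |w|^2 /
    \<alpha>; the total mass then gives 2 m, the bound that serves both boundedness and the
    trace.\<close>
  have K_bound: "(\<integral>\<^sup>+w. ennreal (Re (Kph \<alpha> w w)) \<partial>\<nu>) \<le> ennreal (2 * m)"
  proof (rule le_m)
    show "(\<lambda>w :: complex ^ 'n. ennreal (Re (Kph \<alpha> w w))) \<in> borel_measurable borel"
      unfolding Kph_self [OF \<alpha>] by measurable
    show "ennreal (exp (- (norm w)\<^sup>2 / \<alpha>)) * ennreal (Re (Kph \<alpha> w w)) \<le> ennreal 2" for w :: "complex ^ 'n"
    proof -
      define a where "a = (norm w)\<^sup>2 / \<alpha>"
      have "0 \<le> a" using \<alpha> by (simp add: a_def)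
      then have "1 \<le> exp a" by simp
      then have "0 \<le> 2 * exp a - 1" by linarith
      have "ennreal (exp (- a)) * ennreal (2 * exp a - 1) = ennreal (exp (- a) * (2 * exp a - 1))"
        by (intro ennreal_mult [symmetric] exp_ge_zero) fact
      also have "\<dots> \<le> ennreal 2"
        by (intro ennreal_leI) (simp add: exp_minus field_simps)
      finally show ?thesis
        unfolding Kph_self [OF \<alpha>] by (simp add: a_def)
    qed
  qed simp
  have L2_K: "Re (L2_inner (fock \<alpha>) (Kph \<alpha> z) (Kph \<alpha> z)) = Re (Kph \<alpha> z z)" for z :: "complex ^ 'n"
    by (simp add: L2_inner_Kph [OF \<alpha> Kph_in_PH2 [OF \<alpha>]])
  have nn_K: "(\<integral>\<^sup>+z. ennreal ((cmod (Kph \<alpha> z w))\<^sup>2) \<partial>fock \<alpha>) = ennreal (Re (Kph \<alpha> w w))" for w :: "complex ^ 'n"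
  proof -
    have "(\<integral>\<^sup>+z. ennreal ((cmod (Kph \<alpha> z w))\<^sup>2) \<partial>fock \<alpha>) = (\<integral>\<^sup>+z. ennreal ((cmod (Kph \<alpha> w z))\<^sup>2) \<partial>fock \<alpha>)"
      by (rule nn_integral_cong) (subst Kph_commute, rule refl)
    then show ?thesis
      unfolding nn_integral_sqint [OF sqint_Kph [OF \<alpha>]] L2_K .
  qed
  have T: "T f z = (\<integral>w. Kph \<alpha> z w * f w \<partial>\<nu>)" if "f \<in> ?H" for f z
    unfolding T_def by (rule toeplitz_eq [OF meas [OF that]])
  have intK: "integrable \<nu> (\<lambda>w. Kph \<alpha> z w * f w)" if "f \<in> ?H" for f z
    by (intro sqint_mult sq Kph_in_PH2 [OF \<alpha>] that)
  have [measurable]: "(\<lambda>x. Kph \<alpha> (fst x) (snd x)) \<in> borel_measurable (borel \<Otimes>\<^sub>M (borel :: (complex ^ 'n) measure))"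
    "(\<lambda>x. Kph \<alpha> (snd x) (fst x)) \<in> borel_measurable (borel \<Otimes>\<^sub>M (borel :: (complex ^ 'n) measure))"
    unfolding Kph_def by measurable
  note [measurable_cong] = sets_\<nu>
  \<comment> \<open>A Hilbert-Schmidt estimate, carried out in L2(fock) since \<open>T f\<close> is
    not yet known to lie in the space. Cauchy-Schwarz in L2(\<nu>) separates kernel and f; after
    Tonelli the integral of |K(z,w)|^2 over z is K(w,w), and each factor contributes 2 m.\<close>
  have Tsq: "sqint (fock \<alpha>) (T f)" and T_bound: "Re (L2_inner (fock \<alpha>) (T f) (T f)) \<le> (2 * m)\<^sup>2 * (nrm f)\<^sup>2"
    if f: "f \<in> ?H" for f
  proof -
    note [measurable] = meas [OF f]
    have Tm [measurable]: "T f \<in> borel_measurable borel"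
    proof -
      have "(\<lambda>z. \<integral>w. Kph \<alpha> z w * f w \<partial>\<nu>) \<in> borel_measurable borel"
        by (rule \<nu>.borel_measurable_lebesgue_integral) (simp add: split_beta')
      moreover have "T f = (\<lambda>z. \<integral>w. Kph \<alpha> z w * f w \<partial>\<nu>)"
        using T [OF f] by (simp add: fun_eq_iff)
      ultimately show ?thesis by simp
    qed
    have nnf: "ennreal (Re (L2_inner \<nu> f f)) \<le> ennreal (2 * (nrm f)\<^sup>2 * m)"
      using nn_bound [OF f] by (simp only: nn_integral_sqint [OF sq [OF f]])
    have "(\<integral>\<^sup>+z. ennreal ((cmod (T f z))\<^sup>2) \<partial>fock \<alpha>)
        \<le> (\<integral>\<^sup>+z. (\<integral>\<^sup>+w. ennreal ((cmod (Kph \<alpha> z w))\<^sup>2) \<partial>\<nu>) * ennreal (2 * (nrm f)\<^sup>2 * m) \<partial>fock \<alpha>)"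
    proof (rule nn_integral_mono)
      fix z :: "complex ^ 'n"
      have "ennreal ((cmod (T f z))\<^sup>2) \<le> ennreal (Re (L2_inner \<nu> (Kph \<alpha> z) (Kph \<alpha> z)) * Re (L2_inner \<nu> f f))"
        unfolding T [OF f] by (intro ennreal_leI L2_Cauchy_Schwarz sq Kph_in_PH2 \<alpha> f)
      also have "\<dots> = ennreal (Re (L2_inner \<nu> (Kph \<alpha> z) (Kph \<alpha> z))) * ennreal (Re (L2_inner \<nu> f f))"
        by (intro ennreal_mult) (simp_all add: L2_inner_self)
      also have "\<dots> \<le> ennreal (Re (L2_inner \<nu> (Kph \<alpha> z) (Kph \<alpha> z))) * ennreal (2 * (nrm f)\<^sup>2 * m)"
        by (intro mult_left_mono nnf) simp
      finally show "ennreal ((cmod (T f z))\<^sup>2) \<le> (\<integral>\<^sup>+w. ennreal ((cmod (Kph \<alpha> z w))\<^sup>2) \<partial>\<nu>) * ennreal (2 * (nrm f)\<^sup>2 * m)"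
        by (simp only: nn_integral_sqint [OF sq [OF Kph_in_PH2 [OF \<alpha>]]])
    qed
    also have "\<dots> = (\<integral>\<^sup>+z. (\<integral>\<^sup>+w. ennreal ((cmod (Kph \<alpha> z w))\<^sup>2) \<partial>\<nu>) \<partial>fock \<alpha>) * ennreal (2 * (nrm f)\<^sup>2 * m)"
      by (rule nn_integral_multc) (auto intro!: \<nu>.borel_measurable_nn_integral simp: split_beta')
    also have "(\<integral>\<^sup>+z. (\<integral>\<^sup>+w. ennreal ((cmod (Kph \<alpha> z w))\<^sup>2) \<partial>\<nu>) \<partial>fock \<alpha>)
        = (\<integral>\<^sup>+w. (\<integral>\<^sup>+z. ennreal ((cmod (Kph \<alpha> z w))\<^sup>2) \<partial>fock \<alpha>) \<partial>\<nu>)"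
      by (rule pair.Fubini' [symmetric]) (simp add: split_beta')
    also have "\<dots> * ennreal (2 * (nrm f)\<^sup>2 * m) \<le> ennreal (2 * m) * ennreal (2 * (nrm f)\<^sup>2 * m)"
      unfolding nn_K by (intro mult_right_mono K_bound) simp
    also have "\<dots> = ennreal ((2 * m)\<^sup>2 * (nrm f)\<^sup>2)"
      using m(2) by (simp add: power2_eq_square mult_ac flip: ennreal_mult)
    finally have le: "(\<integral>\<^sup>+z. ennreal ((cmod (T f z))\<^sup>2) \<partial>fock \<alpha>) \<le> ennreal ((2 * m)\<^sup>2 * (nrm f)\<^sup>2)" .
    then show sqT: "sqint (fock \<alpha>) (T f)"
      unfolding sqint_def using le_less_trans [OF le] by simp
    show "Re (L2_inner (fock \<alpha>) (T f) (T f)) \<le> (2 * m)\<^sup>2 * (nrm f)\<^sup>2"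
      using le unfolding nn_integral_sqint [OF sqT] by simp
  qed
  \<comment> \<open>Fubini brings the z-integral inside, where it reproduces g at w; only g has to
    lie in the range of the reproducing identity.\<close>
  have weak: "L2_inner (fock \<alpha>) (T f) g = L2_inner \<nu> f g" if f: "f \<in> ?H" and g: "g \<in> ?H" for f g
  proof -
    note [measurable] = meas [OF f] meas [OF g]
    let ?F = "\<lambda>z w. Kph \<alpha> z w * f w * cnj (g z)"
    have int: "integrable (fock \<alpha> \<Otimes>\<^sub>M \<nu>) (\<lambda>(z, w). ?F z w)"
    proof (rule integrableI_bounded)
      show "(\<lambda>(z, w). ?F z w) \<in> borel_measurable (fock \<alpha> \<Otimes>\<^sub>M \<nu>)"
        by (simp add: split_beta')
      have "(\<integral>\<^sup>+x. ennreal (norm (case x of (z, w) \<Rightarrow> ?F z w)) \<partial>(fock \<alpha> \<Otimes>\<^sub>M \<nu>))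
        \<le> (\<integral>\<^sup>+x. ennreal ((cmod (Kph \<alpha> (fst x) (snd x)))\<^sup>2) + ennreal ((cmod (g (fst x)))\<^sup>2) * ennreal ((cmod (f (snd x)))\<^sup>2) \<partial>(fock \<alpha> \<Otimes>\<^sub>M \<nu>))"
      proof (rule nn_integral_mono)
        fix x :: "(complex ^ 'n) \<times> (complex ^ 'n)"
        have "a * b \<le> a\<^sup>2 + b\<^sup>2" if "a \<ge> 0" "b \<ge> 0" for a b :: real
          using sum_squares_bound [of a b] mult_nonneg_nonneg [OF that] by linarith
        from this [of "cmod (Kph \<alpha> (fst x) (snd x))" "cmod (g (fst x)) * cmod (f (snd x))"]
        show "ennreal (norm (case x of (z, w) \<Rightarrow> ?F z w)) \<le>
           ennreal ((cmod (Kph \<alpha> (fst x) (snd x)))\<^sup>2) + ennreal ((cmod (g (fst x)))\<^sup>2) * ennreal ((cmod (f (snd x)))\<^sup>2)"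
          by (simp add: split_beta norm_mult power_mult_distrib mult_ac flip: ennreal_mult ennreal_plus)
      qed
      also have "\<dots> = (\<integral>\<^sup>+x. ennreal ((cmod (Kph \<alpha> (fst x) (snd x)))\<^sup>2) \<partial>(fock \<alpha> \<Otimes>\<^sub>M \<nu>))
          + (\<integral>\<^sup>+x. ennreal ((cmod (g (fst x)))\<^sup>2) * ennreal ((cmod (f (snd x)))\<^sup>2) \<partial>(fock \<alpha> \<Otimes>\<^sub>M \<nu>))"
        by (rule nn_integral_add) measurable
      also have "(\<integral>\<^sup>+x. ennreal ((cmod (Kph \<alpha> (fst x) (snd x)))\<^sup>2) \<partial>(fock \<alpha> \<Otimes>\<^sub>M \<nu>))
          = (\<integral>\<^sup>+w. ennreal (Re (Kph \<alpha> w w)) \<partial>\<nu>)"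
        by (subst pair.nn_integral_snd [symmetric]) (simp_all add: nn_K)
      also have "(\<integral>\<^sup>+x. ennreal ((cmod (g (fst x)))\<^sup>2) * ennreal ((cmod (f (snd x)))\<^sup>2) \<partial>(fock \<alpha> \<Otimes>\<^sub>M \<nu>))
          = (\<integral>\<^sup>+z. ennreal ((cmod (g z))\<^sup>2) \<partial>fock \<alpha>) * (\<integral>\<^sup>+w. ennreal ((cmod (f w))\<^sup>2) \<partial>\<nu>)"
        by (subst \<nu>.nn_integral_fst [symmetric]) (simp_all add: nn_integral_cmult nn_integral_multc)
      also have "(\<integral>\<^sup>+w. ennreal (Re (Kph \<alpha> w w)) \<partial>\<nu>)
          + (\<integral>\<^sup>+z. ennreal ((cmod (g z))\<^sup>2) \<partial>fock \<alpha>) * (\<integral>\<^sup>+w. ennreal ((cmod (f w))\<^sup>2) \<partial>\<nu>) < \<infinity>"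
        using le_less_trans [OF K_bound] PH2_sqint [OF \<alpha> g] sq [OF f]
        by (simp add: sqint_def ennreal_mult_less_top)
      finally show "(\<integral>\<^sup>+x. ennreal (norm (case x of (z, w) \<Rightarrow> ?F z w)) \<partial>(fock \<alpha> \<Otimes>\<^sub>M \<nu>)) < \<infinity>" .
    qed
    have "L2_inner (fock \<alpha>) (T f) g = (\<integral>z. (\<integral>w. ?F z w \<partial>\<nu>) \<partial>fock \<alpha>)"
      unfolding L2_inner_def T [OF f] by simp
    also have "\<dots> = (\<integral>w. (\<integral>z. ?F z w \<partial>fock \<alpha>) \<partial>\<nu>)"
      by (rule pair.Fubini_integral [OF int, symmetric])
    also have "\<dots> = (\<integral>w. f w * cnj (g w) \<partial>\<nu>)"
    proof (intro Bochner_Integration.integral_cong refl)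
      fix w
      have "(\<integral>z. ?F z w \<partial>fock \<alpha>) = (\<integral>z. f w * cnj (Kph \<alpha> w z * g z) \<partial>fock \<alpha>)"
        by (intro Bochner_Integration.integral_cong refl, subst Kph_commute) (simp add: mult_ac)
      also have "\<dots> = f w * cnj (\<integral>z. Kph \<alpha> w z * g z \<partial>fock \<alpha>)"
        by (simp del: complex_cnj_mult)
      finally show "(\<integral>z. ?F z w \<partial>fock \<alpha>) = f w * cnj (g w)"
        by (simp only: PH2_reproducing [OF \<alpha> g])
    qed
    finally show ?thesis by (simp add: L2_inner_def)
  qed
  \<comment> \<open>With g a kernel, the form identity says that \<open>T f\<close> is
    reproduced.\<close>
  have TH: "T f \<in> ?H" if f: "f \<in> ?H" for f
  proof (rule PH2I_reproducing [OF \<alpha> Tsq [OF f]])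
    fix z
    have "(\<integral>w. Kph \<alpha> z w * T f w \<partial>fock \<alpha>) = L2_inner (fock \<alpha>) (T f) (Kph \<alpha> z)"
      by (simp add: L2_inner_def mult.commute)
    also have "\<dots> = T f z"
      unfolding weak [OF f Kph_in_PH2 [OF \<alpha>]] T [OF f] by (simp add: L2_inner_def mult.commute)
    finally show "T f z = (\<integral>w. Kph \<alpha> z w * T f w \<partial>fock \<alpha>)" ..
  qed
  have ipT: "PH2_inner \<alpha> (T f) g = L2_inner \<nu> f g" if "f \<in> ?H" "g \<in> ?H" for f g
    using that by (simp add: PH2_inner_L2 \<alpha> TH weak)
  have T_bounded: "bounded_operator ?H (PH2_inner \<alpha>) T"
    unfolding bounded_operator_def
  proof (intro conjI ballI allI)
    fix f g :: "complex ^ 'n \<Rightarrow> complex" and c :: complex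
    assume f: "f \<in> ?H"
    show "T f \<in> ?H" using f by (rule TH)
    have cf: "(\<lambda>x. c * f x) \<in> ?H" using H_closed(5) [OF f] by simp
    show "T (\<lambda>x. c * f x) = (\<lambda>x. c * T f x)"
      by (simp add: fun_eq_iff T f cf mult.left_commute)
    assume g: "g \<in> ?H"
    have fg: "(\<lambda>x. f x + g x) \<in> ?H" using H_closed(2) [OF f g] by (simp add: plus_fun_def)
    show "T (\<lambda>x. f x + g x) = (\<lambda>x. T f x + T g x)"
      by (simp add: fun_eq_iff T f g fg distrib_left intK)
  next
    show "\<exists>C. \<forall>f\<in>?H. hnorm (PH2_inner \<alpha>) (T f) \<le> C * hnorm (PH2_inner \<alpha>) f"
    proof (intro exI ballI)
      fix f assume f: "f \<in> ?H"
      have "(nrm (T f))\<^sup>2 \<le> (2 * m * nrm f)\<^sup>2"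
        using T_bound [OF f] by (simp add: nrm_square TH f PH2_inner_L2 \<alpha> power_mult_distrib)
      then have "nrm (T f) \<le> 2 * m * nrm f"
        by (rule power2_le_imp_le) (use m f in simp)
      then show "hnorm (PH2_inner \<alpha>) (T f) \<le> 2 * m * hnorm (PH2_inner \<alpha>) f"
        by (simp add: hnorm_def nrm_def)
    qed
  qed
  have T_positive: "positive_operator ?H (PH2_inner \<alpha>) T"
    unfolding positive_operator_def
    using T_bounded by (auto simp: ipT L2_inner_self nonneg_Reals_of_real_iff)
  have "is_adjoint ?H (PH2_inner \<alpha>) T T"
    unfolding is_adjoint_def
  proof (intro conjI ballI T_bounded)
    fix f g assume f: "f \<in> ?H" and g: "g \<in> ?H"
    have "PH2_inner \<alpha> f (T g) = cnj (L2_inner \<nu> g f)"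
      using hermitian [OF TH [OF g] f] by (simp add: ipT f g)
    also have "\<dots> = L2_inner \<nu> f g"
      unfolding L2_inner_def Bochner_Integration.integral_cnj [symmetric] by (simp add: mult.commute)
    finally show "PH2_inner \<alpha> (T f) g = PH2_inner \<alpha> f (T g)" by (simp add: ipT f g)
  qed
  then have T_abs: "is_absolute_value ?H (PH2_inner \<alpha>) T T"
    using T_positive by (auto simp: is_absolute_value_def)
  obtain E where E: "orthonormal E" "total E"
    using total_orthonormal_exists by blast
  then have EH: "E \<subseteq> ?H" by (simp add: orthonormal_def)
  have onb: "orthonormal_basis ?H (PH2_inner \<alpha>) E"
    using E by (auto simp: orthonormal_basis_def orthonormal_def total_def zero_fun_def)
  have "(\<lambda>e. Re (PH2_inner \<alpha> (T e) e)) summable_on E"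
  proof (rule nonneg_bdd_above_summable_on)
    show "0 \<le> Re (PH2_inner \<alpha> (T e) e)" if "e \<in> E" for e
      using that EH by (simp add: ipT L2_inner_self subset_iff)
    \<comment> \<open>For nonnegative families, bounded finite sums suffice. Bessel's inequality for
      the kernel at w bounds the finite sum of |e(w)|^2 by K(w,w), uniformly in the
      subfamily.\<close>
    show "bdd_above (sum (\<lambda>e. Re (PH2_inner \<alpha> (T e) e)) ` {F. F \<subseteq> E \<and> finite F})"
    proof (rule bdd_aboveI2)
      fix F assume "F \<in> {F. F \<subseteq> E \<and> finite F}"
      then have F: "F \<subseteq> E" "finite F" by auto
      then have onF: "orthonormal F" using E(1) unfolding orthonormal_def by blast
      have FH: "F \<subseteq> ?H" using F EH by blast
      have "ennreal (\<Sum>e\<in>F. Re (PH2_inner \<alpha> (T e) e)) = (\<Sum>e\<in>F. (\<integral>\<^sup>+w. ennreal ((cmod (e w))\<^sup>2) \<partial>\<nu>))"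
        using FH by (subst sum_ennreal [symmetric])
          (auto simp: ipT nn_integral_sqint sq L2_inner_self intro!: sum.cong)
      also have "\<dots> = (\<integral>\<^sup>+w. (\<Sum>e\<in>F. ennreal ((cmod (e w))\<^sup>2)) \<partial>\<nu>)"
        using FH by (intro nn_integral_sum [symmetric]) (auto simp: measurable_\<mu>_\<nu> dest!: meas)
      also have "\<dots> \<le> (\<integral>\<^sup>+w. ennreal (Re (Kph \<alpha> w w)) \<partial>\<nu>)"
      proof (rule nn_integral_mono)
        fix w
        have "(\<Sum>e\<in>F. (cmod (e w))\<^sup>2) = (\<Sum>e\<in>F. (cmod (PH2_inner \<alpha> (Kph \<alpha> w) e))\<^sup>2)"
        proof (intro sum.cong refl)
          fix e assume "e \<in> F"
          then have e: "e \<in> ?H" using FH by blast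
          show "(cmod (e w))\<^sup>2 = (cmod (PH2_inner \<alpha> (Kph \<alpha> w) e))\<^sup>2"
            using hermitian [OF e Kph_in_PH2 [OF \<alpha>], of w] by (simp add: PH2_inner_Kph [OF \<alpha> e])
        qed
        also have "\<dots> \<le> Re (Kph \<alpha> w w)"
          using Bessel [OF onF F(2) Kph_in_PH2 [OF \<alpha>], of w]
          by (simp add: nrm_square Kph_in_PH2 \<alpha> PH2_inner_Kph)
        finally show "(\<Sum>e\<in>F. ennreal ((cmod (e w))\<^sup>2)) \<le> ennreal (Re (Kph \<alpha> w w))"
          by (simp add: sum_ennreal ennreal_leI)
      qed
      also have "\<dots> \<le> ennreal (2 * m)" by (rule K_bound)
      finally show "(\<Sum>e\<in>F. Re (PH2_inner \<alpha> (T e) e)) \<le> 2 * m"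
        using m(2) by simp
    qed
  qed
  then have "trace_class ?H (PH2_inner \<alpha>) T"
    unfolding trace_class_def using T_bounded T_abs onb by blast
  then show ?thesis
    unfolding toeplitz_trace_class_def T_def by blast
qed

section \<open>Trace class implies finite measure\<close>

lemma finite_if_toeplitz_trace_class:
  assumes K2: "\<And>z :: complex ^ 'n.
      (\<integral>\<^sup>+ w. ennreal ((cmod (Kph \<alpha> z w))\<^sup>2 * exp (- (norm w)\<^sup>2 / \<alpha>)) \<partial>\<mu>) < \<infinity>"
    and tc: "toeplitz_trace_class \<alpha> \<mu>"
  shows "emeasure \<mu> UNIV < \<infinity>"
proof -
  let ?H = "PH2 \<alpha> :: (complex ^ 'n \<Rightarrow> complex) set"
  interpret hilbert_form fscale ?H "PH2_inner \<alpha>"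
    by (rule hilbert_form_PH2 [OF \<alpha>])
  have meas: "f \<in> borel_measurable borel" if "f \<in> ?H" for f
    using that by (rule PH2_measurable [OF \<alpha>])
  obtain A where A: "trace_class ?H (PH2_inner \<alpha>) A"
    and A_eq: "\<And>f. f \<in> kernel_span \<alpha> \<Longrightarrow> A f = toeplitz \<alpha> \<mu> f"
    using tc unfolding toeplitz_trace_class_def by blast
  obtain P E where P: "is_absolute_value ?H (PH2_inner \<alpha>) A P" and onb: "orthonormal_basis ?H (PH2_inner \<alpha>) E"
    and sumE: "(\<lambda>e. Re (PH2_inner \<alpha> (P e) e)) summable_on E" and A_bop: "bounded_operator ?H (PH2_inner \<alpha>) A"
    using A unfolding trace_class_def by blast
  have bop: "f \<in> ?H \<Longrightarrow> T f \<in> ?H" "f \<in> ?H \<Longrightarrow> g \<in> ?H \<Longrightarrow> T (f + g) = T f + T g"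
      "f \<in> ?H \<Longrightarrow> T (fscale c f) = fscale c (T f)"
    if "bounded_operator ?H (PH2_inner \<alpha>) T" for T f g c
    using that unfolding bounded_operator_def plus_fun_def by auto
  have bop_bound: "\<exists>C. \<forall>f\<in>?H. nrm (T f) \<le> C * nrm f" if "bounded_operator ?H (PH2_inner \<alpha>) T" for T
    using that unfolding bounded_operator_def nrm_def hnorm_def by blast
  have P_bop: "bounded_operator ?H (PH2_inner \<alpha>) P" and P_pos: "\<And>f. f \<in> ?H \<Longrightarrow> PH2_inner \<alpha> (P f) f \<in> \<real>\<^sub>\<ge>\<^sub>0"
    using P unfolding is_absolute_value_def positive_operator_def by auto
  obtain Q where Q: "is_adjoint ?H (PH2_inner \<alpha>) A Q" and PQ: "\<And>f. f \<in> ?H \<Longrightarrow> P (P f) = Q (A f)"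
    using P unfolding is_absolute_value_def by blast
  note A_op = bop [OF A_bop] and P_op = bop [OF P_bop]

  have K_span: "Kph \<alpha> z \<in> kernel_span \<alpha>" for z :: "complex ^ 'n"
    unfolding kernel_span_def
    by (rule CollectI, rule exI [of _ "{z}"], rule exI [of _ "\<lambda>_. 1"]) (simp add: fun_eq_iff Kph_commute)
  \<comment> \<open>The integrability hypothesis on \<mu> says that the kernels lie in L2(\<nu>);
    this gives the \<nu>-product a meaning on their span while \<mu> may still be infinite.\<close>
  have sqK: "sqint \<nu> (Kph \<alpha> z)" for z
    unfolding sqint_def
  proof
    note [measurable] = meas [OF Kph_in_PH2 [OF \<alpha>]]
    show "Kph \<alpha> z \<in> borel_measurable \<nu>" by (simp add: measurable_\<mu>_\<nu>)
    show "(\<integral>\<^sup>+w. ennreal ((cmod (Kph \<alpha> z w))\<^sup>2) \<partial>\<nu>) < \<infinity>"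
      using K2 [of z] by (simp add: nn_integral_\<nu> mult.commute flip: ennreal_mult)
  qed
  have span_rep: "\<exists>S c. finite S \<and> f = (\<Sum>w\<in>S. fscale (c w) (Kph \<alpha> w))" if "f \<in> kernel_span \<alpha>" for f :: "complex ^ 'n \<Rightarrow> complex"
  proof -
    have "\<exists>S c. f = (\<lambda>z. \<Sum>w\<in>S. c w * Kph \<alpha> z w) \<and> finite S"
      using that by (simp add: kernel_span_def)
    then obtain S c where f: "f = (\<lambda>z. \<Sum>w\<in>S. c w * Kph \<alpha> z w)" and "finite S"
      by (elim exE conjE)
    have "f = (\<Sum>w\<in>S. fscale (c w) (Kph \<alpha> w))"
      unfolding f by (rule ext) (simp add: sum_apply Kph_commute)
    then show ?thesis using \<open>finite S\<close> by blast
  qed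
  interpret L: psd_form fscale "{f. sqint \<nu> f}" "L2_inner \<nu>" by (rule psd_form_L2)
  have span_H: "f \<in> ?H" and span_sq: "sqint \<nu> f" if ks: "f \<in> kernel_span \<alpha>" for f
  proof -
    obtain S c where f: "finite S" "f = (\<Sum>w\<in>S. fscale (c w) (Kph \<alpha> w))"
      using span_rep [OF ks] by blast
    show "f \<in> ?H"
      unfolding f(2) by (intro subspace_sum [OF subspace_H] H_closed Kph_in_PH2 \<alpha>)
    have "f \<in> {f. sqint \<nu> f}"
      unfolding f(2) by (intro subspace_sum [OF L.subspace_H] L.H_closed) (simp add: sqK)
    then show "sqint \<nu> f" by simp
  qed
  have subspace_kernel_span: "subspace (kernel_span \<alpha> :: (complex ^ 'n \<Rightarrow> complex) set)"
  proof -
    have "kernel_span \<alpha> = span (range (Kph \<alpha> :: complex ^ 'n \<Rightarrow> _))"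
    proof
      show "kernel_span \<alpha> \<subseteq> span (range (Kph \<alpha> :: complex ^ 'n \<Rightarrow> _))"
      proof
        fix f :: "complex ^ 'n \<Rightarrow> complex" assume ks: "f \<in> kernel_span \<alpha>"
        obtain S c where f: "finite S" "f = (\<Sum>w\<in>S. fscale (c w) (Kph \<alpha> w))"
          using span_rep [OF ks] by blast
        show "f \<in> span (range (Kph \<alpha>))"
          unfolding f(2) by (intro span_sum span_scale span_base rangeI)
      qed
      show "span (range (Kph \<alpha> :: complex ^ 'n \<Rightarrow> _)) \<subseteq> kernel_span \<alpha>"
      proof
        fix f :: "complex ^ 'n \<Rightarrow> complex" assume "f \<in> span (range (Kph \<alpha>))"
        then obtain F r where F: "finite F" "F \<subseteq> range (Kph \<alpha>)" "f = (\<Sum>a\<in>F. fscale (r a) a)"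
          unfolding span_explicit by blast
        then obtain S where S: "F = Kph \<alpha> ` S" "inj_on (Kph \<alpha>) S" by (meson subset_image_inj)
        have "f = (\<lambda>z. \<Sum>w\<in>S. r (Kph \<alpha> w) * Kph \<alpha> z w)"
          unfolding F(3) S(1) by (simp add: sum.reindex [OF S(2)] fun_eq_iff sum_apply Kph_commute)
        moreover have "finite S" using F(1) S finite_imageD by blast
        ultimately show "f \<in> kernel_span \<alpha>"
          unfolding kernel_span_def by (intro CollectI exI [of _ S] exI [of _ "\<lambda>w. r (Kph \<alpha> w)"]) simp
      qed
    qed
    then show ?thesis by (simp add: subspace_span)
  qed
  have total_span: "total (kernel_span \<alpha>)"
    unfolding total_def
  proof (intro ballI impI)
    fix f assume "f \<in> ?H" "\<forall>e\<in>kernel_span \<alpha>. PH2_inner \<alpha> f e = 0"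
    then show "f = 0" using K_span PH2_inner_Kph [OF \<alpha>, of f] by (simp add: fun_eq_iff)
  qed

  \<comment> \<open>Pairing \<open>A f\<close> with a kernel evaluates it, and the value is the
    Toeplitz integral, the \<nu>-product of f with that kernel. Expanding the second f into kernels
    finishes by sesquilinearity, without interchanging integrals.\<close>
  have A_span: "PH2_inner \<alpha> (A f) f = L2_inner \<nu> f f" if f: "f \<in> kernel_span \<alpha>" for f
  proof -
    obtain S c where fS: "finite S" "f = (\<Sum>w\<in>S. fscale (c w) (Kph \<alpha> w))"
      using span_rep [OF f] by blast
    have Af: "A f \<in> ?H" using A_op(1) [OF span_H [OF f]] .
    have AfK: "PH2_inner \<alpha> (A f) (Kph \<alpha> w) = L2_inner \<nu> f (Kph \<alpha> w)" for w
    proof -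
      have "PH2_inner \<alpha> (A f) (Kph \<alpha> w) = toeplitz \<alpha> \<mu> f w"
        using PH2_inner_Kph [OF \<alpha> Af] A_eq [OF f] by simp
      also have "\<dots> = L2_inner \<nu> f (Kph \<alpha> w)"
        unfolding toeplitz_eq [OF meas [OF span_H [OF f]]] L2_inner_def by (simp add: mult.commute)
      finally show ?thesis .
    qed
    have "PH2_inner \<alpha> (A f) (\<Sum>w\<in>S. fscale (c w) (Kph \<alpha> w)) = (\<Sum>w\<in>S. cnj (c w) * PH2_inner \<alpha> (A f) (Kph \<alpha> w))"
      by (subst sum_right) (auto simp: fS(1) Af scale_right Kph_in_PH2 \<alpha>)
    also have "\<dots> = L2_inner \<nu> f (\<Sum>w\<in>S. fscale (c w) (Kph \<alpha> w))"
      by (subst L.sum_right) (auto simp: fS(1) L.scale_right sqK sqint_cmult span_sq f AfK)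
    finally show ?thesis by (simp only: fS(2) [symmetric])
  qed

  \<comment> \<open>Approximation by the kernel span: boundedness of \<open>A\<close> makes its
    quadratic form continuous, norm convergence forces pointwise convergence, and Fatou's lemma
    passes the identity to the limit as an inequality, in the direction required.\<close>
  have A_form: "Im (PH2_inner \<alpha> (A f) f) = 0"
    "(\<integral>\<^sup>+w. ennreal ((cmod (f w))\<^sup>2) \<partial>\<nu>) \<le> ennreal (Re (PH2_inner \<alpha> (A f) f))"
    "0 \<le> Re (PH2_inner \<alpha> (A f) f)" if f: "f \<in> ?H" for f
  proof -
    have "\<exists>v\<in>kernel_span \<alpha>. nrm (f - v) < 1 / real (Suc n)" for n
      by (rule dense_if_total [OF subspace_kernel_span _ total_span f]) (use span_H in auto)
    then obtain g where g: "\<And>n. g n \<in> kernel_span \<alpha>" and g_lt: "\<And>n. nrm (f - g n) < 1 / real (Suc n)"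
      by metis
    note gH = span_H [OF g]
    have lim0: "(\<lambda>n. nrm (f - g n)) \<longlonglongrightarrow> 0"
    proof (rule real_tendsto_sandwich [OF _ _ tendsto_const LIMSEQ_inverse_real_of_nat])
      show "\<forall>\<^sub>F n in sequentially. nrm (f - g n) \<le> inverse (real (Suc n))"
        using g_lt by (auto simp: inverse_eq_divide less_imp_le)
    qed (use f gH in auto)
    obtain C where C: "\<And>f. f \<in> ?H \<Longrightarrow> nrm (A f) \<le> C * nrm f"
      using bop_bound [OF A_bop] by blast
    have lim: "(\<lambda>n. PH2_inner \<alpha> (A (g n)) (g n)) \<longlonglongrightarrow> PH2_inner \<alpha> (A f) f"
    proof -
      let ?d = "\<lambda>n. nrm (f - g n)"
      have "(\<lambda>n. C * ?d n * nrm f + \<bar>C\<bar> * (nrm f + ?d n) * ?d n) \<longlonglongrightarrow> C * 0 * nrm f + \<bar>C\<bar> * (nrm f + 0) * 0"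
        by (intro tendsto_add tendsto_mult tendsto_const lim0)
      then have rhs: "(\<lambda>n. C * ?d n * nrm f + \<bar>C\<bar> * (nrm f + ?d n) * ?d n) \<longlonglongrightarrow> 0"
        by simp
      have "norm (PH2_inner \<alpha> (A (g n)) (g n) - PH2_inner \<alpha> (A f) f) \<le> C * ?d n * nrm f + \<bar>C\<bar> * (nrm f + ?d n) * ?d n" for n
      proof -
        have d: "f - g n \<in> ?H" using f gH by simp
        have Ad: "A (f - g n) \<in> ?H" "A (g n) \<in> ?H" using A_op(1) d gH by auto
        have "A f = A (f - g n) + A (g n)"
          using A_op(2) [OF d gH [of n]] by simp
        then have "PH2_inner \<alpha> (A f) f = PH2_inner \<alpha> (A (f - g n)) f + PH2_inner \<alpha> (A (g n)) f"
          by (simp add: add_left Ad f)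
        also have "PH2_inner \<alpha> (A (g n)) f = PH2_inner \<alpha> (A (g n)) (f - g n) + PH2_inner \<alpha> (A (g n)) (g n)"
          using add_right [OF d gH [of n] Ad(2)] by simp
        finally have split: "PH2_inner \<alpha> (A f) f = PH2_inner \<alpha> (A (f - g n)) f
            + (PH2_inner \<alpha> (A (g n)) (f - g n) + PH2_inner \<alpha> (A (g n)) (g n))" .
        have "norm (PH2_inner \<alpha> (A (g n)) (g n) - PH2_inner \<alpha> (A f) f)
            = norm (PH2_inner \<alpha> (A (f - g n)) f + PH2_inner \<alpha> (A (g n)) (f - g n))"
          unfolding split by (subst norm_minus_commute) (simp add: algebra_simps)
        also have "\<dots> \<le> nrm (A (f - g n)) * nrm f + nrm (A (g n)) * ?d n"
          using Cauchy_Schwarz_nrm [OF Ad(1) f] Cauchy_Schwarz_nrm [OF Ad(2) d] by (intro norm_triangle_le) simp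
        also have "\<dots> \<le> C * ?d n * nrm f + \<bar>C\<bar> * (nrm f + ?d n) * ?d n"
        proof (intro add_mono mult_right_mono C d)
          have "nrm (g n) \<le> nrm f + ?d n"
            using nrm_triangle [of f "g n - f"] nrm_minus_commute [OF f gH [of n]] f gH by simp
          then have "\<bar>C\<bar> * nrm (g n) \<le> \<bar>C\<bar> * (nrm f + ?d n)" by (rule mult_left_mono) simp
          moreover have "C * nrm (g n) \<le> \<bar>C\<bar> * nrm (g n)" using gH by (intro mult_right_mono) auto
          ultimately show "nrm (A (g n)) \<le> \<bar>C\<bar> * (nrm f + ?d n)" using C [OF gH [of n]] by linarith
        qed (use f d in auto)
        finally show ?thesis .
      qed
      then have "(\<lambda>n. PH2_inner \<alpha> (A (g n)) (g n) - PH2_inner \<alpha> (A f) f) \<longlonglongrightarrow> 0"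
        by (intro Lim_null_comparison [OF _ rhs] always_eventually allI)
      then show ?thesis by (simp add: LIM_zero_iff)
    qed
    have Ag: "PH2_inner \<alpha> (A (g n)) (g n) = of_real (\<integral>w. (cmod (g n w))\<^sup>2 \<partial>\<nu>)" for n
      using A_span [OF g] by (simp add: L2_inner_self)
    have "(\<lambda>n. Im (PH2_inner \<alpha> (A (g n)) (g n))) \<longlonglongrightarrow> Im (PH2_inner \<alpha> (A f) f)"
      by (intro tendsto_intros lim)
    then show "Im (PH2_inner \<alpha> (A f) f) = 0"
      by (simp add: Ag LIMSEQ_const_iff)
    have lim_Re: "(\<lambda>n. Re (PH2_inner \<alpha> (A (g n)) (g n))) \<longlonglongrightarrow> Re (PH2_inner \<alpha> (A f) f)"
      by (intro tendsto_intros lim)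
    then show "0 \<le> Re (PH2_inner \<alpha> (A f) f)"
      by (rule LIMSEQ_le_const) (simp add: Ag)
    have g_lim: "(\<lambda>n. g n z) \<longlonglongrightarrow> f z" for z
    proof -
      have "(\<lambda>n. nrm (f - g n) * nrm (Kph \<alpha> z)) \<longlonglongrightarrow> 0"
        using tendsto_mult_left_zero [OF lim0] .
      moreover have "norm (g n z - f z) \<le> nrm (f - g n) * nrm (Kph \<alpha> z)" for n
        using Cauchy_Schwarz_nrm [of "f - g n" "Kph \<alpha> z"] f gH
        by (simp add: PH2_inner_Kph \<alpha> Kph_in_PH2 norm_minus_commute)
      ultimately have "(\<lambda>n. g n z - f z) \<longlonglongrightarrow> 0"
        by (intro Lim_null_comparison [of "\<lambda>n. g n z - f z"] always_eventually allI)
      then show ?thesis by (simp add: LIM_zero_iff)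
    qed
    have "(\<integral>\<^sup>+w. ennreal ((cmod (f w))\<^sup>2) \<partial>\<nu>) = (\<integral>\<^sup>+w. liminf (\<lambda>n. ennreal ((cmod (g n w))\<^sup>2)) \<partial>\<nu>)"
      by (intro nn_integral_cong lim_imp_Liminf [symmetric] tendsto_intros g_lim) simp
    also have "\<dots> \<le> liminf (\<lambda>n. \<integral>\<^sup>+w. ennreal ((cmod (g n w))\<^sup>2) \<partial>\<nu>)"
    proof (rule nn_integral_liminf)
      fix n
      note [measurable] = meas [OF gH [of n]]
      show "(\<lambda>w. ennreal ((cmod (g n w))\<^sup>2)) \<in> borel_measurable \<nu>"
        by (simp add: measurable_\<mu>_\<nu>)
    qed
    also have "\<dots> = liminf (\<lambda>n. ennreal (Re (PH2_inner \<alpha> (A (g n)) (g n))))"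
      by (simp add: nn_integral_sqint span_sq g A_span)
    also have "\<dots> = ennreal (Re (PH2_inner \<alpha> (A f) f))"
      by (intro lim_imp_Liminf tendsto_ennrealI lim_Re) simp
    finally show "(\<integral>\<^sup>+w. ennreal ((cmod (f w))\<^sup>2) \<partial>\<nu>) \<le> ennreal (Re (PH2_inner \<alpha> (A f) f))" .
  qed

  have P_re: "Im (PH2_inner \<alpha> (P f) f) = 0" "0 \<le> Re (PH2_inner \<alpha> (P f) f)" if "f \<in> ?H" for f
    using P_pos [OF that] by (simp_all add: complex_nonneg_Reals_iff)
  have P_sym: "PH2_inner \<alpha> (P f) g = PH2_inner \<alpha> f (P g)" if "f \<in> ?H" "g \<in> ?H" for f g
    by (rule symmetric_if_real [OF P_op P_re(1)]) (use that in auto)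
  have A_sym: "PH2_inner \<alpha> (A f) g = PH2_inner \<alpha> f (A g)" if "f \<in> ?H" "g \<in> ?H" for f g
    by (rule symmetric_if_real [OF A_op A_form(1)]) (use that in auto)
  have nrm_AP: "nrm (A f) = nrm (P f)" if f: "f \<in> ?H" for f
  proof -
    have Pf: "P f \<in> ?H" and Af: "A f \<in> ?H" using P_op(1) [OF f] A_op(1) [OF f] by auto
    have "PH2_inner \<alpha> (P f) (P f) = PH2_inner \<alpha> f (P (P f))" by (rule P_sym [OF f Pf])
    also have "\<dots> = PH2_inner \<alpha> f (Q (A f))" by (simp add: PQ f)
    also have "\<dots> = PH2_inner \<alpha> (A f) (A f)"
      using Q f Af unfolding is_adjoint_def by simp
    finally show ?thesis by (simp add: nrm_def)
  qed
  obtain CA where CA: "\<And>f. f \<in> ?H \<Longrightarrow> nrm (A f) \<le> CA * nrm f"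
    using bop_bound [OF A_bop] by blast
  obtain CP where CP: "\<And>f. f \<in> ?H \<Longrightarrow> nrm (P f) \<le> CP * nrm f"
    using bop_bound [OF P_bop] by blast
  \<comment> \<open>\<open>P\<close> enters through its positivity, boundedness and symmetry, and
    through equality of the norms of \<open>A f\<close> and \<open>P f\<close>, a consequence of P P
    = A^* A.\<close>
  have A_le_P: "Re (PH2_inner \<alpha> (A f) f) \<le> Re (PH2_inner \<alpha> (P f) f)" if f: "f \<in> ?H" for f
    by (rule symmetric_le_absolute_value [OF A_op CA A_sym P_op CP P_sym P_re(2) nrm_AP f])

  have E: "orthonormal E" "total E"
    using onb by (auto simp: orthonormal_basis_def orthonormal_def total_def zero_fun_def)
  then have EH: "E \<subseteq> ?H" by (simp add: orthonormal_def)
  have KE: "(cmod (PH2_inner \<alpha> (Kph \<alpha> w) e))\<^sup>2 = (cmod (e w))\<^sup>2" if "e \<in> E" for e w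
  proof -
    have e: "e \<in> ?H" using that EH by blast
    show ?thesis
      using hermitian [OF e Kph_in_PH2 [OF \<alpha>], of w] by (simp add: PH2_inner_Kph [OF \<alpha> e])
  qed
  \<comment> \<open>Monotone convergence below needs a sequence. By Bessel, at each point only
    countably many basis functions are nonzero; by continuity, each basis function is nonzero
    somewhere on a countable dense set.\<close>
  have "countable E"
  proof -
    obtain D :: "(complex ^ 'n) set" where D: "countable D" "\<And>X. open X \<Longrightarrow> X \<noteq> {} \<Longrightarrow> \<exists>d\<in>D. d \<in> X"
      by (rule countable_dense_setE) blast
    have "countable {e \<in> E. (cmod (e z))\<^sup>2 \<noteq> 0}" for z
    proof (rule summable_countable_real, rule nonneg_bdd_above_summable_on)
      show "bdd_above (sum (\<lambda>e. (cmod (e z))\<^sup>2) ` {F. F \<subseteq> E \<and> finite F})"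
      proof (rule bdd_aboveI2)
        fix F assume "F \<in> {F. F \<subseteq> E \<and> finite F}"
        then have F: "F \<subseteq> E" "finite F" by auto
        then have "orthonormal F" using E(1) unfolding orthonormal_def by blast
        from Bessel [OF this F(2) Kph_in_PH2 [OF \<alpha>], of z]
        show "(\<Sum>e\<in>F. (cmod (e z))\<^sup>2) \<le> (nrm (Kph \<alpha> z))\<^sup>2"
          using F(1) KE by (simp add: subset_iff cong: sum.cong)
      qed
    qed simp
    moreover have "E \<subseteq> (\<Union>z\<in>D. {e \<in> E. (cmod (e z))\<^sup>2 \<noteq> 0})"
    proof
      fix e assume e: "e \<in> E"
      then have "PH2_inner \<alpha> e e = 1" using E(1) by (simp add: orthonormal_def)
      then have "e \<noteq> 0" using zero_left [OF H_closed(1)] by auto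
      then obtain z where "e z \<noteq> 0" by (auto simp: fun_eq_iff)
      moreover have "open {z. e z \<noteq> 0}"
        using PH2_continuous [OF \<alpha>, of e] e EH by (intro open_Collect_neq continuous_on_const) auto
      ultimately obtain d where "d \<in> D" "e d \<noteq> 0" using D(2) [of "{z. e z \<noteq> 0}"] by blast
      then show "e \<in> (\<Union>z\<in>D. {e \<in> E. (cmod (e z))\<^sup>2 \<noteq> 0})" using e by auto
    qed
    ultimately show ?thesis using D(1) countable_subset by (meson countable_UN)
  qed

  \<comment> \<open>Basis vectors with code at most n: finite sets that increase and exhaust E, also
    when E is finite.\<close>
  define F where "F n = {e \<in> E. to_nat_on E e \<le> n}" for n :: nat
  have F: "finite (F n)" "F n \<subseteq> E" "m \<le> n \<Longrightarrow> F m \<subseteq> F n" for m n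
  proof -
    have "inj_on (to_nat_on E) (F n)"
      using inj_on_to_nat_on [OF \<open>countable E\<close>] by (rule inj_on_subset) (auto simp: F_def)
    moreover have "to_nat_on E ` F n \<subseteq> {..n}" by (auto simp: F_def)
    ultimately show "finite (F n)" by (rule inj_on_finite) simp
  qed (auto simp: F_def)
  have F_cover: "\<exists>n. X \<subseteq> F n" if "finite X" "X \<subseteq> E" for X
  proof (intro exI subsetI)
    show "e \<in> F (Max (to_nat_on E ` X))" if "e \<in> X" for e
      using that \<open>finite X\<close> \<open>X \<subseteq> E\<close> by (auto simp: F_def)
  qed
  define C where "C = infsum (\<lambda>e. Re (PH2_inner \<alpha> (P e) e)) E"
  define \<phi> where "\<phi> n w = (\<Sum>e\<in>F n. ennreal ((cmod (e w))\<^sup>2))" for n w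
  have \<phi>_meas: "\<phi> n \<in> borel_measurable \<nu>" for n
    unfolding \<phi>_def measurable_\<mu>_\<nu>
  proof (rule borel_measurable_sum)
    fix e assume "e \<in> F n"
    then have [measurable]: "e \<in> borel_measurable borel" using F(2) EH meas by blast
    show "(\<lambda>w. ennreal ((cmod (e w))\<^sup>2)) \<in> borel_measurable borel" by measurable
  qed
  have \<phi>_int: "(\<integral>\<^sup>+w. \<phi> n w \<partial>\<nu>) \<le> ennreal C" for n
  proof -
    have "(\<integral>\<^sup>+w. \<phi> n w \<partial>\<nu>) = (\<Sum>e\<in>F n. \<integral>\<^sup>+w. ennreal ((cmod (e w))\<^sup>2) \<partial>\<nu>)"
      unfolding \<phi>_def
    proof (rule nn_integral_sum)
      fix e assume "e \<in> F n"
      then have [measurable]: "e \<in> borel_measurable borel" using F(2) EH meas by blast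
      show "(\<lambda>w. ennreal ((cmod (e w))\<^sup>2)) \<in> borel_measurable \<nu>" unfolding measurable_\<mu>_\<nu> by measurable
    qed
    also have "\<dots> \<le> (\<Sum>e\<in>F n. ennreal (Re (PH2_inner \<alpha> (P e) e)))"
    proof (rule sum_mono)
      fix e assume "e \<in> F n"
      then have e: "e \<in> ?H" using F(2) EH by blast
      show "(\<integral>\<^sup>+w. ennreal ((cmod (e w))\<^sup>2) \<partial>\<nu>) \<le> ennreal (Re (PH2_inner \<alpha> (P e) e))"
        using A_form(2) [OF e] ennreal_leI [OF A_le_P [OF e]] by (rule order_trans)
    qed
    also have "\<dots> = ennreal (\<Sum>e\<in>F n. Re (PH2_inner \<alpha> (P e) e))"
      using F(2) EH P_re(2) by (intro sum_ennreal) blast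
    also have "\<dots> \<le> ennreal C"
      unfolding C_def using F(1,2) EH P_re(2) by (intro ennreal_leI finite_sum_le_infsum sumE) auto
    finally show ?thesis .
  qed
  \<comment> \<open>The error 1 / 2 is reached by finitely many basis vectors at each w. Since
    K(w,w) \<ge> 1, the left side stays at least 1 / 2 and is not truncated by
    \<open>ennreal\<close>.\<close>
  have lower: "ennreal (Re (Kph \<alpha> w w) - 1 / 2) \<le> (SUP n. \<phi> n w)" for w
  proof -
    obtain X where X: "X \<subseteq> E" "finite X" "(nrm (Kph \<alpha> w))\<^sup>2 - 1 / 2 \<le> (\<Sum>e\<in>X. (cmod (PH2_inner \<alpha> (Kph \<alpha> w) e))\<^sup>2)"
      using Parseval_lower [OF E Kph_in_PH2 [OF \<alpha>], of "1 / 2" w] by auto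
    obtain n where n: "X \<subseteq> F n" using F_cover [OF X(2,1)] by blast
    have "Re (Kph \<alpha> w w) - 1 / 2 \<le> (\<Sum>e\<in>X. (cmod (e w))\<^sup>2)"
      using X KE by (simp add: nrm_square Kph_in_PH2 \<alpha> PH2_inner_Kph subset_iff cong: sum.cong)
    also have "\<dots> \<le> (\<Sum>e\<in>F n. (cmod (e w))\<^sup>2)"
      by (intro sum_mono2 F n) simp
    finally have "ennreal (Re (Kph \<alpha> w w) - 1 / 2) \<le> \<phi> n w"
      unfolding \<phi>_def by (simp add: sum_ennreal ennreal_leI)
    also have "\<dots> \<le> (SUP n. \<phi> n w)" by (rule SUP_upper) simp
    finally show ?thesis .
  qed
  have Kmeas: "(\<lambda>w :: complex ^ 'n. ennreal (Re (Kph \<alpha> w w) - 1 / 2)) \<in> borel_measurable borel"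
    unfolding Kph_self [OF \<alpha>] by measurable
  have "ennreal (1 / 2) * emeasure \<mu> UNIV = (\<integral>\<^sup>+w. ennreal (1 / 2) \<partial>\<mu>)"
    using sets_eq_imp_space_eq [OF sets_\<mu>] by simp
  also have "\<dots> \<le> (\<integral>\<^sup>+w. ennreal (exp (- (norm w)\<^sup>2 / \<alpha>)) * ennreal (Re (Kph \<alpha> w w) - 1 / 2) \<partial>\<mu>)"
  proof (rule nn_integral_mono)
    fix w :: "complex ^ 'n"
    define a where "a = (norm w)\<^sup>2 / \<alpha>"
    have "0 \<le> a" using \<alpha> by (simp add: a_def)
    then have "exp (- a) \<le> 1" and ge: "1 \<le> exp a" by simp_all
    \<comment> \<open>The right side is 2 - (3 / 2) exp (-a), and exp (-a) \<le> 1.\<close>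
    have "1 / 2 \<le> exp (- a) * (2 * exp a - 1 - 1 / 2)"
      using ge by (simp add: exp_minus field_simps)
    then have "ennreal (1 / 2) \<le> ennreal (exp (- a) * (2 * exp a - 1 - 1 / 2))"
      by (rule ennreal_leI)
    also have "\<dots> = ennreal (exp (- a)) * ennreal (2 * exp a - 1 - 1 / 2)"
      by (rule ennreal_mult) (simp, use ge in linarith)
    finally show "ennreal (1 / 2) \<le> ennreal (exp (- (norm w)\<^sup>2 / \<alpha>)) * ennreal (Re (Kph \<alpha> w w) - 1 / 2)"
      unfolding Kph_self [OF \<alpha>] by (simp add: a_def)
  qed
  also have "\<dots> = (\<integral>\<^sup>+w. ennreal (Re (Kph \<alpha> w w) - 1 / 2) \<partial>\<nu>)"
    by (rule nn_integral_\<nu> [OF Kmeas, symmetric])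
  also have "\<dots> \<le> (\<integral>\<^sup>+w. (SUP n. \<phi> n w) \<partial>\<nu>)"
    by (intro nn_integral_mono lower)
  also have "\<dots> = (SUP n. \<integral>\<^sup>+w. \<phi> n w \<partial>\<nu>)"
  proof (rule nn_integral_monotone_convergence_SUP [OF _ \<phi>_meas])
    show "incseq \<phi>"
      unfolding incseq_def le_fun_def \<phi>_def by (intro allI impI sum_mono2 F) auto
  qed
  also have "\<dots> \<le> ennreal C" by (intro SUP_least \<phi>_int)
  finally have "ennreal (1 / 2) * emeasure \<mu> UNIV < \<infinity>"
    using le_less_trans by fastforce
  then show ?thesis by (auto simp: ennreal_mult_less_top)
qed

end

theorem proposition3p3:
  fixes \<alpha> :: real and \<mu> :: "(complex ^ 'n) measure"
  assumes "\<alpha> > 0"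
    and "sets \<mu> = sets borel"
    and "\<And>z :: complex ^ 'n.
           (\<integral>\<^sup>+ w. ennreal ((cmod (Kph \<alpha> z w))\<^sup>2 * exp (- (norm w)\<^sup>2 / \<alpha>)) \<partial>\<mu>) < \<infinity>"
  shows "toeplitz_trace_class \<alpha> \<mu> \<longleftrightarrow> emeasure \<mu> UNIV < \<infinity>"
  using toeplitz_trace_class_if_finite [OF assms(1,2)] finite_if_toeplitz_trace_class [OF assms]
  by blast

end
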